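(* Let $f=\sum_{v\in I}\alpha(v)\phi v$ be a (finite) sum of counting quasimorphisms on $F_d$, $d\geq 2$. Then $f$ is equivalent to $\lambda\,\mathrm{rot}+g$, where $\lambda$ is a real number and $g$ is a sum of counting quasimorphisms that is speed reduced for $T^{-1}$. In particular $\mathrm{sp}_S(T^{-1},[f])=\mathrm{sp}_S(T^{-1},[g])$.
   Context: $F_d$ is the free group on $S=\{a_1,\dots,a_d\}$; $a=a_1$, $b=a_2$, $\bar S=S\cup S^{-1}$, $S_b=\bar S\setminus\{b,b^{-1}\}$; elements are reduced words, $|v|_S$ is word length. $T$ is the automorphism $a\mapsto ab$ fixing all other generators. For a reduced word $v\neq e$, $\#v(w)$ is the number of (possibly overlapping) occurrences of $v$ as a contiguous subword of the reduced word $w$; $\phi v=\#v-\#(v^{-1})$. $f_1\sim f_2$ ("equivalent") iff $f_1-f_2$ is bounded. $\mathcal{C}(F_d,S)$ is the real span of the (linearly independent) $\#v$, $v\ne e$; for $f=\sum\alpha(v)\#v$, $\|f\|_S=\max\{|v|_S:\alpha(v)\neq0\}$ ($0$ if $f=0$) and $|f|_S=\min\{\|g\|_S:g\in\mathcal{C}(F_d,S),g\sim f\}$. $\mathcal{B}(F_d)$ is the span of the $\phi v$, $\tilde{\mathcal{B}}(F_d)=\mathcal{B}(F_d)/\sim$, $|[f]|_S=|f|_S$. $\mathrm{Out}(F_d)$ acts by $X[f]=[f\circ X^{-1}]$. The speed of $X$ on $[f]$ is $\mathrm{sp}_S(X,[f])=\lim_n|X^n[f]|_S/n$; it exists if this limit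 exists in $\mathbb{R}$. A sum of counting quasimorphisms $g=\sum_{v\in J}\beta(v)\phi v$ (with this representation) is speed reduced for $X$ if the speeds of $X$ on $[g]$ and on all $[\phi v]$, $v\in\mathrm{supp}(\beta)$, exist and $\mathrm{sp}_S(X,[g])=\sup_{v\in\mathrm{supp}(\beta)}\mathrm{sp}_S(X,[\phi v])$ (supremum over the empty set being $0$). Finally $\mathrm{rot}=\phi(ab)-\sum_{s\in S_b\setminus\{a^{-1}\}}\phi(bs)$. *)

theory Defs
  imports Complex_Main "HOL-Algebra.Bij"
begin

section \<open>The free group as the group of reduced words\<close>

text \<open>The letter \<open>(i, True)\<close> is the generator \<open>a\<^sub>i\<close> and \<open>(i, False)\<close> is its inverse.
  The generators of \<open>F\<^sub>d\<close> are \<open>a\<^sub>1, \<dots>, a\<^sub>d\<close>.\<close>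

type_synonym letter = "nat \<times> bool"
type_synonym word = "letter list"

definition letter_inv :: "letter \<Rightarrow> letter" where
  "letter_inv x = (fst x, \<not> snd x)"

definition word_inv :: "word \<Rightarrow> word" where
  "word_inv w = rev (map letter_inv w)"

definition letters :: "nat \<Rightarrow> letter set" where
  "letters d = {1..d} \<times> UNIV"

definition reduced :: "word \<Rightarrow> bool" where
  "reduced w \<longleftrightarrow> successively (\<lambda>x y. y \<noteq> letter_inv x) w"

fun push :: "letter \<Rightarrow> word \<Rightarrow> word" where
  "push x [] = [x]"
| "push x (y # ys) = (if y = letter_inv x then ys else x # y # ys)"

definition reduce :: "word \<Rightarrow> word" where
  "reduce w = foldr push w []"

definition free_group :: "nat \<Rightarrow> word monoid" where
  "free_group d =
     \<lparr>carrier = {w. reduced w \<and> set w \<subseteq> letters d}, mult = (\<lambda>u v. reduce (u @ v)), one = []\<rparr>"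

text \<open>The endomorphism of the free group that sends \<open>a\<^sub>i\<close> to \<open>g i\<close>.\<close>

definition extend_hom :: "(nat \<Rightarrow> word) \<Rightarrow> word \<Rightarrow> word" where
  "extend_hom g w = reduce (concat (map (\<lambda>(i, e). if e then g i else word_inv (g i)) w))"

text \<open>The automorphism \<open>T\<close>: \<open>a\<^sub>1 \<mapsto> a\<^sub>1 a\<^sub>2\<close>, all other generators fixed. It is made
  extensional so that it is an element of \<^const>\<open>AutoGroup\<close>.\<close>

definition twist :: "nat \<Rightarrow> word \<Rightarrow> word" where
  "twist d = restrict (extend_hom (\<lambda>i. if i = 1 then [(1, True), (2, True)] else [(i, True)]))
               (carrier (free_group d))"

section \<open>Counting functions and counting quasimorphisms\<close>

definition nontriv :: "nat \<Rightarrow> word set" where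
  "nontriv d = carrier (free_group d) - {\<one>\<^bsub>free_group d\<^esub>}"

definition occ :: "word \<Rightarrow> word \<Rightarrow> real" where
  "occ v w = real (card {(p, q). w = p @ v @ q})"

definition phi :: "word \<Rightarrow> word \<Rightarrow> real" where
  "phi v w = occ v w - occ (word_inv v) w"

definition supp :: "word set \<Rightarrow> (word \<Rightarrow> real) \<Rightarrow> word set" where
  "supp I \<alpha> = {v \<in> I. \<alpha> v \<noteq> 0}"

definition occ_sum :: "word set \<Rightarrow> (word \<Rightarrow> real) \<Rightarrow> word \<Rightarrow> real" where
  "occ_sum I \<alpha> w = (\<Sum>v\<in>I. \<alpha> v * occ v w)"

definition phi_sum :: "word set \<Rightarrow> (word \<Rightarrow> real) \<Rightarrow> word \<Rightarrow> real" where
  "phi_sum I \<alpha> w = (\<Sum>v\<in>I. \<alpha> v * phi v w)"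

text \<open>The norm of \<open>occ_sum I \<alpha>\<close>, which is a function of the coefficients because the
  counting functions are linearly independent.\<close>

definition coeff_norm :: "word set \<Rightarrow> (word \<Rightarrow> real) \<Rightarrow> nat" where
  "coeff_norm I \<alpha> = Max (insert 0 (length ` supp I \<alpha>))"

text \<open>Functions on \<open>F\<^sub>d\<close> are functions on all words of which only the values on
  the carrier matter.\<close>

definition equivalent :: "nat \<Rightarrow> (word \<Rightarrow> real) \<Rightarrow> (word \<Rightarrow> real) \<Rightarrow> bool" where
  "equivalent d f h \<longleftrightarrow> (\<exists>C. \<forall>w\<in>carrier (free_group d). \<bar>f w - h w\<bar> \<le> C)"

definition eq_class :: "nat \<Rightarrow> (word \<Rightarrow> real) \<Rightarrow> (word \<Rightarrow> real) set" where
  "eq_class d f = {h. equivalent d f h}"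

text \<open>The minimum of the norms of the elements of the span of the counting functions that
  lie in the class \<open>c\<close>.\<close>

definition class_norm :: "nat \<Rightarrow> (word \<Rightarrow> real) set \<Rightarrow> nat" where
  "class_norm d c =
     (LEAST k. \<exists>I \<alpha>. finite I \<and> I \<subseteq> nontriv d \<and> occ_sum I \<alpha> \<in> c \<and> coeff_norm I \<alpha> = k)"

section \<open>The action on classes and the speed\<close>

text \<open>The action of an outer automorphism is that of any automorphism \<open>X\<close> representing it:
  inner automorphisms act trivially on classes of sums of counting quasimorphisms.\<close>

definition act :: "nat \<Rightarrow> (word \<Rightarrow> word) \<Rightarrow> (word \<Rightarrow> real) set \<Rightarrow> (word \<Rightarrow> real) set" where
  "act d X c = (\<Union>f\<in>c. eq_class d (f \<circ> inv\<^bsub>AutoGroup (free_group d)\<^esub> X))"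

definition speed_seq :: "nat \<Rightarrow> (word \<Rightarrow> word) \<Rightarrow> (word \<Rightarrow> real) set \<Rightarrow> nat \<Rightarrow> real" where
  "speed_seq d X c n =
     real (class_norm d (act d (X [^]\<^bsub>AutoGroup (free_group d)\<^esub> n) c)) / real n"

definition speed_exists :: "nat \<Rightarrow> (word \<Rightarrow> word) \<Rightarrow> (word \<Rightarrow> real) set \<Rightarrow> bool" where
  "speed_exists d X c \<longleftrightarrow> convergent (speed_seq d X c)"

definition speed :: "nat \<Rightarrow> (word \<Rightarrow> word) \<Rightarrow> (word \<Rightarrow> real) set \<Rightarrow> real" where
  "speed d X c = lim (speed_seq d X c)"

definition speed_reduced :: "nat \<Rightarrow> (word \<Rightarrow> word) \<Rightarrow> word set \<Rightarrow> (word \<Rightarrow> real) \<Rightarrow> bool" where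
  "speed_reduced d X J \<beta> \<longleftrightarrow>
     speed_exists d X (eq_class d (phi_sum J \<beta>)) \<and>
     (\<forall>v\<in>supp J \<beta>. speed_exists d X (eq_class d (phi v))) \<and>
     speed d X (eq_class d (phi_sum J \<beta>)) =
       (if supp J \<beta> = {} then 0 else (SUP v\<in>supp J \<beta>. speed d X (eq_class d (phi v))))"

definition rot :: "nat \<Rightarrow> word \<Rightarrow> real" where
  "rot d w =
     phi [(1, True), (2, True)] w -
     (\<Sum>s\<in>letters d - {(2, True), (2, False)} - {(1, False)}. phi [(2, True), s] w)"

section \<open>Well-definedness\<close>

lemma letter_inv_inv [simp]: "letter_inv (letter_inv x) = x"
  by (simp add: letter_inv_def)

lemma letter_inv_neq [simp]: "letter_inv x \<noteq> x" "x \<noteq> letter_inv x"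
  by (auto simp: letter_inv_def prod_eq_iff)

lemma letter_inv_in [simp]: "letter_inv x \<in> letters d \<longleftrightarrow> x \<in> letters d"
  by (auto simp: letter_inv_def letters_def mem_Times_iff)

lemma reduced_push: "reduced v \<Longrightarrow> reduced (push x v)"
  by (cases v) (auto simp: reduced_def successively_Cons)

lemma push_push: "reduced v \<Longrightarrow> push x (push (letter_inv x) v) = v"
  by (cases v; cases "tl v") (auto simp: reduced_def successively_Cons)

lemma reduced_foldr: "reduced v \<Longrightarrow> reduced (foldr push u v)"
  by (induction u) (auto intro: reduced_push)

lemma reduced_reduce: "reduced (reduce w)"
  unfolding reduce_def by (rule reduced_foldr) (simp add: reduced_def)

lemma reduce_id: "reduced w \<Longrightarrow> reduce w = w"
proof (induction w)
  case (Cons x w)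
  then have "reduce w = w" by (auto simp: reduced_def successively_Cons)
  with Cons.prems show ?case
    by (cases w) (auto simp: reduce_def reduced_def)
qed (simp add: reduce_def)

lemma foldr_push: "reduced v \<Longrightarrow> foldr push (push x u) v = push x (foldr push u v)"
proof (cases u)
  case (Cons y ys)
  assume "reduced v"
  then show ?thesis using Cons push_push[OF reduced_foldr[of v ys], of x] by auto
qed simp

lemma foldr_reduce: "reduced v \<Longrightarrow> foldr push (reduce u) v = foldr push u v"
  by (induction u) (auto simp: reduce_def foldr_push)

lemma reduce_append_left: "reduce (reduce u @ v) = reduce (u @ v)"
  using foldr_reduce[OF reduced_reduce[of v]] by (simp add: reduce_def)

lemma reduce_append_right: "reduce (u @ reduce v) = reduce (u @ v)"
  using reduce_id[OF reduced_reduce[of v]] by (simp add: reduce_def)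

lemma set_reduce: "set (reduce w) \<subseteq> set w"
proof (induction w)
  case (Cons x w)
  then show ?case by (cases "reduce w") (auto simp: reduce_def split: if_splits)
qed (simp add: reduce_def)

lemma word_inv_append: "word_inv (u @ v) = word_inv v @ word_inv u"
  by (simp add: word_inv_def)

lemma word_inv_inv [simp]: "word_inv (word_inv w) = w"
  by (simp add: word_inv_def rev_map[symmetric] map_idI)

lemma set_word_inv: "set (word_inv w) \<subseteq> letters d \<longleftrightarrow> set w \<subseteq> letters d"
  by (auto simp: word_inv_def)

lemma reduced_word_inv: "reduced w \<Longrightarrow> reduced (word_inv w)"
  unfolding reduced_def word_inv_def
  by (auto simp: successively_map elim!: successively_mono)

lemma reduce_word_inv_append: "reduced v \<Longrightarrow> reduce (word_inv w @ w @ v) = v"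
proof (induction w arbitrary: v)
  case (Cons x w)
  have 1: "reduce (letter_inv x # x # u) = reduce u" for u
    using push_push[OF reduced_reduce[of u], of "letter_inv x"] by (simp add: reduce_def)
  have "reduce (word_inv (x # w) @ (x # w) @ v) = reduce (word_inv w @ letter_inv x # x # w @ v)"
    by (simp add: word_inv_def)
  also have "\<dots> = reduce (word_inv w @ reduce (letter_inv x # x # w @ v))"
    by (simp only: reduce_append_right)
  also have "\<dots> = reduce (word_inv w @ w @ v)"
    by (simp only: reduce_append_right 1)
  finally show ?case using Cons by simp
qed (simp add: word_inv_def reduce_id)

lemma reduce_word_inv: "reduce (word_inv w @ w) = []"
  using reduce_word_inv_append[of "[]" w] by (simp add: reduced_def)

theorem group_free_group: "group (free_group d)"
proof (rule groupI)
  fix x y z assume "x \<in> carrier (free_group d)" "y \<in> carrier (free_group d)"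
    "z \<in> carrier (free_group d)"
  show "x \<otimes>\<^bsub>free_group d\<^esub> y \<otimes>\<^bsub>free_group d\<^esub> z = x \<otimes>\<^bsub>free_group d\<^esub> (y \<otimes>\<^bsub>free_group d\<^esub> z)"
    by (simp add: free_group_def reduce_append_left reduce_append_right)
next
  fix x y assume "x \<in> carrier (free_group d)" "y \<in> carrier (free_group d)"
  then show "x \<otimes>\<^bsub>free_group d\<^esub> y \<in> carrier (free_group d)"
    using set_reduce[of "x @ y"] by (auto simp: free_group_def reduced_reduce)
next
  show "\<one>\<^bsub>free_group d\<^esub> \<in> carrier (free_group d)"
    by (simp add: free_group_def reduced_def)
next
  fix x assume "x \<in> carrier (free_group d)"
  then show "\<one>\<^bsub>free_group d\<^esub> \<otimes>\<^bsub>free_group d\<^esub> x = x"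
    by (simp add: free_group_def reduce_id)
next
  fix x assume x: "x \<in> carrier (free_group d)"
  show "\<exists>y\<in>carrier (free_group d). y \<otimes>\<^bsub>free_group d\<^esub> x = \<one>\<^bsub>free_group d\<^esub>"
    by (rule bexI[of _ "word_inv x"])
      (use x in \<open>auto simp: free_group_def reduce_word_inv reduced_word_inv set_word_inv\<close>)
qed

lemma inv_free_group:
  assumes "w \<in> carrier (free_group d)"
  shows "inv\<^bsub>free_group d\<^esub> w = word_inv w"
  using assms by (intro group.inv_equality[OF group_free_group])
    (auto simp: free_group_def reduce_word_inv reduced_word_inv set_word_inv)

abbreviation subst_word :: "(nat \<Rightarrow> word) \<Rightarrow> word \<Rightarrow> word" where
  "subst_word g w \<equiv> concat (map (\<lambda>(i, e). if e then g i else word_inv (g i)) w)"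

lemma subst_letter_inv: "subst_word g [letter_inv x] = word_inv (subst_word g [x])"
  by (cases x) (simp add: letter_inv_def)

lemma reduce_subst_reduce: "reduce (subst_word g (reduce w)) = reduce (subst_word g w)"
proof (induction w)
  case (Cons x w)
  have push: "reduce (subst_word g (push x u)) = reduce (subst_word g [x] @ subst_word g u)" for u
  proof (cases u)
    case (Cons y ys)
    show ?thesis
    proof (cases "y = letter_inv x")
      case True
      have "reduce (subst_word g [x] @ subst_word g u)
          = reduce (subst_word g [x] @ word_inv (subst_word g [x]) @ subst_word g ys)"
        using subst_letter_inv[of g x] by (simp add: Cons True)
      also have "\<dots> = reduce (subst_word g [x] @ word_inv (subst_word g [x]) @ reduce (subst_word g ys))"
        by (simp only: append_assoc[symmetric] reduce_append_right)
      also have "\<dots> = reduce (subst_word g ys)"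
        using reduce_word_inv_append[OF reduced_reduce, of "word_inv (subst_word g [x])"]
        by (simp only: word_inv_inv)
      finally show ?thesis by (simp add: Cons True)
    qed (simp add: Cons)
  qed simp
  have "reduce (subst_word g (reduce (x # w))) = reduce (subst_word g [x] @ subst_word g (reduce w))"
    using push[of "reduce w"] by (simp add: reduce_def)
  also have "\<dots> = reduce (subst_word g [x] @ subst_word g w)"
    by (subst (1 2) reduce_append_right[symmetric]) (simp only: Cons.IH)
  finally show ?case by simp
qed (simp add: reduce_def)

lemma extend_mult: "extend_hom g (reduce (u @ v)) = reduce (extend_hom g u @ extend_hom g v)"
  unfolding extend_hom_def reduce_subst_reduce by (simp add: reduce_append_left reduce_append_right)

lemma extend_carrier:
  assumes "\<And>i. i \<in> {1..d} \<Longrightarrow> set (g i) \<subseteq> letters d" and "set w \<subseteq> letters d"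
  shows "extend_hom g w \<in> carrier (free_group d)"
proof -
  have "set (subst_word g w) \<subseteq> letters d"
    using assms(2)
  proof (induction w)
    case (Cons x w)
    obtain i e where x: "x = (i, e)" by (cases x)
    have "i \<in> {1..d}" using Cons.prems by (simp add: x letters_def)
    then have "set (g i) \<subseteq> letters d" by (rule assms(1))
    then have "set (subst_word g [x]) \<subseteq> letters d" by (simp add: x set_word_inv)
    moreover have "set (subst_word g w) \<subseteq> letters d" using Cons by simp
    ultimately show ?case by simp
  qed simp
  then show ?thesis
    using set_reduce[of "subst_word g w"] by (auto simp: extend_hom_def free_group_def reduced_reduce)
qed

lemma extend_extend_id:
  assumes "\<And>i. extend_hom h (g i) = [(i, True)]" and w: "reduced w"
  shows "extend_hom h (extend_hom g w) = w"
proof -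
  have inv: "reduce (subst_word h (word_inv u)) = word_inv (reduce (subst_word h u))" for u
  proof -
    let ?A = "reduce (subst_word h (word_inv u))" and ?B = "reduce (subst_word h u)"
    have "reduce (?A @ ?B) = []"
      using extend_mult[of h "word_inv u" u] by (simp add: extend_hom_def reduce_word_inv)
        (simp add: reduce_def)
    then have "reduce (reduce (?A @ ?B) @ word_inv ?B) = reduce (word_inv ?B)" by simp
    moreover have "reduce (reduce (?A @ ?B) @ word_inv ?B) = reduce (?A @ reduce (?B @ word_inv ?B))"
      by (simp only: reduce_append_left reduce_append_right append_assoc)
    moreover have "reduce (?B @ word_inv ?B) = []"
      using reduce_word_inv[of "word_inv ?B"] by simp
    ultimately show ?thesis
      by (simp add: reduce_id reduced_reduce reduced_word_inv)
  qed
  have "reduce (subst_word h (subst_word g u)) = reduce u" for u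
  proof (induction u)
    case (Cons x u)
    obtain i e where x: "x = (i, e)" by (cases x)
    have "reduce (subst_word h (subst_word g [x])) = [x]"
      using assms(1)[of i] inv[of "g i"]
      by (cases e) (auto simp: x extend_hom_def word_inv_def letter_inv_def)
    moreover have "reduce (subst_word h (subst_word g (x # u)))
        = reduce (reduce (subst_word h (subst_word g [x])) @ reduce (subst_word h (subst_word g u)))"
      by (simp add: reduce_append_left reduce_append_right)
    ultimately show ?case
      by (simp only: Cons.IH reduce_append_right) simp
  qed simp
  then show ?thesis
    using w by (simp add: extend_hom_def reduce_subst_reduce reduce_id)
qed

theorem twist_auto:
  assumes "d \<ge> 2"
  shows "twist d \<in> carrier (AutoGroup (free_group d))"
proof -
  let ?C = "carrier (free_group d)"
  define g where "g = (\<lambda>i::nat. if i = 1 then [(1, True), (2::nat, True)] else [(i, True)])"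
  define h where "h = (\<lambda>i::nat. if i = 1 then [(1, True), (2::nat, False)] else [(i, True)])"
  have twist: "twist d = restrict (extend_hom g) ?C"
    by (simp add: twist_def g_def)
  have g: "extend_hom g w \<in> ?C" and h: "extend_hom h w \<in> ?C" if "w \<in> ?C" for w
  proof -
    have w: "set w \<subseteq> letters d" using that by (simp add: free_group_def)
    show "extend_hom g w \<in> ?C"
      by (rule extend_carrier[OF _ w]) (use assms in \<open>simp add: g_def letters_def\<close>)
    show "extend_hom h w \<in> ?C"
      by (rule extend_carrier[OF _ w]) (use assms in \<open>simp add: h_def letters_def\<close>)
  qed
  have hg: "extend_hom h (extend_hom g w) = w" and gh: "extend_hom g (extend_hom h w) = w" if "w \<in> ?C" for w
  proof -
    have w: "reduced w" using that by (simp add: free_group_def)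
    show "extend_hom h (extend_hom g w) = w"
      by (rule extend_extend_id[OF _ w])
        (simp add: extend_hom_def reduce_def g_def h_def letter_inv_def word_inv_def)
    show "extend_hom g (extend_hom h w) = w"
      by (rule extend_extend_id[OF _ w])
        (simp add: extend_hom_def reduce_def g_def h_def letter_inv_def word_inv_def)
  qed
  have "bij_betw (extend_hom g) ?C ?C"
    by (rule bij_betw_byWitness[where f' = "extend_hom h"]) (auto simp: hg gh intro: g h)
  then have "twist d \<in> Bij ?C"
    by (auto simp: twist Bij_def bij_betw_restrict_eq cong: bij_betw_cong)
  moreover have "twist d \<in> hom (free_group d) (free_group d)"
  proof (rule homI)
    fix x y assume xy: "x \<in> ?C" "y \<in> ?C"
    then have "x \<otimes>\<^bsub>free_group d\<^esub> y \<in> ?C"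
      using group_free_group[of d] by (simp add: group.is_monoid monoid.m_closed)
    then show "twist d (x \<otimes>\<^bsub>free_group d\<^esub> y) = twist d x \<otimes>\<^bsub>free_group d\<^esub> twist d y"
      using xy by (simp add: twist) (simp add: free_group_def extend_mult)
  qed (simp add: twist g)
  ultimately show ?thesis
    by (simp add: AutoGroup_def auto_def)
qed

end

theory Submission
  imports Defs "HOL-Library.Sublist"
begin

text \<open>Write a reduced word as non-\<open>b\<close> letters separated by powers of \<open>b\<close>. Between consecutive
  non-\<open>b\<close> letters \<open>t\<close> and \<open>s\<close> the automorphism \<open>T\<^sup>n\<close> changes the exponent of \<open>b\<close> by
  \<open>n ([t = a] - [s = a\<inverse>])\<close> and, apart from the powers of \<open>b\<close> at the two ends, changes nothing else. The link between \<open>t\<close> and \<open>s\<close> is called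
  stretched if this shift is not zero. The \<open>n\<close>-th power of \<open>T\<inverse>\<close> sends the class of \<open>f\<close> to the class
  of \<open>f \<circ> T\<^sup>n\<close>, so the theorem is about the growth of the norm of \<open>f \<circ> T\<^sup>n\<close>.

  Extension relations (the sum of \<open>#(xv)\<close> over all letters \<open>x\<close> is equivalent to \<open>#v\<close>) express every
  counting function through \<open>#b\<close>, \<open>#b\<inverse>\<close> and words of a normal form: a core that starts and ends with
  non-\<open>b\<close> letters, with at most one letter \<open>b\<close> or \<open>b\<inverse>\<close> added at either end, whose sign is
  prescribed by the neighbouring letter (\<open>span_basic_words\<close>). Normal words have two virtues.
  First, the norm of a combination of normal words is the length of its longest word if this is at
  least \<open>3\<close> (\<open>norm_lower_bound\<close>). Secondly, the counting function of a normal word composed with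
  \<open>T\<^sup>n\<close> is an explicit combination of normal words (\<open>occ_with_ends_twist\<close>). The lengths of these grow
  at most as \<open>n\<close> times the degree of the word, the number of its stretched links plus the number of
  its end letters \<open>b\<^sup>\<plusminus>\<^sup>1\<close>: an end letter contributes because beyond it there may or may not be a
  stretched link.

  So the norm of \<open>f \<circ> T\<^sup>n\<close> grows as \<open>n\<close> times the largest degree that occurs in \<open>f\<close>, unless the
  longest words cancel. The obstruction is that a word \<open>a b\<^sup>j s\<close> with one stretched
  link is produced both by \<open>ab\<close> and by \<open>bs\<close>. If neither \<open>ab\<close> nor its inverse occurs
  in \<open>f\<close>, then a word of maximal degree with the greatest number of end letters produces a word of
  length \<open>n\<close> times the degree, up to a constant, that nothing else produces
  (\<open>expansion_unique\<close>). This gives the speed of every such sum and of each of its terms, hence such a sum is speed reduced (\<open>speed_reduced_antisymmetric\<close>). Finally \<open>rot\<close> is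
  a combination of normal words that contains \<open>ab\<close> and that is invariant under \<open>T\<close> up to bounded
  functions, since precisely the cancellation above takes place (\<open>norm_le_rot_twist\<close>).
  Subtracting a multiple of it removes \<open>ab\<close> from \<open>f\<close> without changing the speed.\<close>

section \<open>Counting occurrences\<close>

lemma finite_splits: "finite {(p, q). w = p @ v @ q}"
proof -
  have "{(p, q). w = p @ v @ q} \<subseteq> (\<lambda>i. (take i w, drop (i + length v) w)) ` {..length w}"
  proof (clarify)
    fix p q
    let ?w = "p @ v @ q"
    show "(p, q) \<in> (\<lambda>i. (take i ?w, drop (i + length v) ?w)) ` {..length ?w}"
      by (intro image_eqI[of _ _ "length p"]) auto
  qed
  then show ?thesis by (rule finite_subset) simp
qed

lemma occ_Nil: "v \<noteq> [] \<Longrightarrow> occ v [] = 0"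
  by (simp add: occ_def)

lemma occ_Cons:
  assumes "v \<noteq> []"
  shows "occ v (x # w) = of_bool (prefix v (x # w)) + occ v w"
proof -
  have eq: "{(p, q). x # w = p @ v @ q}
      = (\<lambda>q. ([], q)) ` {q. x # w = v @ q} \<union> (\<lambda>(p, q). (x # p, q)) ` {(p, q). w = p @ v @ q}"
    using assms by (auto simp: image_iff Cons_eq_append_conv)
  have fin: "finite {q. x # w = v @ q}"
    by (rule finite_subset[of _ "{drop (length v) (x # w)}"]) auto
  have c1: "card {q. x # w = v @ q} = of_bool (prefix v (x # w))"
  proof (cases "prefix v (x # w)")
    case True
    then obtain q where q: "x # w = v @ q" by (auto simp: prefix_def)
    then have "{q. x # w = v @ q} = {q}" by auto
    then show ?thesis using True by simp
  qed (auto simp: prefix_def)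
  have "card {(p, q). x # w = p @ v @ q}
      = card {q. x # w = v @ q} + card {(p, q). w = p @ v @ q}"
    unfolding eq
    by (subst card_Un_disjoint) (auto simp: card_image inj_on_def fin finite_splits)
  then show ?thesis by (simp add: occ_def c1)
qed

lemma occ_word_inv: "occ (word_inv v) w = occ v (word_inv w)"
proof -
  have "bij_betw (\<lambda>(p, q). (word_inv q, word_inv p)) {(p, q). w = p @ word_inv v @ q}
      {(p, q). word_inv w = p @ v @ q}"
    by (rule bij_betw_byWitness[where f' = "\<lambda>(p, q). (word_inv q, word_inv p)"])
      (auto simp: word_inv_append, metis append_assoc word_inv_append word_inv_inv)
  then show ?thesis by (simp add: occ_def bij_betw_same_card)
qed

lemma occ_eq_0:
  assumes "\<And>p q. w \<noteq> p @ v @ q"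
  shows "occ v w = 0"
  using assms by (simp add: occ_def)

text \<open>Fixing the occurrences of the core and testing what surrounds them separates the two ends of a
  word; the effect of \<open>T\<^sup>n\<close> on the two ends can then be studied independently.\<close>

lemma occ_context:
  "occ (l @ c @ r) w = (\<Sum>(p, q)\<in>{(p, q). w = p @ c @ q}. of_bool (suffix l p) * of_bool (prefix r q))"
proof -
  let ?S = "{(p, q). w = p @ c @ q}"
  have "bij_betw (\<lambda>(p, q). (p @ l, r @ q)) {(p, q). w = p @ (l @ c @ r) @ q}
      {x \<in> ?S. suffix l (fst x) \<and> prefix r (snd x)}"
    unfolding bij_betw_def
    by (auto simp: inj_on_def suffix_def prefix_def image_iff)
  then have "card {(p, q). w = p @ (l @ c @ r) @ q} = card {x \<in> ?S. suffix l (fst x) \<and> prefix r (snd x)}"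
    by (rule bij_betw_same_card)
  then have "occ (l @ c @ r) w = (\<Sum>x\<in>{x \<in> ?S. suffix l (fst x) \<and> prefix r (snd x)}. 1)"
    by (simp add: occ_def)
  also have "\<dots> = (\<Sum>x\<in>?S. of_bool (suffix l (fst x) \<and> prefix r (snd x)))"
    by (subst sum.inter_filter) (auto simp: finite_splits of_bool_def intro!: sum.cong)
  also have "\<dots> = (\<Sum>(p, q)\<in>?S. of_bool (suffix l p) * of_bool (prefix r q))"
    by (rule sum.cong) auto
  finally show ?thesis .
qed

text \<open>An occurrence of a word that is not longer than \<open>u\<close> by more than two letters cannot reach beyond
  \<open>u\<close> on both sides, except in one way. Counting functions of short words therefore do not see which
  left context of \<open>u\<close> is combined with which right context; this is what the lower bound for norms
  rests on.\<close>

lemma occ_swap: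
  assumes "v \<noteq> []" and "length v \<le> length u + 2"
  shows "occ v (X @ x # u @ y # Y)
    = occ v (X @ x # u) + occ v (u @ y # Y) - occ v u + of_bool (v = x # u @ [y])"
proof (induction X)
  case Nil
  have "prefix v (x # u @ y # Y) \<longleftrightarrow> prefix v (x # u) \<or> v = x # u @ [y]"
  proof -
    have "x # u @ y # Y = (x # u @ [y]) @ Y" by simp
    then have "prefix v (x # u @ y # Y) \<longleftrightarrow> prefix v (x # u @ [y])"
      using assms(2) by (metis (no_types, lifting) append_eq_append_conv_if length_Cons length_append_singleton
          prefix_append prefix_length_prefix prefix_order.trans prefixI add_2_eq_Suc')
    then show ?thesis by (metis append_Cons prefix_snoc)
  qed
  moreover have "\<not> (prefix v (x # u) \<and> v = x # u @ [y])"
    by (auto dest: prefix_length_le)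
  ultimately show ?case using occ_Cons[OF assms(1)] by auto
next
  case (Cons z X)
  have "z # X @ x # u @ y # Y = (z # X @ x # u) @ y # Y" by simp
  moreover have "length v \<le> length (z # X @ x # u)" using assms(2) by simp
  ultimately have "prefix v (z # X @ x # u @ y # Y) \<longleftrightarrow> prefix v (z # X @ x # u)"
    by (metis prefix_length_prefix prefix_order.trans prefixI)
  then show ?case using occ_Cons[OF assms(1)] Cons.IH by simp
qed

section \<open>Spans of counting functions up to bounded functions\<close>

text \<open>The name is that of the free group in the literature, \<open>F\<^sub>d\<close>.\<close>

abbreviation F :: "nat \<Rightarrow> word set" where
  "F d \<equiv> carrier (free_group d)"

lemma carrier_iff: "w \<in> F d \<longleftrightarrow> reduced w \<and> set w \<subseteq> letters d"
  by (simp add: free_group_def)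

lemma nontriv_iff: "v \<in> nontriv d \<longleftrightarrow> v \<in> F d \<and> v \<noteq> []"
  by (auto simp: nontriv_def free_group_def)

lemma carrier_inv: "word_inv w \<in> F d \<longleftrightarrow> w \<in> F d"
  using reduced_word_inv[of w] reduced_word_inv[of "word_inv w"] by (auto simp: carrier_iff set_word_inv)

lemma word_inv_Nil [simp]: "word_inv [] = []" "word_inv w = [] \<longleftrightarrow> w = []"
  by (auto simp: word_inv_def)

lemma length_word_inv [simp]: "length (word_inv w) = length w"
  by (simp add: word_inv_def)

lemma equivalent_refl: "equivalent d f f"
  by (auto simp: equivalent_def)

lemma equivalent_sym: "equivalent d f g \<Longrightarrow> equivalent d g f"
  by (simp add: equivalent_def abs_minus_commute)

lemma equivalent_trans: "equivalent d f g \<Longrightarrow> equivalent d g h \<Longrightarrow> equivalent d f h"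
proof -
  assume "equivalent d f g" "equivalent d g h"
  then obtain C D where "\<forall>w\<in>F d. \<bar>f w - g w\<bar> \<le> C" "\<forall>w\<in>F d. \<bar>g w - h w\<bar> \<le> D"
    by (auto simp: equivalent_def)
  then have "\<forall>w\<in>F d. \<bar>f w - h w\<bar> \<le> C + D" by force
  then show ?thesis by (auto simp: equivalent_def)
qed

lemma equivalent_add:
  assumes "equivalent d f g" "equivalent d f' g'"
  shows "equivalent d (\<lambda>w. f w + f' w) (\<lambda>w. g w + g' w)"
proof -
  obtain C D where "\<forall>w\<in>F d. \<bar>f w - g w\<bar> \<le> C" "\<forall>w\<in>F d. \<bar>f' w - g' w\<bar> \<le> D"
    using assms by (auto simp: equivalent_def)
  then have "\<forall>w\<in>F d. \<bar>(f w + f' w) - (g w + g' w)\<bar> \<le> C + D" by force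
  then show ?thesis by (auto simp: equivalent_def)
qed

lemma equivalent_scale:
  assumes "equivalent d f g"
  shows "equivalent d (\<lambda>w. r * f w) (\<lambda>w. r * g w)"
proof -
  obtain C where "\<forall>w\<in>F d. \<bar>f w - g w\<bar> \<le> C" using assms by (auto simp: equivalent_def)
  then have "\<forall>w\<in>F d. \<bar>r * f w - r * g w\<bar> \<le> \<bar>r\<bar> * C"
    by (auto simp: right_diff_distrib[symmetric] abs_mult intro!: mult_left_mono)
  then show ?thesis by (auto simp: equivalent_def)
qed

lemma equivalent_sum:
  assumes "\<And>i. i \<in> I \<Longrightarrow> equivalent d (f i) (g i)"
  shows "equivalent d (\<lambda>w. \<Sum>i\<in>I. f i w) (\<lambda>w. \<Sum>i\<in>I. g i w)"
  using assms
  by (induction I rule: infinite_finite_induct) (auto intro: equivalent_add equivalent_refl)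

lemma equivalent_comp:
  assumes "equivalent d f g" "\<And>w. w \<in> F d \<Longrightarrow> h w \<in> F d"
  shows "equivalent d (\<lambda>w. f (h w)) (\<lambda>w. g (h w))"
  using assms by (fastforce simp: equivalent_def)

lemma equivalent_cong:
  assumes "equivalent d f g" "\<And>w. w \<in> F d \<Longrightarrow> f w = f' w" "\<And>w. w \<in> F d \<Longrightarrow> g w = g' w"
  shows "equivalent d f' g'"
  using assms by (auto simp: equivalent_def)

definition in_span :: "nat \<Rightarrow> word set \<Rightarrow> (word \<Rightarrow> real) \<Rightarrow> bool" where
  "in_span d A f \<longleftrightarrow> (\<exists>J \<alpha>. finite J \<and> J \<subseteq> A \<and> equivalent d f (occ_sum J \<alpha>))"

lemma in_span_equiv: "in_span d A f \<Longrightarrow> equivalent d g f \<Longrightarrow> in_span d A g"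
  unfolding in_span_def by (blast intro: equivalent_trans)

lemma in_span_mono: "in_span d A f \<Longrightarrow> A \<subseteq> B \<Longrightarrow> in_span d B f"
  unfolding in_span_def by blast

lemma in_span_zero: "in_span d A (\<lambda>w. 0)"
  unfolding in_span_def occ_sum_def by (rule exI[of _ "{}"]) (auto simp: equivalent_refl)

lemma in_span_occ: "v \<in> A \<Longrightarrow> in_span d A (occ v)"
  unfolding in_span_def occ_sum_def
  by (rule exI[of _ "{v}"], rule exI[of _ "\<lambda>_. 1"]) (auto simp: equivalent_refl)

lemma occ_sum_superset:
  assumes "finite K" "J \<subseteq> K"
  shows "occ_sum J \<alpha> = occ_sum K (\<lambda>v. if v \<in> J then \<alpha> v else 0)"
  unfolding occ_sum_def using assms
  by (auto intro!: ext sum.mono_neutral_cong_left)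

lemma in_span_add:
  assumes "in_span d A f" "in_span d A g"
  shows "in_span d A (\<lambda>w. f w + g w)"
proof -
  obtain J \<alpha> K \<beta> where J: "finite J" "J \<subseteq> A" "equivalent d f (occ_sum J \<alpha>)"
    and K: "finite K" "K \<subseteq> A" "equivalent d g (occ_sum K \<beta>)"
    using assms unfolding in_span_def by metis
  let ?\<gamma> = "\<lambda>v. (if v \<in> J then \<alpha> v else 0) + (if v \<in> K then \<beta> v else 0)"
  have "(\<lambda>w. occ_sum J \<alpha> w + occ_sum K \<beta> w) = occ_sum (J \<union> K) ?\<gamma>"
    using J(1) K(1) by (subst occ_sum_superset[of "J \<union> K" J], simp, simp,
      subst occ_sum_superset[of "J \<union> K" K], simp, simp)
      (auto simp: occ_sum_def sum.distrib[symmetric] algebra_simps intro!: ext sum.cong)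
  then have "equivalent d (\<lambda>w. f w + g w) (occ_sum (J \<union> K) ?\<gamma>)"
    using equivalent_add[OF J(3) K(3)] by simp
  then show ?thesis unfolding in_span_def using J K by (intro exI[of _ "J \<union> K"] exI[of _ ?\<gamma>]) auto
qed

lemma in_span_scale:
  assumes "in_span d A f"
  shows "in_span d A (\<lambda>w. r * f w)"
proof -
  obtain J \<alpha> where J: "finite J" "J \<subseteq> A" "equivalent d f (occ_sum J \<alpha>)"
    using assms unfolding in_span_def by metis
  have "(\<lambda>w. r * occ_sum J \<alpha> w) = occ_sum J (\<lambda>v. r * \<alpha> v)"
    by (simp add: occ_sum_def[abs_def] sum_distrib_left mult.assoc)
  then show ?thesis using J equivalent_scale[OF J(3), of r] unfolding in_span_def by metis
qed

lemma in_span_minus: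
  assumes "in_span d A f" "in_span d A g"
  shows "in_span d A (\<lambda>w. f w - g w)"
  using in_span_add[OF assms(1) in_span_scale[OF assms(2), of "-1"]] by simp

lemma in_span_sum:
  assumes "\<And>i. i \<in> I \<Longrightarrow> in_span d A (f i)"
  shows "in_span d A (\<lambda>w. \<Sum>i\<in>I. f i w)"
  using assms
  by (induction I rule: infinite_finite_induct) (auto intro: in_span_add in_span_zero)

lemma in_span_subst:
  assumes "in_span d A f" "\<And>v. v \<in> A \<Longrightarrow> in_span d B (occ v)"
  shows "in_span d B f"
proof -
  obtain J \<alpha> where J: "finite J" "J \<subseteq> A" "equivalent d f (occ_sum J \<alpha>)"
    using assms(1) unfolding in_span_def by metis
  have "in_span d B (\<lambda>w. \<Sum>v\<in>J. \<alpha> v * occ v w)"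
    using J(2) assms(2) by (intro in_span_sum in_span_scale) auto
  then show ?thesis using J(3) in_span_equiv by (simp add: occ_sum_def[abs_def] in_span_equiv)
qed

lemma in_span_inv:
  assumes "in_span d A f"
  shows "in_span d (word_inv ` A) (\<lambda>w. f (word_inv w))"
proof -
  obtain J \<alpha> where J: "finite J" "J \<subseteq> A" "equivalent d f (occ_sum J \<alpha>)"
    using assms(1) unfolding in_span_def by metis
  have "occ_sum J \<alpha> (word_inv w) = occ_sum (word_inv ` J) (\<lambda>v. \<alpha> (word_inv v)) w" for w
    unfolding occ_sum_def
    by (subst sum.reindex) (auto simp: occ_word_inv inj_on_def dest: arg_cong[of _ _ word_inv])
  then show ?thesis unfolding in_span_def using J equivalent_comp[OF J(3), of word_inv]
    by (intro exI[of _ "word_inv ` J"] exI[of _ "\<lambda>v. \<alpha> (word_inv v)"]) (auto simp: carrier_inv)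
qed

section \<open>Reduced words and powers of b\<close>

definition bletter :: "letter \<Rightarrow> bool" where
  "bletter x \<longleftrightarrow> fst x = 2"

definition bpow :: "int \<Rightarrow> word" where
  "bpow k = replicate (nat \<bar>k\<bar>) (2, k > 0)"

lemma bletter_inv [simp]: "bletter (letter_inv x) = bletter x"
  by (simp add: bletter_def letter_inv_def)

lemma bletter_bpow: "x \<in> set (bpow k) \<Longrightarrow> bletter x"
  by (auto simp: bpow_def bletter_def split: if_splits)

lemma bpow_0 [simp]: "bpow 0 = []"
  by (simp add: bpow_def)

lemma bpow_eq_Nil [simp]: "bpow k = [] \<longleftrightarrow> k = 0" "[] = bpow k \<longleftrightarrow> k = 0"
  by (auto simp: bpow_def)

lemma length_bpow [simp]: "length (bpow k) = nat \<bar>k\<bar>"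
  by (simp add: bpow_def)

lemma bpow_pos: "k > 0 \<Longrightarrow> bpow k = (2, True) # bpow (k - 1)"
proof -
  assume "k > 0"
  then have "nat \<bar>k\<bar> = Suc (nat \<bar>k - 1\<bar>)" by linarith
  then show ?thesis using \<open>k > 0\<close> by (cases "k = 1") (auto simp: bpow_def)
qed

lemma bpow_neg: "k < 0 \<Longrightarrow> bpow k = (2, False) # bpow (k + 1)"
proof -
  assume "k < 0"
  then have "nat \<bar>k\<bar> = Suc (nat \<bar>k + 1\<bar>)" by linarith
  then show ?thesis using \<open>k < 0\<close> by (auto simp: bpow_def)
qed

lemma bpow_1 [simp]: "bpow 1 = [(2, True)]" "bpow (-1) = [(2, False)]"
  by (simp_all add: bpow_def)

lemma word_inv_bpow [simp]: "word_inv (bpow k) = bpow (- k)"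
  by (cases "k = 0") (auto simp: bpow_def word_inv_def letter_inv_def)

lemma bpow_inj [simp]: "bpow i = bpow j \<longleftrightarrow> i = j"
proof
  assume e: "bpow i = bpow j"
  then have "nat \<bar>i\<bar> = nat \<bar>j\<bar>" using length_bpow by metis
  moreover from this e have "i \<noteq> 0 \<Longrightarrow> (i > 0) = (j > 0)" by (auto simp: bpow_def)
  ultimately show "i = j" by linarith
qed simp

lemma bpow_letters: "d \<ge> 2 \<Longrightarrow> set (bpow k) \<subseteq> letters d"
  by (auto simp: bpow_def letters_def)

lemma word_inv_Cons: "word_inv (x # w) = word_inv w @ [letter_inv x]"
  by (simp add: word_inv_def)

lemma bletter_cases: "bletter x \<Longrightarrow> x = (2, True) \<or> x = (2, False)"
  by (cases x) (auto simp: bletter_def)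

lemma bletter_simps [simp]: "bletter (2, e)" "\<not> bletter (1, e)" "\<not> bletter (Suc 0, e)"
  by (auto simp: bletter_def)

lemma letter_inv_simps [simp]: "letter_inv (i, e) = (i, \<not> e)"
  by (simp add: letter_inv_def)

lemma letter_inv_bletter [simp]:
  "\<not> bletter s \<Longrightarrow> (2, c) \<noteq> letter_inv s" "\<not> bletter s \<Longrightarrow> letter_inv s \<noteq> (2, c)"
  by (metis bletter_inv bletter_simps(1))+

lemma letter_inv_eq_iff [simp]: "letter_inv x = letter_inv y \<longleftrightarrow> x = y"
  by (metis letter_inv_inv)

lemma reduced_Nil [simp]: "reduced []" and reduced_single [simp]: "reduced [x]"
  by (simp_all add: reduced_def)

lemma reduced_Cons: "reduced (x # w) \<longleftrightarrow> reduced w \<and> (w \<noteq> [] \<longrightarrow> hd w \<noteq> letter_inv x)"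
  by (cases w) (auto simp: reduced_def)

lemma reduced_append:
  "reduced (u @ v) \<longleftrightarrow> reduced u \<and> reduced v \<and> (u \<noteq> [] \<longrightarrow> v \<noteq> [] \<longrightarrow> hd v \<noteq> letter_inv (last u))"
  by (auto simp: reduced_def successively_append_iff)

lemma reduced_bpow [simp]: "reduced (bpow k)"
  by (simp add: reduced_def bpow_def successively_conv_nth)

lemma hd_bpow: "k \<noteq> 0 \<Longrightarrow> hd (bpow k) = (2, k > 0)" and last_bpow: "k \<noteq> 0 \<Longrightarrow> last (bpow k) = (2, k > 0)"
  by (auto simp: bpow_def)

lemma bpow_append_decode:
  assumes "\<not> bletter s" "\<not> bletter t" "bpow i @ s # u = bpow j @ t # v"
  shows "i = j \<and> s = t \<and> u = v"
proof -
  have tk: "takeWhile bletter (bpow k @ x # w) = bpow k" if "\<not> bletter x" for k x w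
    using that by (subst takeWhile_append2) (auto dest: bletter_bpow)
  from assms have "bpow i = bpow j" using tk by metis
  then show ?thesis using assms(3) by simp
qed

lemma bpow_not_decode: "\<not> bletter s \<Longrightarrow> bpow j \<noteq> p @ s # u"
  by (metis bletter_bpow in_set_conv_decomp)

lemma bword_bpow:
  assumes "reduced w" "\<forall>x\<in>set w. bletter x"
  shows "\<exists>k. w = bpow k"
  using assms
proof (induction w)
  case Nil
  then show ?case by (metis bpow_0)
next
  case (Cons x w)
  then obtain k where k: "w = bpow k" by (auto simp: reduced_Cons)
  have "x = (2, True) \<or> x = (2, False)" using Cons.prems bletter_cases by simp
  then show ?case
  proof
    assume x: "x = (2, True)"
    then have "k \<ge> 0" using Cons.prems(1) by (cases "k \<ge> 0") (auto simp: k reduced_Cons hd_bpow)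
    then show ?thesis using bpow_pos[of "k + 1"] x k by (intro exI[of _ "k + 1"]) simp
  next
    assume x: "x = (2, False)"
    then have "k \<le> 0" using Cons.prems(1) by (cases "k \<le> 0") (auto simp: k reduced_Cons hd_bpow)
    then show ?thesis using bpow_neg[of "k - 1"] x k by (intro exI[of _ "k - 1"]) simp
  qed
qed

lemma word_cases:
  assumes "reduced w"
  obtains (power) k where "w = bpow k"
  | (letter) k s u where "w = bpow k @ s # u" "\<not> bletter s" "reduced (s # u)"
proof (cases "\<forall>x\<in>set w. bletter x")
  case True
  then show ?thesis using bword_bpow[OF assms] power by blast
next
  case False
  then obtain p s u where w: "w = p @ s # u" "\<not> bletter s" "\<forall>x\<in>set p. bletter x"
    using split_list_first_prop[of w "\<lambda>x. \<not> bletter x"] by auto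
  then have "reduced p" "reduced (s # u)" using assms by (auto simp: reduced_append)
  then obtain k where "p = bpow k" using bword_bpow[of p] w(3) by blast
  then show ?thesis using letter[of k s u] w \<open>reduced (s # u)\<close> by simp
qed

lemma word_induct [consumes 1, case_names power letter]:
  assumes "reduced w"
    and "\<And>k. P (bpow k)"
    and "\<And>k s u. \<not> bletter s \<Longrightarrow> reduced (bpow k @ s # u) \<Longrightarrow> reduced u \<Longrightarrow> P u \<Longrightarrow> P (bpow k @ s # u)"
  shows "P w"
  using assms(1)
proof (induction "length w" arbitrary: w rule: less_induct)
  case less
  from less.prems show ?case
  proof (cases rule: word_cases)
    case (letter k s u)
    then have "reduced u" by (auto simp: reduced_Cons)
    then show ?thesis using letter less assms(3) by auto
  qed (use assms(2) in auto)
qed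

lemma word_cases_rev:
  assumes "reduced w"
  obtains (power) k where "w = bpow k"
  | (letter) u s k where "w = u @ s # bpow k" "\<not> bletter s" "reduced (u @ [s])"
proof -
  have "reduced (word_inv w)" using assms reduced_word_inv by blast
  then show ?thesis
  proof (cases rule: word_cases)
    case (power k)
    then have "w = bpow (- k)" by (metis word_inv_bpow word_inv_inv)
    then show ?thesis using that(1) by blast
  next
    case (letter k s u)
    then have w: "w = word_inv u @ letter_inv s # bpow (- k)"
      by (metis append_Cons append_Nil append_assoc word_inv_Cons word_inv_append word_inv_bpow word_inv_inv)
    moreover have "reduced (word_inv u @ [letter_inv s])"
      using letter(3) reduced_word_inv[of "s # u"] by (simp add: word_inv_Cons)
    ultimately show ?thesis using letter that(2) by auto
  qed
qed

section \<open>The powers of the twist on reduced words\<close>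

definition is_a :: "letter \<Rightarrow> int" where
  "is_a s = of_bool (s = (1, True))"

definition is_a_inv :: "letter \<Rightarrow> int" where
  "is_a_inv s = of_bool (s = (1, False))"

text \<open>For reduced \<open>w\<close> this is the reduced word of \<open>b\<^sup>k T\<^sup>n(w) b\<^sup>-\<^sup>n\<^sup>e\<close>. The argument \<open>k\<close> accumulates the exponent
  of \<open>b\<close> before the next letter; \<open>e\<close> says whether \<open>w\<close> is continued by a letter \<open>a\<inverse>\<close>, whose image
  starts with \<open>b\<^sup>-\<^sup>n\<close>, and \<open>k = n\<close> is the corresponding choice after a letter \<open>a\<close>. With these two parameters the image
  of a word can be cut at any non-\<open>b\<close> letter (\<open>tw_append\<close>). No cancellation ever occurs, for any
  integer \<open>n\<close>.\<close>

fun tw :: "int \<Rightarrow> int \<Rightarrow> int \<Rightarrow> word \<Rightarrow> word" where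
  "tw n e k [] = bpow (k - n * e)"
| "tw n e k (x # w) =
     (if bletter x then tw n e (k + (if snd x then 1 else -1)) w
      else bpow (k - n * is_a_inv x) @ x # tw n e (n * is_a x) w)"

lemma letter_inv_is_a [simp]: "is_a (letter_inv s) = is_a_inv s" "is_a_inv (letter_inv s) = is_a s"
  by (auto simp: is_a_def is_a_inv_def letter_inv_def prod_eq_iff)

lemma tw_replicate: "tw n e k (replicate m (2, c) @ w) = tw n e (k + (if c then int m else - int m)) w"
  by (induction m arbitrary: k) (auto simp: algebra_simps)

lemma tw_bpow_append [simp]: "tw n e k (bpow j @ w) = tw n e (k + j) w"
proof -
  have "(if j > 0 then int (nat \<bar>j\<bar>) else - int (nat \<bar>j\<bar>)) = j" by auto
  then show ?thesis unfolding bpow_def tw_replicate by (simp only:)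
qed

lemma tw_bpow [simp]: "tw n e k (bpow j) = bpow (k + j - n * e)"
  using tw_bpow_append[of n e k j "[]"] by (simp del: tw_bpow_append)

lemma tw_append:
  "\<not> bletter s \<Longrightarrow> tw n e k (p @ s # q) = tw n (is_a_inv s) k p @ s # tw n e (n * is_a s) q"
  by (induction p arbitrary: k) auto

lemma tw_inverse:
  "reduced w \<Longrightarrow> tw (- n) e (- n * e') (tw n e (n * e') w) = w"
proof (induction w arbitrary: e' rule: word_induct)
  case (letter k s u)
  then show ?case using letter.IH[of "is_a s"] by simp
qed simp

lemma tw_inverse0: "reduced w \<Longrightarrow> tw (- n) 0 0 (tw n 0 0 w) = w"
  using tw_inverse[of w n 0 0] by simp

lemma reduced_bpow_Cons:
  "\<not> bletter s \<Longrightarrow> reduced (bpow k @ s # w) \<longleftrightarrow> reduced (s # w)"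
  by (cases "k = 0") (auto simp: reduced_append last_bpow)

lemma reduced_Cons_bpow:
  "\<not> bletter s \<Longrightarrow> reduced (s # bpow k @ w) \<longleftrightarrow> (if k = 0 then reduced (s # w) else reduced (bpow k @ w))"
  by (cases "k = 0") (auto simp: reduced_Cons hd_bpow)

text \<open>A link with exponent zero between \<open>s\<close> and \<open>t\<close> could only become unreduced for \<open>t = s\<inverse>\<close>, but the
  link between a letter and its inverse is not stretched.\<close>

lemma reduced_tw: "reduced w \<Longrightarrow> reduced (tw n e k w)"
proof (induction w arbitrary: k rule: word_induct)
  case (letter j s u)
  have su: "reduced (s # u)" using letter by (simp add: reduced_bpow_Cons)
  have IH: "reduced (tw n e (n * is_a s) u)" by (rule letter.IH)
  have "reduced (s # tw n e (n * is_a s) u)"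
    using \<open>reduced u\<close>
  proof (cases rule: word_cases)
    case (power i)
    then show ?thesis
      using letter(1) by (cases "n * is_a s + i - n * e = 0") (auto simp: reduced_Cons hd_bpow)
  next
    case (letter i t v)
    have "reduced (s # bpow (n * is_a s + i - n * is_a_inv t) @ t # tw n e (n * is_a t) v)"
    proof (cases "n * is_a s + i - n * is_a_inv t = 0")
      case True
      have "t \<noteq> letter_inv s"
      proof
        assume t: "t = letter_inv s"
        then have "i = 0" using True by simp
        then show False using su letter t by (simp add: reduced_Cons)
      qed
      then show ?thesis using IH letter True by (auto simp: reduced_Cons tw_append)
    next
      case False
      then show ?thesis using IH letter \<open>\<not> bletter s\<close> by (simp add: reduced_Cons_bpow)
    qed
    then show ?thesis using letter by simp
  qed
  then show ?case using letter(1) by (simp add: reduced_bpow_Cons)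
qed simp

lemma set_tw: "d \<ge> 2 \<Longrightarrow> set w \<subseteq> letters d \<Longrightarrow> set (tw n e k w) \<subseteq> letters d"
proof (induction w arbitrary: k)
  case (Cons x w)
  then show ?case using bpow_letters[OF Cons.prems(1)] by auto
qed (use bpow_letters in auto)

lemma tw_carrier: "d \<ge> 2 \<Longrightarrow> w \<in> F d \<Longrightarrow> tw n e k w \<in> F d"
  by (simp add: carrier_iff reduced_tw set_tw)

lemma tw_word_inv:
  "reduced w \<Longrightarrow> word_inv (tw n e (n * e') w) = tw n e' (n * e) (word_inv w)"
proof (induction w arbitrary: e' rule: word_induct)
  case (power k)
  then show ?case by (simp add: algebra_simps)
next
  case (letter k s u)
  have "word_inv (bpow k @ s # u) = word_inv u @ letter_inv s # bpow (- k)"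
    by (simp add: word_inv_append word_inv_Cons)
  moreover have "word_inv (tw n e (n * e') (bpow k @ s # u))
      = word_inv (tw n e (n * is_a s) u) @ letter_inv s # bpow (- (n * e' + k - n * is_a_inv s))"
    using letter(1) by (simp add: word_inv_append word_inv_Cons)
  ultimately show ?case using letter
    by (simp add: tw_append algebra_simps)
qed

lemma push_bletter: "push (2, c) (bpow k @ w) = bpow (k + (if c then 1 else -1)) @ w"
  if "w = [] \<or> \<not> bletter (hd w)"
proof -
  consider "k = 0" | "k > 0" "c" | "k > 0" "\<not> c" | "k < 0" "c" | "k < 0" "\<not> c" by linarith
  then show ?thesis
  proof cases
    case 1
    have "push (2, c) w = (2, c) # w"
      using that by (cases w) (auto simp: letter_inv_def bletter_def)
    then show ?thesis using 1 by auto
  next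
    case 2
    then show ?thesis using bpow_pos[of k] bpow_pos[of "k + 1"] by (simp add: letter_inv_def)
  next
    case 3
    then show ?thesis using bpow_pos[of k] by (simp add: letter_inv_def)
  next
    case 4
    then show ?thesis using bpow_neg[of k] by (simp add: letter_inv_def)
  next
    case 5
    then show ?thesis using bpow_neg[of k] bpow_neg[of "k - 1"] by (simp add: letter_inv_def)
  qed
qed

abbreviation twist_images :: "nat \<Rightarrow> word" where
  "twist_images \<equiv> (\<lambda>i. if i = 1 then [(1, True), (2, True)] else [(i, True)])"

lemma push_reduced: "reduced (x # v) \<Longrightarrow> push x v = x # v"
  by (cases v) (auto simp: reduced_Cons)

lemma push_tw:
  "reduced w \<Longrightarrow> push (2, c) (tw n e k w) = tw n e (k + (if c then 1 else -1)) w"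
proof -
  assume w: "reduced w"
  then show ?thesis
  proof (cases rule: word_cases)
    case (power j)
    then show ?thesis using push_bletter[of "[]" c "k + j - n * e"] by (auto simp: algebra_simps)
  next
    case (letter j s u)
    let ?v = "s # tw n e (n * is_a s) u"
    have "reduced ?v"
      using reduced_tw[OF w, of n e k] letter by (simp add: reduced_bpow_Cons)
    then show ?thesis using letter push_bletter[of ?v c "k + j - n * is_a_inv s"]
      by (auto simp: algebra_simps)
  qed
qed

text \<open>Pushing the image of a letter onto an already reduced word never cancels a non-\<open>b\<close> letter, because
  the result given by \<open>tw\<close> is reduced.\<close>

lemma extend_hom_tw:
  "reduced w \<Longrightarrow> extend_hom twist_images w = tw 1 0 0 w"
proof (induction w)
  case Nil
  then show ?case by (simp add: extend_hom_def reduce_def)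
next
  case (Cons x w)
  have w: "reduced w" using Cons.prems by (simp add: reduced_Cons)
  have IH: "reduce (subst_word twist_images w) = tw 1 0 0 w" using Cons.IH[OF w] by (simp only: extend_hom_def)
  have step: "extend_hom twist_images (x # w) = foldr push (subst_word twist_images [x]) (tw 1 0 0 w)"
    unfolding IH[symmetric] by (simp only: extend_hom_def reduce_def list.map concat.simps foldr_append o_def append_Nil2)
  have red: "reduced (tw 1 0 0 (x # w))" using Cons.prems by (rule reduced_tw)
  obtain i c where x: "x = (i, c)" by (cases x)
  consider "i = 2" | "i = 1" "c" | "i = 1" "\<not> c" | "i \<noteq> 1" "i \<noteq> 2" by blast
  then show ?case
  proof cases
    case 1
    then show ?thesis using step push_tw[OF w, of c 1 0 0] by (cases c) (auto simp: x word_inv_def)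
  next
    case 2
    then have "reduced ((1, True) # tw 1 0 1 w)" using red by (simp add: x is_a_def is_a_inv_def)
    then show ?thesis using step push_tw[OF w, of True 1 0 0] 2 push_reduced
      by (simp add: x is_a_def is_a_inv_def)
  next
    case 3
    then have "reduced ((2, False) # (1, False) # tw 1 0 0 w)"
      using red by (simp add: x is_a_def is_a_inv_def)
    then show ?thesis using step 3 push_reduced
      by (simp add: x is_a_def is_a_inv_def word_inv_def reduced_Cons)
  next
    case 4
    then have nb: "\<not> bletter x" "is_a x = 0" "is_a_inv x = 0"
      by (auto simp: x bletter_def is_a_def is_a_inv_def)
    then have "reduced (x # tw 1 0 0 w)" using red by simp
    moreover have "subst_word twist_images [x] = [x]" using 4 by (auto simp: x word_inv_def)
    ultimately show ?thesis using step nb push_reduced by simp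
  qed
qed

lemma twist_tw: "w \<in> F d \<Longrightarrow> twist d w = tw 1 0 0 w"
  unfolding twist_def using extend_hom_tw by (simp add: carrier_iff)

lemma tw_tw: "reduced w \<Longrightarrow> tw m e (m * e') (tw n e (n * e') w) = tw (m + n) e ((m + n) * e') w"
proof (induction w arbitrary: e' rule: word_induct)
  case (power k)
  then show ?case by (simp add: algebra_simps)
next
  case (letter k s u)
  then show ?case using letter.IH[of "is_a s"] by (simp add: algebra_simps)
qed

lemma twist_pow:
  assumes "d \<ge> 2" "w \<in> F d"
  shows "(twist d [^]\<^bsub>AutoGroup (free_group d)\<^esub> n) w = tw (int n) 0 0 w"
  using assms(2)
proof (induction n arbitrary: w)
  case 0
  interpret A: group "AutoGroup (free_group d)" by (rule group.AutoGroup[OF group_free_group])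
  have "tw 0 0 0 w = w" using tw_tw[of w 0 0 0 0] tw_inverse0[of w 0] 0 by (simp add: carrier_iff)
  then show ?case using 0 by (simp add: AutoGroup_def BijGroup_def)
next
  case (Suc n)
  interpret A: group "AutoGroup (free_group d)" by (rule group.AutoGroup[OF group_free_group])
  let ?G = "AutoGroup (free_group d)"
  have t: "twist d \<in> carrier ?G" by (rule twist_auto[OF assms(1)])
  have tn: "twist d [^]\<^bsub>?G\<^esub> n \<in> carrier ?G" using t by simp
  have "twist d [^]\<^bsub>?G\<^esub> Suc n = compose (F d) (twist d [^]\<^bsub>?G\<^esub> n) (twist d)"
    using t tn by (simp add: AutoGroup_def BijGroup_def auto_def)
  moreover have "twist d w \<in> F d" using Suc.prems assms(1) by (simp add: twist_tw tw_carrier)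
  ultimately show ?case
    using Suc tw_tw[of w "int n" 0 0 1] by (simp add: compose_def twist_tw carrier_iff algebra_simps)
qed

section \<open>Normal words\<close>

text \<open>The link before \<open>s\<close> is stretched for some of the letters that may precede it. Among these links
  the exponent is shifted by \<open>n\<close> times this sign.\<close>

definition bsign :: "letter \<Rightarrow> int" where
  "bsign s = (if s = (1, False) then -1 else 1)"

lemma bsign_nz [simp]: "bsign s \<noteq> 0"
  by (simp add: bsign_def)

definition core :: "nat \<Rightarrow> word \<Rightarrow> bool" where
  "core d c \<longleftrightarrow> c \<in> F d \<and> c \<noteq> [] \<and> \<not> bletter (hd c) \<and> \<not> bletter (last c)"

text \<open>The sign of the end letter is the direction in which \<open>T\<^sup>n\<close> moves the stretched links before \<open>s\<close>. So
  an end letter persists, and \<open>T\<^sup>n\<close> only adds the links that become long enough: the expansion in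
  \<open>left_choices\<close> has no terms to be subtracted.\<close>

definition b_end :: "bool \<Rightarrow> letter \<Rightarrow> word" where
  "b_end e s = (if e then bpow (bsign s) else [])"

text \<open>The right end is the left end of the inverse word, which makes normal words closed under
  inversion.\<close>

definition with_ends :: "bool \<Rightarrow> word \<Rightarrow> bool \<Rightarrow> word" where
  "with_ends el c er = b_end el (hd c) @ c @ word_inv (b_end er (letter_inv (last c)))"

definition normal_words :: "nat \<Rightarrow> word set" where
  "normal_words d = {with_ends el c er | el c er. core d c}"

abbreviation nonb :: "nat \<Rightarrow> letter set" where
  "nonb d \<equiv> {t \<in> letters d. \<not> bletter t}"

lemma finite_letters [simp]: "finite (letters d)"
  by (simp add: letters_def)

lemma hd_word_inv: "c \<noteq> [] \<Longrightarrow> hd (word_inv c) = letter_inv (last c)"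
  by (simp add: word_inv_def hd_rev last_map)

lemma last_word_inv: "c \<noteq> [] \<Longrightarrow> last (word_inv c) = letter_inv (hd c)"
  by (simp add: word_inv_def last_rev hd_map)

lemma core_inv: "core d (word_inv c) \<longleftrightarrow> core d c"
  by (cases "c = []") (auto simp: core_def carrier_inv hd_word_inv last_word_inv)

lemma word_inv_with_ends: "c \<noteq> [] \<Longrightarrow> word_inv (with_ends el c er) = with_ends er (word_inv c) el"
  by (simp add: with_ends_def word_inv_append hd_word_inv last_word_inv)

lemma with_ends_not_Nil: "c \<noteq> [] \<Longrightarrow> with_ends el c er \<noteq> []"
  by (simp add: with_ends_def)

lemma b_end_carrier: "d \<ge> 2 \<Longrightarrow> b_end e s @ y \<in> F d \<longleftrightarrow> y \<in> F d" if "y \<noteq> []" "hd y = s" "\<not> bletter s"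
  using that bpow_letters[of d "bsign s"] reduced_bpow_Cons[of s "bsign s" "tl y"]
  by (cases y) (auto simp: b_end_def carrier_iff)

lemma with_ends_carrier:
  assumes "d \<ge> 2" "core d c"
  shows "with_ends el c er \<in> F d"
proof -
  have "word_inv (with_ends False c er) \<in> F d"
    using assms b_end_carrier[of "word_inv c" "letter_inv (last c)" d er]
    by (simp add: with_ends_def b_end_def[of False] word_inv_append hd_word_inv core_def carrier_inv)
  then have "with_ends False c er \<in> F d" by (simp add: carrier_inv)
  then have *: "c @ word_inv (b_end er (letter_inv (last c))) \<in> F d" by (simp add: with_ends_def b_end_def)
  show ?thesis unfolding with_ends_def
    by (subst b_end_carrier) (use assms * in \<open>auto simp: core_def\<close>)
qed

lemma normal_words_nontriv: "d \<ge> 2 \<Longrightarrow> normal_words d \<subseteq> nontriv d"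
  by (auto simp: normal_words_def nontriv_iff with_ends_carrier with_ends_not_Nil core_def)

lemma normal_words_inv: "v \<in> normal_words d \<Longrightarrow> word_inv v \<in> normal_words d"
proof -
  assume "v \<in> normal_words d"
  then obtain el c er where v: "v = with_ends el c er" "core d c" by (auto simp: normal_words_def)
  then have "word_inv v = with_ends er (word_inv c) el" by (simp add: word_inv_with_ends core_def)
  then show ?thesis using v core_inv by (auto simp: normal_words_def)
qed

section \<open>Extension relations\<close>

lemma occ_extend_left:
  assumes "set w \<subseteq> letters d" "y \<noteq> []"
  shows "occ y w = (\<Sum>z\<in>letters d. occ (z # y) w) + of_bool (prefix y w)"
  using assms(1)
proof (induction w)
  case Nil
  then show ?case using assms(2) by (simp add: occ_Nil)
next
  case (Cons x w)
  have "(\<Sum>z\<in>letters d. occ (z # y) (x # w))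
      = (\<Sum>z\<in>letters d. (if x = z then of_bool (prefix y w) else 0)) + (\<Sum>z\<in>letters d. occ (z # y) w)"
    by (subst sum.distrib[symmetric]) (auto simp: occ_Cons intro!: sum.cong)
  then show ?case using Cons assms(2) by (simp add: occ_Cons sum.delta')
qed

lemma occ_not_reduced: "reduced w \<Longrightarrow> \<not> reduced v \<Longrightarrow> occ v w = 0"
  by (rule occ_eq_0) (auto simp: reduced_append)

lemma occ_extend_b:
  assumes "d \<ge> 2" "y \<noteq> []"
  shows "equivalent d (occ y) (\<lambda>w. occ ((2, True) # y) w + occ ((2, False) # y) w
    + (\<Sum>t\<in>nonb d. occ (t # y) w))"
proof -
  have L: "letters d = insert (2, True) (insert (2, False) (nonb d))"
    using assms(1) by (auto simp: letters_def bletter_def)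
  have "\<bar>occ y w - (\<Sum>z\<in>letters d. occ (z # y) w)\<bar> \<le> 1" if "w \<in> F d" for w
    using occ_extend_left[of w d y] that assms(2) by (simp add: carrier_iff)
  then have "equivalent d (occ y) (\<lambda>w. \<Sum>z\<in>letters d. occ (z # y) w)"
    by (auto simp: equivalent_def)
  then show ?thesis by (subst (asm) L) (simp add: add.assoc)
qed

lemma in_span_occ_reduced:
  assumes "reduced v \<Longrightarrow> v \<in> A"
  shows "in_span d A (occ v)"
proof (cases "reduced v")
  case False
  have "equivalent d (occ v) (\<lambda>w. 0)"
    by (rule equivalent_cong[OF equivalent_refl[of d "\<lambda>w. 0"]])
      (use False in \<open>auto simp: occ_not_reduced carrier_iff\<close>)
  then show ?thesis using in_span_equiv in_span_zero by blast
qed (use assms in_span_occ in blast)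

definition left_ext :: "nat \<Rightarrow> word \<Rightarrow> word set" where
  "left_ext d y = {y, bpow (bsign (hd y)) @ y}
     \<union> {t # bpow j @ y | t j. t \<in> nonb d \<and> reduced (t # bpow j @ y)}"

text \<open>The power of \<open>b\<close> in front of \<open>y\<close> can be shortened by the extension relation for
  \<open>b\<^sup>i y\<close>, which trades \<open>b\<^sup>i\<^sup>+\<^sup>1 y\<close> for \<open>b\<^sup>i y\<close> and for words starting with a non-\<open>b\<close> letter. The
  extension relation for \<open>y\<close> itself trades one sign of the exponent for the other.\<close>

lemma left_normalise:
  assumes d: "d \<ge> 2" and y: "y \<noteq> []" "\<not> bletter (hd y)" "reduced y"
  shows "in_span d (left_ext d y) (occ (bpow k @ y))"
proof -
  let ?S = "in_span d (left_ext d y)"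
  let ?e = "\<lambda>c. if c then 1 else - 1 :: int"
  have t: "?S (\<lambda>w. \<Sum>t\<in>nonb d. occ (t # bpow j @ y) w)" for j
    by (intro in_span_sum in_span_occ_reduced) (auto simp: left_ext_def)
  have y0: "?S (occ y)" by (rule in_span_occ) (simp add: left_ext_def)
  have far: "?S (occ (bpow (?e c * int (Suc i)) @ y))"
    if base: "?S (occ (bpow (?e c) @ y))" for c i
  proof (induction i)
    case 0
    then show ?case using base by simp
  next
    case (Suc i)
    define z where "z = bpow (?e c * int (Suc i)) @ y"
    have z: "(2, c) # z = bpow (?e c * int (Suc (Suc i))) @ y"
      using bpow_pos[of "int (Suc (Suc i))"] bpow_neg[of "- int (Suc (Suc i))"]
      by (cases c) (simp_all add: z_def algebra_simps)
    have nz: "\<not> reduced ((2, \<not> c) # z)"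
      using bpow_pos[of "int (Suc i)"] bpow_neg[of "- int (Suc i)"]
      by (cases c) (simp_all add: z_def algebra_simps reduced_Cons)
    have "equivalent d (occ z) (\<lambda>w. occ ((2, True) # z) w + occ ((2, False) # z) w
        + (\<Sum>t\<in>nonb d. occ (t # z) w))"
      by (rule occ_extend_b[OF d]) (use y in \<open>simp add: z_def\<close>)
    then have "equivalent d (\<lambda>w. occ z w - (\<Sum>t\<in>nonb d. occ (t # z) w)) (occ ((2, c) # z))"
      unfolding equivalent_def
      by (cases c) (use nz in \<open>fastforce simp: occ_not_reduced carrier_iff algebra_simps\<close>)+
    then have "?S (occ ((2, c) # z))"
      using in_span_minus[OF Suc.IH t[of "?e c * int (Suc i)"]] equivalent_sym in_span_equiv
      unfolding z_def by blast
    then show ?case by (simp add: z)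
  qed
  let ?c = "hd y \<noteq> (1, False)"
  have base1: "?S (occ (bpow (?e ?c) @ y))"
    by (rule in_span_occ) (simp add: left_ext_def bsign_def)
  have base2: "?S (occ (bpow (?e (\<not> ?c)) @ y))"
  proof -
    have "equivalent d (occ y) (\<lambda>w. occ ((2, True) # y) w + occ ((2, False) # y) w
        + (\<Sum>t\<in>nonb d. occ (t # y) w))"
      by (rule occ_extend_b[OF d]) (use y in simp)
    then have "equivalent d (\<lambda>w. occ y w - occ (bpow (?e ?c) @ y) w - (\<Sum>t\<in>nonb d. occ (t # bpow 0 @ y) w))
        (occ (bpow (?e (\<not> ?c)) @ y))"
      unfolding equivalent_def by (cases ?c) (fastforce simp: algebra_simps)+
    then show ?thesis
      using in_span_minus[OF in_span_minus[OF y0 base1] t[of 0]] equivalent_sym in_span_equiv by blast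
  qed
  have base: "?S (occ (bpow (?e c) @ y))" for c
    using base1 base2 by (cases "c = ?c") (simp_all only:, metis (full_types))
  consider "k = 0" | i where "k = int (Suc i)" | i where "k = - int (Suc i)"
    by (metis int_cases of_nat_Suc not0_implies_Suc of_nat_0)
  then show ?thesis
  proof cases
    case (2 i)
    then show ?thesis using far[OF base[of True], of i] by simp
  next
    case (3 i)
    then show ?thesis using far[OF base[of False], of i] by simp
  qed (use y0 in simp)
qed

lemma core_extend_left:
  assumes "core d c" "t \<in> nonb d" "reduced (t # bpow j @ c)" "d \<ge> 2"
  shows "core d (t # bpow j @ c)"
  using assms bpow_letters[OF assms(4)] by (auto simp: core_def carrier_iff)

text \<open>Inversion of words exchanges the two ends, so this is \<open>left_normalise\<close> for the inverse word. The
  normalised left end is preserved because the first non-\<open>b\<close> letter does not change.\<close>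

lemma right_normalise:
  assumes d: "d \<ge> 2" and c: "core d c"
  shows "in_span d (normal_words d) (occ (b_end el (hd c) @ c @ bpow l))"
proof -
  let ?y = "word_inv (b_end el (hd c) @ c)"
  have c': "c \<noteq> []" "\<not> bletter (hd c)" "\<not> bletter (last c)" "c \<in> F d" using c by (auto simp: core_def)
  have "b_end el (hd c) @ c \<in> F d" using c' d by (simp add: b_end_carrier)
  then have y: "?y \<noteq> []" "\<not> bletter (hd ?y)" "reduced ?y" "hd ?y = letter_inv (last c)"
    using c' by (auto simp: hd_word_inv carrier_iff reduced_word_inv)
  have "in_span d (word_inv ` left_ext d ?y) (\<lambda>w. occ (bpow (- l) @ ?y) (word_inv w))"
    by (rule in_span_inv[OF left_normalise[OF d y(1-3)]])
  moreover have "(\<lambda>w. occ (bpow (- l) @ ?y) (word_inv w)) = occ (b_end el (hd c) @ c @ bpow l)"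
    by (simp add: occ_word_inv[symmetric] word_inv_append)
  moreover have "word_inv ` left_ext d ?y \<subseteq> normal_words d"
  proof
    fix v assume "v \<in> word_inv ` left_ext d ?y"
    then obtain x where v: "v = word_inv x" and x: "x \<in> left_ext d ?y" by blast
    consider "x = ?y" | "x = bpow (bsign (hd ?y)) @ ?y"
      | t j where "x = t # bpow j @ ?y" "t \<in> nonb d" "reduced (t # bpow j @ ?y)"
      using x by (auto simp: left_ext_def)
    then show "v \<in> normal_words d"
    proof cases
      case 1
      then have "v = with_ends el c False" using v by (simp add: with_ends_def b_end_def)
      then show ?thesis using c by (auto simp: normal_words_def)
    next
      case 2
      then have "v = with_ends el c True" using v y(4) by (simp add: with_ends_def b_end_def word_inv_append)
      then show ?thesis using c by (auto simp: normal_words_def)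
    next
      case (3 t j)
      let ?c = "word_inv (t # bpow j @ word_inv c)"
      have "reduced (t # bpow j @ word_inv c)"
      proof -
        have "t # bpow j @ ?y = (t # bpow j @ word_inv c) @ word_inv (b_end el (hd c))"
          by (simp add: word_inv_append)
        then show ?thesis using 3(3) reduced_append by metis
      qed
      then have "core d (t # bpow j @ word_inv c)"
        using core_extend_left[of d "word_inv c" t j] 3 d c by (simp add: core_inv)
      then have "core d ?c" by (simp add: core_inv)
      moreover have "hd ?c = hd c" using c' by (simp add: word_inv_Cons word_inv_append)
      then have "v = with_ends el ?c False"
        using v 3 by (simp add: with_ends_def b_end_def word_inv_append word_inv_Cons)
      ultimately show ?thesis by (auto simp: normal_words_def)
    qed
  qed
  ultimately show ?thesis using in_span_mono by metis
qed

lemma span_letter: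
  assumes d: "d \<ge> 2" and v: "v \<in> F d" and nb: "\<exists>x\<in>set v. \<not> bletter x"
  shows "in_span d (normal_words d) (occ v)"
proof -
  have rv: "reduced v" using v by (simp add: carrier_iff)
  obtain u s l where vu: "v = u @ s # bpow l" "\<not> bletter s" "reduced (u @ [s])"
    using rv by (cases rule: word_cases_rev) (use nb bletter_bpow in blast)+
  obtain k t x where us: "u @ [s] = bpow k @ t # x" "\<not> bletter t" "reduced (t # x)"
    using vu(3)
  proof (cases rule: word_cases)
    case (power k)
    then show thesis using bpow_not_decode[OF vu(2), of k u "[]"] by simp
  qed (use that in blast)
  define c where "c = t # x"
  have vc: "v = bpow k @ c @ bpow l" using vu(1) us(1) by (simp add: c_def)
  have "last c = s" using us(1) by (metis c_def last_appendR last_snoc list.distinct(1))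
  then have c: "core d c" using us vu v vc by (auto simp: core_def c_def carrier_iff)
  have red: "reduced (c @ bpow l)" using rv vc by (simp add: reduced_append)
  have "in_span d (left_ext d (c @ bpow l)) (occ v)"
    unfolding vc by (rule left_normalise[OF d _ _ red]) (use us in \<open>simp_all add: c_def\<close>)
  moreover have "in_span d (normal_words d) (occ x)" if "x \<in> left_ext d (c @ bpow l)" for x
  proof -
    have hd: "hd (c @ bpow l) = hd c" by (simp add: c_def)
    consider "x = c @ bpow l" | "x = bpow (bsign (hd c)) @ c @ bpow l"
      | t j where "x = t # bpow j @ c @ bpow l" "t \<in> nonb d" "reduced (t # bpow j @ c @ bpow l)"
      using \<open>x \<in> left_ext d (c @ bpow l)\<close> unfolding left_ext_def hd by blast
    then show ?thesis
    proof cases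
      case 1
      then show ?thesis using right_normalise[OF d c, of False l] by (simp add: b_end_def)
    next
      case 2
      then show ?thesis using right_normalise[OF d c, of True l] by (simp add: b_end_def)
    next
      case (3 t j)
      have "t # bpow j @ c @ bpow l = (t # bpow j @ c) @ bpow l" by simp
      then have "reduced (t # bpow j @ c)" using 3(3) reduced_append by metis
      then have "core d (t # bpow j @ c)" using core_extend_left[OF c 3(2) _ d] by simp
      then show ?thesis using right_normalise[OF d, of "t # bpow j @ c" False l] 3(1) by (simp add: b_end_def)
    qed
  qed
  ultimately show ?thesis using in_span_subst by blast
qed

text \<open>The words \<open>b\<close> and \<open>b\<inverse>\<close> have no core; they only contribute a multiple of the exponent sum of \<open>b\<close>.\<close>

definition basic_words :: "nat \<Rightarrow> word set" where
  "basic_words d = normal_words d \<union> {[(2, True)], [(2, False)]}"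

lemma span_basic_words:
  assumes d: "d \<ge> 2" and v: "v \<in> nontriv d"
  shows "in_span d (basic_words d) (occ v)"
proof (cases "\<exists>x\<in>set v. \<not> bletter x")
  case True
  then have "in_span d (normal_words d) (occ v)" using span_letter[OF d _ True] v by (simp add: nontriv_iff)
  then show ?thesis by (rule in_span_mono) (auto simp: basic_words_def)
next
  case False
  let ?S = "in_span d (basic_words d)"
  let ?e = "\<lambda>c. if c then 1 else - 1 :: int"
  have pow: "?S (occ (bpow (?e c * int (Suc i))))" for c i
  proof (induction i)
    case 0
    then show ?case by (cases c) (auto intro!: in_span_occ simp: basic_words_def)
  next
    case (Suc i)
    define z where "z = bpow (?e c * int (Suc i))"
    have z: "(2, c) # z = bpow (?e c * int (Suc (Suc i)))"
      using bpow_pos[of "int (Suc (Suc i))"] bpow_neg[of "- int (Suc (Suc i))"]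
      by (cases c) (simp_all add: z_def algebra_simps)
    have nz: "\<not> reduced ((2, \<not> c) # z)"
      using bpow_pos[of "int (Suc i)"] bpow_neg[of "- int (Suc i)"]
      by (cases c) (simp_all add: z_def algebra_simps reduced_Cons)
    have t: "?S (\<lambda>w. \<Sum>t\<in>nonb d. occ (t # z) w)"
    proof (rule in_span_sum)
      fix t assume t: "t \<in> nonb d"
      then have "t # z \<in> F d" using bpow_letters[OF d] reduced_Cons_bpow[of t _ "[]"]
        by (auto simp: carrier_iff z_def)
      then have "in_span d (normal_words d) (occ (t # z))" using span_letter[OF d, of "t # z"] t by auto
      then show "?S (occ (t # z))" by (rule in_span_mono) (auto simp: basic_words_def)
    qed
    have "equivalent d (occ z) (\<lambda>w. occ ((2, True) # z) w + occ ((2, False) # z) w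
        + (\<Sum>t\<in>nonb d. occ (t # z) w))"
      by (rule occ_extend_b[OF d]) (simp add: z_def)
    then have "equivalent d (\<lambda>w. occ z w - (\<Sum>t\<in>nonb d. occ (t # z) w)) (occ ((2, c) # z))"
      unfolding equivalent_def
      by (cases c) (use nz in \<open>fastforce simp: occ_not_reduced carrier_iff algebra_simps\<close>)+
    then have "?S (occ ((2, c) # z))"
      using in_span_minus[OF Suc.IH t[unfolded z_def]] equivalent_sym in_span_equiv
      unfolding z_def by blast
    then show ?case by (simp add: z)
  qed
  obtain k where k: "v = bpow k" using False v bword_bpow[of v] by (auto simp: nontriv_iff carrier_iff)
  then have "k \<noteq> 0" using v by (auto simp: nontriv_iff)
  then consider i where "k = int (Suc i)" | i where "k = - int (Suc i)"
    by (metis int_cases of_nat_Suc not0_implies_Suc of_nat_0)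
  then show ?thesis using pow[of True] pow[of False] k by cases (metis (full_types) mult_1 mult_minus_left)+
qed

section \<open>The norm of a combination of normal words\<close>

text \<open>A form of the bound \<open>L\<close> for the norm of the class of \<open>f\<close> that is visibly closed under linear
  combinations.\<close>

definition norm_le :: "nat \<Rightarrow> (word \<Rightarrow> real) \<Rightarrow> nat \<Rightarrow> bool" where
  "norm_le d f L \<longleftrightarrow> in_span d {v \<in> nontriv d. length v \<le> L} f"

text \<open>Words in which copies of \<open>u\<close> alternate with given blocks, for the exchange argument of
  \<open>occ_swap\<close>.\<close>

fun chain :: "word \<Rightarrow> word list \<Rightarrow> word" where
  "chain u [] = u"
| "chain u (B # Bs) = u @ B @ chain u Bs"

lemma chain_hd: "\<exists>Y. chain u Bs = u @ Y \<and> (case Bs of [] \<Rightarrow> Y = [] | B # _ \<Rightarrow> \<exists>Z. Y = B @ Z)"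
  by (cases Bs) auto

lemma occ_sum_chain:
  assumes J: "\<And>v. v \<in> J \<Longrightarrow> v \<noteq> [] \<and> length v \<le> length u + 2" "finite J"
  shows "occ_sum J \<gamma> (chain u ([y, m, x] # [y', m', x'] # Bs))
    = (occ_sum J \<gamma> (u @ [y, m, x] @ u) - occ_sum J \<gamma> u) + occ_sum J \<gamma> (chain u ([y', m', x'] # Bs))
      + (if x # u @ [y'] \<in> J then \<gamma> (x # u @ [y']) else 0)"
proof -
  let ?R = "[m', x'] @ chain u Bs"
  have "\<gamma> v * occ v (chain u ([y, m, x] # [y', m', x'] # Bs))
      = (\<gamma> v * occ v (u @ [y, m, x] @ u) - \<gamma> v * occ v u)
        + \<gamma> v * occ v (chain u ([y', m', x'] # Bs)) + \<gamma> v * of_bool (v = x # u @ [y'])"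
    if "v \<in> J" for v
  proof -
    have "occ v (chain u ([y, m, x] # [y', m', x'] # Bs))
        = occ v (u @ [y, m, x] @ u) + occ v (chain u ([y', m', x'] # Bs)) - occ v u + of_bool (v = x # u @ [y'])"
      using occ_swap[of v u "u @ [y, m]" x y' ?R] J(1)[OF that] by simp
    then show ?thesis by (simp only: ring_distribs)
  qed
  then have "occ_sum J \<gamma> (chain u ([y, m, x] # [y', m', x'] # Bs))
      = (occ_sum J \<gamma> (u @ [y, m, x] @ u) - occ_sum J \<gamma> u) + occ_sum J \<gamma> (chain u ([y', m', x'] # Bs))
        + (\<Sum>v\<in>J. \<gamma> v * of_bool (v = x # u @ [y']))"
    unfolding occ_sum_def by (simp add: sum.distrib sum_subtractf)
  moreover have "(\<Sum>v\<in>J. \<gamma> v * of_bool (v = x # u @ [y'])) = (\<Sum>v\<in>J. if v = x # u @ [y'] then \<gamma> v else 0)"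
    by (rule sum.cong) auto
  ultimately show ?thesis using J(2) by (simp add: sum.delta)
qed

fun alternate :: "word \<Rightarrow> word \<Rightarrow> nat \<Rightarrow> word list" where
  "alternate B C 0 = []"
| "alternate B C (Suc N) = B # C # alternate B C N"

lemma reduced_chain:
  assumes "\<And>B. B \<in> set Bs \<Longrightarrow> B \<noteq> [] \<and> reduced (u @ B) \<and> reduced (B @ u)" "reduced u" "u \<noteq> []"
  shows "reduced (chain u Bs)"
  using assms(1)
proof (induction Bs)
  case (Cons B Bs)
  obtain Y where Y: "chain u Bs = u @ Y" using chain_hd by blast
  then have "reduced (u @ Y)" using Cons by simp
  then show ?case using Cons.prems[of B] assms(2,3) Y by (auto simp: reduced_append)
qed (use assms in simp)

lemma connecting_letter: "d \<ge> 2 \<Longrightarrow> \<exists>m\<in>letters d. m \<noteq> letter_inv y \<and> m \<noteq> letter_inv x"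
proof -
  assume "d \<ge> 2"
  then have L: "(1, True) \<in> letters d" "(1, False) \<in> letters d" "(2, True) \<in> letters d"
    by (auto simp: letters_def)
  have "((1, True) \<noteq> p \<and> (1, True) \<noteq> q) \<or> ((1, False) \<noteq> p \<and> (1, False) \<noteq> q)
      \<or> ((2, True) \<noteq> p \<and> (2, True) \<noteq> q)" for p q :: letter by auto
  then show ?thesis using L by metis
qed

text \<open>If \<open>u\<close> starts with a power of \<open>b\<close>, one more letter \<open>b\<^sup>\<plusminus>\<^sup>1\<close> makes a power that is too long at the
  left end; otherwise the end letter of the forbidden sign does the job.\<close>

lemma bad_left_letter:
  assumes "reduced u" "u \<noteq> []"
  shows "\<exists>x. bletter x \<and> reduced (x # u) \<and> (\<forall>z. x # u @ z \<notin> normal_words d)"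
proof -
  have key: "v \<notin> normal_words d"
    if v: "v = x # u @ z" and x: "x = (2, c)"
      "bletter (hd u) \<or> (c \<longleftrightarrow> hd u = (1, False))" for v x c z
  proof
    assume "v \<in> normal_words d"
    then obtain el k er where t: "v = with_ends el k er" "core d k" by (auto simp: normal_words_def)
    obtain h r where k: "k = h # r" "\<not> bletter h" using t(2) by (cases k) (auto simp: core_def)
    have "el" using t(1) v x(1) k by (cases el) (auto simp: with_ends_def b_end_def)
    then have "bpow (bsign h) @ h # (r @ word_inv (b_end er (letter_inv (last k)))) = x # u @ z"
      using t(1) v k by (simp add: with_ends_def b_end_def)
    then have "hd u = h \<and> (c \<longleftrightarrow> h \<noteq> (1, False))"
      using assms(2) x(1) by (cases u) (auto simp: bsign_def split: if_splits)
    then show False using k(2) x(2) by auto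
  qed
  show ?thesis
  proof (cases "bletter (hd u)")
    case True
    then obtain c where c: "hd u = (2, c)" using bletter_cases by blast
    then have "reduced ((2, c) # u)" using assms by (simp add: reduced_Cons)
    then show ?thesis using key[of _ "(2, c)" _ c] True by (intro exI[of _ "(2, c)"]) auto
  next
    case False
    let ?c = "hd u = (1, False)"
    have "hd u \<noteq> (2, e)" for e using False by (metis bletter_simps(1))
    then have "reduced ((2, ?c) # u)" using assms by (simp add: reduced_Cons)
    then show ?thesis using key[of _ "(2, ?c)" _ ?c] by (intro exI[of _ "(2, ?c)"]) auto
  qed
qed

lemma bad_right_letter:
  assumes "reduced u" "u \<noteq> []"
  shows "\<exists>y. bletter y \<and> reduced (u @ [y]) \<and> (\<forall>z. z @ u @ [y] \<notin> normal_words d)"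
proof -
  obtain x where x: "bletter x" "reduced (x # word_inv u)" "\<forall>z. x # word_inv u @ z \<notin> normal_words d"
    using bad_left_letter[of "word_inv u" d] assms reduced_word_inv by auto
  have "reduced (u @ [letter_inv x])"
    using reduced_word_inv[OF x(2)] by (simp add: word_inv_Cons)
  moreover have "z @ u @ [letter_inv x] \<notin> normal_words d" for z
    using x(3) normal_words_inv[of "z @ u @ [letter_inv x]" d]
    by (auto simp: word_inv_append word_inv_Cons)
  ultimately show ?thesis using x(1) by (intro exI[of _ "letter_inv x"]) auto
qed

lemma bounded_linear_zero:
  fixes g c D :: real
  assumes "\<And>N::nat. \<bar>real N * g + c\<bar> \<le> D"
  shows "g = 0"
proof (rule ccontr)
  assume "g \<noteq> 0"
  obtain N :: nat where "real N > (D + \<bar>c\<bar>) / \<bar>g\<bar>" using reals_Archimedean2 by blast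
  then have "real N * \<bar>g\<bar> > D + \<bar>c\<bar>" using \<open>g \<noteq> 0\<close> by (simp add: divide_less_eq)
  moreover have "\<bar>real N * g\<bar> - \<bar>c\<bar> \<le> \<bar>real N * g + c\<bar>" by linarith
  ultimately show False using assms[of N] by (simp add: abs_mult)
qed

text \<open>Write a longest word as \<open>x u y\<close> and choose letters \<open>x'\<close> and \<open>y'\<close> such that none of \<open>x' u y\<close>,
  \<open>x u y'\<close>, \<open>x' u y'\<close> is a normal word. Compare the words that repeat the block \<open>B = y m x\<close>, the block
  \<open>C = y' m' x'\<close>, or both in alternation, separated by copies of \<open>u\<close>. By \<open>occ_swap\<close> the sum of the
  values on the first two and the value on the third differ by the coefficient of \<open>x u y\<close> for each repetition, so a bounded
  combination has coefficient zero there.\<close>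

lemma top_coefficient_zero:
  assumes d: "d \<ge> 2" and J: "finite J" "J \<subseteq> nontriv d"
    and bd: "\<forall>w\<in>F d. \<bar>occ_sum J \<gamma> w\<bar> \<le> D"
    and L: "\<And>v. v \<in> J \<Longrightarrow> length v \<le> L"
    and N: "\<And>v. v \<in> J \<Longrightarrow> length v = L \<Longrightarrow> v \<in> normal_words d"
    and v: "v \<in> J" "length v = L" "L \<ge> 3"
  shows "\<gamma> v = 0"
proof -
  obtain x u y where vxy: "v = x # u @ [y]" "u \<noteq> []"
  proof -
    obtain x r where "v = x # r" using v by (cases v) auto
    moreover obtain u y where "r = u @ [y]" using v calculation by (cases r rule: rev_cases) auto
    ultimately have "v = x # u @ [y]" by simp
    moreover have "u \<noteq> []" using v calculation by auto
    ultimately show ?thesis by (rule that)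
  qed
  have vF: "v \<in> F d" using J(2) v(1) by (auto simp: nontriv_iff)
  then have u: "reduced u" "reduced (x # u)" "reduced (u @ [y])" "set u \<subseteq> letters d"
    "x \<in> letters d" "y \<in> letters d"
    using vxy by (auto simp: carrier_iff reduced_Cons reduced_append)
  obtain x' where x': "bletter x'" "reduced (x' # u)" "\<And>z. x' # u @ z \<notin> normal_words d"
    using bad_left_letter[OF u(1) vxy(2)] by blast
  obtain y' where y': "bletter y'" "reduced (u @ [y'])" "\<And>z. z @ u @ [y'] \<notin> normal_words d"
    using bad_right_letter[OF u(1) vxy(2)] by blast
  have bl: "bletter z \<Longrightarrow> z \<in> letters d" for z using d bletter_cases[of z] by (auto simp: letters_def)
  \<comment> \<open>The letters \<open>m\<close> and \<open>m'\<close> close the loops without cancellation.\<close>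
  obtain m where m: "m \<in> letters d" "m \<noteq> letter_inv y" "m \<noteq> letter_inv x"
    using connecting_letter[OF d] by blast
  obtain m' where m': "m' \<in> letters d" "m' \<noteq> letter_inv y'" "m' \<noteq> letter_inv x'"
    using connecting_letter[OF d] by blast
  define B where "B = [y, m, x]"
  define C where "C = [y', m', x']"
  have flip: "z \<noteq> letter_inv z' \<Longrightarrow> z' \<noteq> letter_inv z" for z z' by auto
  have redB: "reduced (u @ B)" "reduced (B @ u)"
    using u m vxy(2) by (auto simp: B_def reduced_append reduced_Cons flip)
  have redC: "reduced (u @ C)" "reduced (C @ u)"
    using u(1) x' y' m' vxy(2) by (auto simp: C_def reduced_append reduced_Cons flip)
  have chF: "chain u Bs \<in> F d" if "set Bs \<subseteq> {B, C}" for Bs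
  proof -
    have "set (chain u Bs) \<subseteq> letters d" using that
      by (induction Bs) (use u m m' bl x'(1) y'(1) in \<open>auto simp: B_def C_def\<close>)
    moreover have "reduced (chain u Bs)"
      by (rule reduced_chain) (use that redB redC u vxy in \<open>auto simp: B_def C_def\<close>)
    ultimately show ?thesis by (simp add: carrier_iff)
  qed
  define G where "G = occ_sum J \<gamma>"
  have len: "z \<noteq> [] \<and> length z \<le> length u + 2" if "z \<in> J" for z
    using that J(2) L[OF that] v vxy by (auto simp: nontriv_iff)
  have notJ: "x' # u @ [y] \<notin> J" "x # u @ [y'] \<notin> J" "x' # u @ [y'] \<notin> J"
  proof -
    have "z \<notin> J" if "z \<notin> normal_words d" "length z = L" for z using N that by blast
    then show "x' # u @ [y] \<notin> J" "x # u @ [y'] \<notin> J" "x' # u @ [y'] \<notin> J"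
      using x'(3) y'(3)[of "[x]"] v vxy by simp_all
  qed
  have step:
    "G (chain u (B # B # Bs)) = (G (u @ B @ u) - G u) + G (chain u (B # Bs)) + \<gamma> v"
    "G (chain u (B # C # Bs)) = (G (u @ B @ u) - G u) + G (chain u (C # Bs))"
    "G (chain u (C # B # Bs)) = (G (u @ C @ u) - G u) + G (chain u (B # Bs))"
    "G (chain u (C # C # Bs)) = (G (u @ C @ u) - G u) + G (chain u (C # Bs))" for Bs
    using occ_sum_chain[OF len J(1), of \<gamma>] notJ v(1) vxy(1)
    unfolding G_def B_def C_def by simp_all
  have rB: "G (chain u (B # replicate n B)) = (1 + real n) * (G (u @ B @ u) - G u) + G u + real n * \<gamma> v" for n
    by (induction n) (simp_all add: step algebra_simps del: chain.simps(2), simp_all add: algebra_simps)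
  have rC: "G (chain u (C # replicate n C)) = (1 + real n) * (G (u @ C @ u) - G u) + G u" for n
    by (induction n) (simp_all add: step algebra_simps del: chain.simps(2), simp_all add: algebra_simps)
  have rA: "G (chain u (B # C # alternate B C n))
      = (1 + real n) * (G (u @ B @ u) - G u + G (u @ C @ u) - G u) + G u" for n
    by (induction n) (simp_all add: step algebra_simps del: chain.simps(2), simp_all add: algebra_simps)
  have alt: "set (alternate B C n) \<subseteq> {B, C}" for n by (induction n) auto
  have GD: "\<bar>G (chain u Bs)\<bar> \<le> D" if "set Bs \<subseteq> {B, C}" for Bs
    using bd chF[OF that] by (simp add: G_def)
  have "\<bar>real n * \<gamma> v + G u\<bar> \<le> 3 * D" for n
  proof -
    have "\<bar>G (chain u (B # replicate n B))\<bar> \<le> D" "\<bar>G (chain u (C # replicate n C))\<bar> \<le> D"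
      "\<bar>G (chain u (B # C # alternate B C n))\<bar> \<le> D"
      using alt[of n] by (auto intro!: GD simp del: chain.simps)
    moreover have "real n * \<gamma> v + G u = G (chain u (B # replicate n B)) + G (chain u (C # replicate n C))
        - G (chain u (B # C # alternate B C n))"
      unfolding rB rC rA by (simp add: algebra_simps)
    ultimately show ?thesis by linarith
  qed
  then show ?thesis by (rule bounded_linear_zero)
qed

lemma sum_fibres:
  fixes a :: "'i \<Rightarrow> real"
  assumes "finite I" "finite K" "z ` I \<subseteq> K"
  shows "(\<Sum>i\<in>I. a i * g (z i)) = (\<Sum>v\<in>K. (\<Sum>i\<in>{i\<in>I. z i = v}. a i) * g v)"
proof -
  have "(\<Sum>v\<in>K. (\<Sum>i\<in>{i\<in>I. z i = v}. a i) * g v) = (\<Sum>v\<in>K. \<Sum>i\<in>{i\<in>I. z i = v}. a i * g (z i))"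
    by (auto simp: sum_distrib_right intro!: sum.cong)
  also have "\<dots> = (\<Sum>i\<in>I. a i * g (z i))" by (rule sum.group[OF assms])
  finally show ?thesis by simp
qed

text \<open>If the combination were equivalent to one of shorter words, then the difference would be bounded, and
  its longest words would be normal words with non-zero coefficients, against
  \<open>top_coefficient_zero\<close>. The words \<open>z i\<close> may coincide, so the coefficient of a word is a sum over its
  indices.\<close>

lemma norm_lower_bound:
  assumes d: "d \<ge> 2" and I: "finite I" "\<And>i. i \<in> I \<Longrightarrow> z i \<in> normal_words d"
    and f: "norm_le d (\<lambda>w. \<Sum>i\<in>I. a i * occ (z i) w) L"
    and coeff: "(\<Sum>i\<in>{i\<in>I. z i = y}. a i) \<noteq> 0" and y: "length y \<ge> 3"
  shows "length y \<le> L"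
proof (rule ccontr)
  assume "\<not> length y \<le> L"
  obtain J \<eta> where J: "finite J" "J \<subseteq> nontriv d" "\<And>v. v \<in> J \<Longrightarrow> length v \<le> L"
    and eq: "equivalent d (\<lambda>w. \<Sum>i\<in>I. a i * occ (z i) w) (occ_sum J \<eta>)"
    using f unfolding norm_le_def in_span_def by blast
  let ?K = "z ` I \<union> J"
  define \<gamma> where "\<gamma> v = (\<Sum>i\<in>{i\<in>I. z i = v}. a i) - (if v \<in> J then \<eta> v else 0)" for v
  define M where "M = {v \<in> ?K. \<gamma> v \<noteq> 0}"
  have fin: "finite ?K" using I J by auto
  obtain D where D: "\<forall>w\<in>F d. \<bar>(\<Sum>i\<in>I. a i * occ (z i) w) - occ_sum J \<eta> w\<bar> \<le> D"
    using eq by (auto simp: equivalent_def)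
  have "(\<Sum>i\<in>I. a i * occ (z i) w) - occ_sum J \<eta> w = occ_sum M \<gamma> w" for w
  proof -
    have "(\<Sum>i\<in>I. a i * occ (z i) w) - occ_sum J \<eta> w
        = (\<Sum>v\<in>?K. (\<Sum>i\<in>{i\<in>I. z i = v}. a i) * occ v w) - (\<Sum>v\<in>?K. (if v \<in> J then \<eta> v else 0) * occ v w)"
      unfolding occ_sum_superset[OF fin Un_upper2, of \<eta>]
      by (subst sum_fibres[OF I(1) fin]) (simp_all add: occ_sum_def)
    also have "\<dots> = (\<Sum>v\<in>?K. \<gamma> v * occ v w)"
      by (simp add: \<gamma>_def left_diff_distrib sum_subtractf)
    also have "\<dots> = (\<Sum>v\<in>M. \<gamma> v * occ v w)"
      by (rule sum.mono_neutral_right) (use fin in \<open>auto simp: M_def\<close>)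
    finally show ?thesis by (simp add: occ_sum_def)
  qed
  then have bd: "\<forall>w\<in>F d. \<bar>occ_sum M \<gamma> w\<bar> \<le> D" using D by simp
  have finM: "finite M" using fin by (simp add: M_def)
  have "y \<notin> J" using J(3) \<open>\<not> length y \<le> L\<close> by blast
  moreover have "y \<in> z ` I"
  proof (rule ccontr)
    assume "y \<notin> z ` I"
    then have "{i\<in>I. z i = y} = {}" by auto
    then show False using coeff by (metis sum.empty)
  qed
  ultimately have yM: "y \<in> M" using coeff by (simp add: M_def \<gamma>_def)
  define m where "m = Max (length ` M)"
  have m: "\<And>v. v \<in> M \<Longrightarrow> length v \<le> m" using finM by (simp add: m_def)
  obtain v where v: "v \<in> M" "length v = m"
    using Max_in[of "length ` M"] finM yM unfolding m_def by fastforce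
  have "\<gamma> v = 0"
  proof (rule top_coefficient_zero[OF d finM _ bd m _ v])
    show "M \<subseteq> nontriv d" using J(2) I(2) normal_words_nontriv[OF d] by (auto simp: M_def)
    show "x \<in> normal_words d" if "x \<in> M" "length x = m" for x
      using that J(3)[of x] m[OF yM] \<open>\<not> length y \<le> L\<close> I(2) by (force simp: M_def)
    show "3 \<le> m" using m[OF yM] y by simp
  qed
  then show False using v(1) by (simp add: M_def)
qed

section \<open>Counting functions composed with powers of the twist\<close>

definition stretched :: "letter \<Rightarrow> letter \<Rightarrow> bool" where
  "stretched t s \<longleftrightarrow> (t = (1, True)) \<noteq> (s = (1, False))"

lemma stretched_eq: "is_a t - is_a_inv s = (if stretched t s then bsign s else 0)"
  by (auto simp: stretched_def is_a_def is_a_inv_def bsign_def)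

lemma stretched_inv: "stretched (letter_inv s) (letter_inv t) = stretched t s"
  unfolding stretched_def by (cases s; cases t) auto

text \<open>The core of \<open>T\<^sup>n(c)\<close>: the exponents of the inner links of \<open>c\<close> are shifted, and the powers of \<open>b\<close> that
  \<open>T\<^sup>n\<close> produces at the two ends are left out.\<close>

definition core_shift :: "int \<Rightarrow> word \<Rightarrow> word" where
  "core_shift n c = tw n (is_a (last c)) (n * is_a_inv (hd c)) c"

lemma tw_core:
  assumes "core d c"
  shows "tw n e k (p @ c @ q) = tw n (is_a_inv (hd c)) k p @ core_shift n c @ tw n e (n * is_a (last c)) q"
proof -
  obtain s r where c: "c = s # r" using assms by (cases c) (auto simp: core_def)
  have s: "\<not> bletter s" using assms c by (simp add: core_def)
  show ?thesis
  proof (cases r rule: rev_cases)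
    case Nil
    then show ?thesis using s c by (simp add: tw_append core_shift_def)
  next
    case (snoc r' t)
    have t: "\<not> bletter t" using assms c snoc by (simp add: core_def)
    have "p @ c @ q = p @ s # (r' @ t # q)" using c snoc by simp
    then have "tw n e k (p @ c @ q)
        = tw n (is_a_inv s) k p @ s # tw n (is_a_inv t) (n * is_a s) r' @ t # tw n e (n * is_a t) q"
      using tw_append[OF s, of n e k p "r' @ t # q"] tw_append[OF t, of n e "n * is_a s" r' q] by simp
    moreover have "core_shift n c = s # tw n (is_a_inv t) (n * is_a s) r' @ [t]"
      using s t c snoc by (simp add: core_shift_def tw_append)
    ultimately show ?thesis using c snoc by simp
  qed
qed

lemma core_shift_Cons: "\<not> bletter s \<Longrightarrow> core_shift n (s # r) = s # tw n (is_a (last (s # r))) (n * is_a s) r"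
  by (simp add: core_shift_def)

lemma hd_core_shift: "core d c \<Longrightarrow> hd (core_shift n c) = hd c"
  by (cases c) (auto simp: core_def core_shift_Cons)

lemma core_shift_inv: "core d c \<Longrightarrow> word_inv (core_shift n c) = core_shift n (word_inv c)"
  using tw_word_inv[of c n "is_a (last c)" "is_a_inv (hd c)"]
  by (simp add: core_shift_def core_def carrier_iff hd_word_inv last_word_inv)

lemma last_core_shift: "core d c \<Longrightarrow> last (core_shift n c) = last c"
proof -
  assume c: "core d c"
  have "letter_inv (last (core_shift n c)) = hd (core_shift n (word_inv c))"
    using c hd_word_inv[of "core_shift n c"] core_shift_inv[OF c] by (cases c) (auto simp: core_def core_shift_Cons)
  also have "\<dots> = letter_inv (last c)"
    using hd_core_shift[of d "word_inv c" n] c core_inv[of d c] hd_word_inv[of c] by (simp add: core_def)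
  finally show ?thesis by simp
qed

lemma core_shift_core: "d \<ge> 2 \<Longrightarrow> core d c \<Longrightarrow> core d (core_shift n c)"
proof -
  assume d: "d \<ge> 2" and c: "core d c"
  have "core_shift n c \<in> F d" using c tw_carrier[OF d] by (simp add: core_shift_def core_def)
  moreover have "core_shift n c \<noteq> []" using c by (cases c) (auto simp: core_def core_shift_Cons)
  ultimately show ?thesis using c hd_core_shift[OF c] last_core_shift[OF c] by (simp add: core_def)
qed

lemma core_shift_inverse: "core d c \<Longrightarrow> core_shift (- n) (core_shift n c) = c"
proof -
  assume c: "core d c"
  have "core_shift (- n) (core_shift n c) = tw (- n) (is_a (last c)) (- n * is_a_inv (hd c)) (core_shift n c)"
    by (simp add: core_shift_def[of "- n"] hd_core_shift[OF c] last_core_shift[OF c])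
  also have "\<dots> = c" using c tw_inverse by (simp add: core_shift_def core_def carrier_iff)
  finally show ?thesis .
qed

lemma core_shift_inverse': "core d c \<Longrightarrow> core_shift n (core_shift (- n) c) = c"
  using core_shift_inverse[of d c "- n"] by simp

text \<open>An end letter \<open>b\<^sup>\<plusminus>\<^sup>1\<close> before \<open>s\<close> in \<open>T\<^sup>n(w)\<close> comes either from such a letter in \<open>w\<close>, or from a
  stretched link of \<open>w\<close> whose exponent, counted in the direction of the shift, is at most \<open>0\<close>
  but at least \<open>1 - n\<close>.\<close>

definition left_choices :: "nat \<Rightarrow> nat \<Rightarrow> bool \<Rightarrow> letter \<Rightarrow> word set" where
  "left_choices d n el s =
     (if el then insert (bpow (bsign s))
        ((\<lambda>(t, i). t # bpow (bsign s * i)) ` ({t \<in> nonb d. stretched t s} \<times> {1 - int n..0}))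
      else {[]})"

definition right_choices :: "nat \<Rightarrow> nat \<Rightarrow> bool \<Rightarrow> letter \<Rightarrow> word set" where
  "right_choices d n er s = word_inv ` left_choices d n er (letter_inv s)"

lemma finite_choices [simp]: "finite (left_choices d n el s)" "finite (right_choices d n er s)"
  by (auto simp: left_choices_def right_choices_def)

lemma left_choices_cases:
  assumes "l \<in> left_choices d n el s"
  obtains (none) "\<not> el" "l = []" | (b) "el" "l = bpow (bsign s)"
  | (letter) t i where "el" "l = t # bpow (bsign s * i)" "t \<in> nonb d" "stretched t s" "1 - int n \<le> i" "i \<le> 0"
proof (cases el)
  case True
  then consider "l = bpow (bsign s)"
    | x where "l = (\<lambda>(t, i). t # bpow (bsign s * i)) x" "x \<in> {t \<in> nonb d. stretched t s} \<times> {1 - int n..0}"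
    using assms unfolding left_choices_def by auto
  then show ?thesis
  proof cases
    case (2 x)
    then show ?thesis using letter[of "fst x" "snd x"] True by (auto simp: case_prod_unfold mem_Times_iff)
  qed (use b True in simp)
qed (use assms none in \<open>simp add: left_choices_def\<close>)

lemma suffix_letter_bpow:
  "\<not> bletter t \<Longrightarrow> \<not> bletter t' \<Longrightarrow> suffix (t' # bpow i) (p @ t # bpow j) \<longleftrightarrow> t' = t \<and> i = j"
proof -
  assume t: "\<not> bletter t" "\<not> bletter t'"
  have "t' = t \<and> i = j" if "p @ t # bpow j = x @ t' # bpow i" for x
  proof -
    have "bpow (- j) @ letter_inv t # word_inv p = bpow (- i) @ letter_inv t' # word_inv x"
      using arg_cong[OF that, of word_inv] by (simp add: word_inv_append word_inv_Cons)
    from bpow_append_decode[OF _ _ this] show ?thesis using t by simp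
  qed
  then have "t' = t \<and> i = j" if "suffix (t' # bpow i) (p @ t # bpow j)"
    using that unfolding suffix_def by blast
  moreover have "suffix (t # bpow j) (p @ t # bpow j)" by (simp add: suffix_def)
  ultimately show ?thesis by blast
qed

lemma suffix_sign:
  assumes "\<not> bletter t"
  shows "suffix (bpow (bsign s)) (p @ t # bpow j) \<longleftrightarrow> bsign s * j \<ge> 1"
proof -
  have "suffix (bpow (bsign s)) (p @ t # bpow j) \<longleftrightarrow> last (p @ t # bpow j) = (2, bsign s > 0)"
  proof -
    have "suffix [z] w \<longleftrightarrow> last w = z" if "w \<noteq> []" for z :: letter and w
      using that by (cases w rule: rev_cases) (auto simp: suffix_def)
    then show ?thesis by (auto simp: bsign_def)
  qed
  also have "\<dots> \<longleftrightarrow> bsign s * j \<ge> 1"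
    using assms by (cases "j = 0") (auto simp: last_bpow bsign_def)
  finally show ?thesis .
qed

lemma sum_of_bool_unique:
  assumes "finite A" "\<And>x y. x \<in> A \<Longrightarrow> y \<in> A \<Longrightarrow> P x \<Longrightarrow> P y \<Longrightarrow> x = y"
  shows "(\<Sum>x\<in>A. of_bool (P x)) = (of_bool (\<exists>x\<in>A. P x) :: real)"
proof (cases "\<exists>x\<in>A. P x")
  case True
  then obtain x where x: "x \<in> A" "P x" by blast
  then have "(\<Sum>y\<in>A. of_bool (P y)) = (\<Sum>y\<in>A. if y = x then 1 else (0::real))"
    using assms(2) by (intro sum.cong) auto
  then show ?thesis using x assms(1) by (auto simp: sum.delta)
qed auto

text \<open>Counted in the direction of the shift, the end letter stands for the exponents from \<open>1\<close> on, and the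
  other choices for the exponents from \<open>1 - n\<close> to \<open>0\<close> of a stretched link. They exclude each other, and
  together they are the exponents that are positive after the shift.\<close>

lemma left_choices_count:
  assumes t: "t \<in> nonb d" and s: "\<not> bletter s"
  shows "(\<Sum>l\<in>left_choices d n el s. of_bool (suffix l (p @ t # bpow j)))
    = (of_bool (suffix (b_end el s) (tw (int n) (is_a_inv s) 0 (p @ t # bpow j))) :: real)"
proof (cases el)
  case False
  then show ?thesis by (simp add: left_choices_def b_end_def)
next
  case True
  have nb: "\<not> bletter t" using t by simp
  have bs: "bsign s * bsign s = 1" by (simp add: bsign_def)
  have inj: "bsign s * i = j \<longleftrightarrow> i = bsign s * j" for i j by (auto simp: bsign_def)
  have iff: "(\<exists>l\<in>left_choices d n el s. suffix l (p @ t # bpow j))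
      \<longleftrightarrow> bsign s * j \<ge> 1 \<or> (stretched t s \<and> 1 - int n \<le> bsign s * j \<and> bsign s * j \<le> 0)"
    using t True by (auto simp: left_choices_def suffix_sign suffix_letter_bpow inj)
  have "(\<Sum>l\<in>left_choices d n el s. of_bool (suffix l (p @ t # bpow j)))
      = (of_bool (\<exists>l\<in>left_choices d n el s. suffix l (p @ t # bpow j)) :: real)"
  proof (rule sum_of_bool_unique)
    fix x y assume xy: "x \<in> left_choices d n el s" "y \<in> left_choices d n el s"
      "suffix x (p @ t # bpow j)" "suffix y (p @ t # bpow j)"
    from xy(1) show "x = y"
    proof (cases rule: left_choices_cases)
      case b
      then have j: "bsign s * j \<ge> 1" using xy(3) nb by (simp add: suffix_sign)
      from xy(2) show ?thesis
        by (cases rule: left_choices_cases) (use b xy(4) j nb in \<open>auto simp: suffix_letter_bpow inj\<close>)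
    next
      case (letter t' i)
      then have j: "t' = t" "bsign s * i = j" using xy(3) nb by (auto simp: suffix_letter_bpow)
      from xy(2) show ?thesis
      proof (cases rule: left_choices_cases)
        case b
        then have "bsign s * j \<ge> 1" using xy(4) nb by (simp add: suffix_sign)
        moreover have "bsign s * j = i" using j(2) bs by (auto simp: inj)
        ultimately show ?thesis using letter by simp
      qed (use letter xy(4) j nb in \<open>auto simp: suffix_letter_bpow\<close>)
    qed (use True in simp)
  qed simp
  also have "\<dots> = of_bool (bsign s * (int n * is_a t + j - int n * is_a_inv s) \<ge> 1)"
  proof -
    have "int n * is_a t + j - int n * is_a_inv s = j + int n * (if stretched t s then bsign s else 0)"
      unfolding stretched_eq[of t s, symmetric] by (simp add: algebra_simps)
    then have "bsign s * (int n * is_a t + j - int n * is_a_inv s) = bsign s * j + (if stretched t s then int n else 0)"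
      using bs by (auto simp: algebra_simps)
    then show ?thesis unfolding iff by (intro arg_cong[where f = of_bool]) auto
  qed
  also have "\<dots> = of_bool (suffix (b_end el s) (tw (int n) (is_a_inv s) 0 (p @ t # bpow j)))"
    using True nb by (simp add: b_end_def tw_append suffix_sign)
  finally show ?thesis .
qed

lemma left_choices_count_word:
  assumes p: "p \<in> F d" "\<exists>x\<in>set p. \<not> bletter x" and s: "\<not> bletter s"
  shows "(\<Sum>l\<in>left_choices d n el s. of_bool (suffix l p))
    = (of_bool (suffix (b_end el s) (tw (int n) (is_a_inv s) 0 p)) :: real)"
proof -
  have "reduced p" using p by (simp add: carrier_iff)
  then show ?thesis
  proof (cases rule: word_cases_rev)
    case (power k)
    then show ?thesis using p(2) bletter_bpow by blast
  next
    case (letter u t k)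
    then show ?thesis using left_choices_count[of t d s] s p(1) by (auto simp: carrier_iff)
  qed
qed

lemma prefix_iff_suffix_inv: "prefix r q \<longleftrightarrow> suffix (word_inv r) (word_inv q)"
proof
  assume "prefix r q"
  then show "suffix (word_inv r) (word_inv q)" by (auto simp: prefix_def suffix_def word_inv_append)
next
  assume "suffix (word_inv r) (word_inv q)"
  then obtain x where "word_inv q = x @ word_inv r" by (auto simp: suffix_def)
  then have "word_inv (word_inv q) = r @ word_inv x" by (simp only: word_inv_append word_inv_inv)
  then show "prefix r q" by simp
qed

lemma inj_word_inv: "inj_on word_inv A"
  by (rule inj_on_inverseI[of _ word_inv]) simp

lemma right_choices_count_word:
  assumes q: "q \<in> F d" "\<exists>x\<in>set q. \<not> bletter x" and s: "\<not> bletter s"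
  shows "(\<Sum>r\<in>right_choices d n er s. of_bool (prefix r q))
    = (of_bool (prefix (word_inv (b_end er (letter_inv s))) (tw (int n) 0 (int n * is_a s) q)) :: real)"
proof -
  have "(\<Sum>r\<in>right_choices d n er s. of_bool (prefix r q))
      = (\<Sum>l\<in>left_choices d n er (letter_inv s). of_bool (suffix l (word_inv q)) :: real)"
    unfolding right_choices_def by (subst sum.reindex[OF inj_word_inv]) (simp add: prefix_iff_suffix_inv)
  also have "\<dots> = of_bool (suffix (b_end er (letter_inv s)) (tw (int n) (is_a_inv (letter_inv s)) 0 (word_inv q)))"
    proof (rule left_choices_count_word)
    show "word_inv q \<in> F d" using q by (simp add: carrier_inv)
    show "\<exists>x\<in>set (word_inv q). \<not> bletter x" using q by (auto simp: word_inv_def)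
  qed (use s in simp)
  also have "\<dots> = of_bool (prefix (word_inv (b_end er (letter_inv s))) (tw (int n) 0 (int n * is_a s) q))"
    using tw_word_inv[of q "int n" 0 "is_a s"] q(1) by (simp add: prefix_iff_suffix_inv carrier_iff)
  finally show ?thesis .
qed

text \<open>The occurrences of \<open>c\<close> in \<open>T\<^sup>n(w)\<close> are the images of those of the shifted core in \<open>w\<close>, since \<open>T\<^sup>-\<^sup>n\<close>
  undoes the correspondence.\<close>

lemma split_bij:
  assumes d: "d \<ge> 2" and c: "core d c" and w: "reduced w"
  shows "bij_betw (\<lambda>(p, q). (tw n (is_a_inv (hd c)) 0 p, tw n 0 (n * is_a (last c)) q))
    {(p, q). w = p @ core_shift (- n) c @ q} {(p, q). tw n 0 0 w = p @ c @ q}"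
proof -
  let ?c = "core_shift (- n) c"
  have c': "core d ?c \<Longrightarrow> tw n 0 0 (p @ ?c @ q) = tw n (is_a_inv (hd c)) 0 p @ c @ tw n 0 (n * is_a (last c)) q" for p q
    using tw_core[of d ?c n 0 0 p q] core_shift_inverse'[OF c] hd_core_shift[OF c] last_core_shift[OF c] by simp
  have cc: "core d ?c" by (rule core_shift_core[OF d c])
  show ?thesis
  proof (rule bij_betw_byWitness[where f' = "\<lambda>(p, q). (tw (- n) (is_a_inv (hd c)) 0 p, tw (- n) 0 (- n * is_a (last c)) q)"])
    show "\<forall>a\<in>{(p, q). w = p @ ?c @ q}.
        (case case a of (p, q) \<Rightarrow> (tw n (is_a_inv (hd c)) 0 p, tw n 0 (n * is_a (last c)) q) of
          (p, q) \<Rightarrow> (tw (- n) (is_a_inv (hd c)) 0 p, tw (- n) 0 (- n * is_a (last c)) q)) = a"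
      using w tw_inverse[of _ n "is_a_inv (hd c)" 0] tw_inverse[of _ n 0 "is_a (last c)"]
      by (auto simp: reduced_append)
    show "\<forall>a\<in>{(p, q). tw n 0 0 w = p @ c @ q}.
        (case case a of (p, q) \<Rightarrow> (tw (- n) (is_a_inv (hd c)) 0 p, tw (- n) 0 (- n * is_a (last c)) q) of
          (p, q) \<Rightarrow> (tw n (is_a_inv (hd c)) 0 p, tw n 0 (n * is_a (last c)) q)) = a"
    proof clarify
      fix p q assume "tw n 0 0 w = p @ c @ q"
      then have "reduced p" "reduced q" using reduced_tw[OF w, of n 0 0] by (auto simp: reduced_append)
      then show "tw n (is_a_inv (hd c)) 0 (tw (- n) (is_a_inv (hd c)) 0 p) = p
          \<and> tw n 0 (n * is_a (last c)) (tw (- n) 0 (- n * is_a (last c)) q) = q"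
        using tw_inverse[of p "- n" "is_a_inv (hd c)" 0] tw_inverse[of q "- n" 0 "is_a (last c)"] by simp
    qed
    show "(\<lambda>(p, q). (tw n (is_a_inv (hd c)) 0 p, tw n 0 (n * is_a (last c)) q)) ` {(p, q). w = p @ ?c @ q}
        \<subseteq> {(p, q). tw n 0 0 w = p @ c @ q}"
      using c'[OF cc] by auto
    show "(\<lambda>(p, q). (tw (- n) (is_a_inv (hd c)) 0 p, tw (- n) 0 (- n * is_a (last c)) q)) `
        {(p, q). tw n 0 0 w = p @ c @ q} \<subseteq> {(p, q). w = p @ ?c @ q}"
    proof clarify
      fix p q assume e: "tw n 0 0 w = p @ c @ q"
      have "w = tw (- n) 0 0 (p @ c @ q)" using tw_inverse0[OF w, of n] e by simp
      also have "\<dots> = tw (- n) (is_a_inv (hd c)) 0 p @ ?c @ tw (- n) 0 (- n * is_a (last c)) q"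
        by (rule tw_core[OF c])
      finally show "w = tw (- n) (is_a_inv (hd c)) 0 p @ ?c @ tw (- n) 0 (- n * is_a (last c)) q" .
    qed
  qed
qed

lemma takeWhile_split: "\<forall>y\<in>set xs. P y \<Longrightarrow> \<not> P z \<Longrightarrow> takeWhile P (xs @ z # zs) = xs"
  by (induction xs) auto

text \<open>At the first and the last non-\<open>b\<close> letter of a word there is no link beyond, so that the count of the
  choices fails there. The error stays bounded because only two occurrences are concerned.\<close>

lemma finite_boundary_splits:
  assumes c: "c \<noteq> []" "\<not> bletter (hd c)" "\<not> bletter (last c)"
  shows "card {x \<in> {(p, q). w = p @ c @ q}. (\<forall>y\<in>set (fst x). bletter y) \<or> (\<forall>y\<in>set (snd x). bletter y)} \<le> 2"
proof -
  let ?p = "takeWhile bletter w" and ?q = "rev (takeWhile bletter (rev w))"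
  have 1: "p = ?p" if "w = p @ c @ q" "\<forall>y\<in>set p. bletter y" for p q
  proof -
    obtain z b where b: "c = z # b" using c(1) list.exhaust by blast
    have rw: "w = p @ z # (b @ q)" unfolding that(1) b by simp
    have "takeWhile bletter w = p"
      unfolding rw by (rule takeWhile_split) (use that(2) c(2) b in auto)
    then show ?thesis by (rule sym)
  qed
  have 2: "q = ?q" if "w = p @ c @ q" "\<forall>y\<in>set q. bletter y" for p q
  proof -
    obtain b z where b: "c = b @ [z]" using c(1) rev_exhaust by blast
    have rw: "rev w = rev q @ z # (rev b @ rev p)" unfolding that(1) b by simp
    have "takeWhile bletter (rev w) = rev q"
      unfolding rw by (rule takeWhile_split) (use that(2) c(3) b in auto)
    then show ?thesis by (metis rev_rev_ident)
  qed
  have "{x \<in> {(p, q). w = p @ c @ q}. (\<forall>y\<in>set (fst x). bletter y) \<or> (\<forall>y\<in>set (snd x). bletter y)}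
      \<subseteq> {(?p, drop (length ?p + length c) w), (take (length w - length ?q - length c) w, ?q)}"
  proof
    fix x assume x: "x \<in> {x \<in> {(p, q). w = p @ c @ q}. (\<forall>y\<in>set (fst x). bletter y) \<or> (\<forall>y\<in>set (snd x). bletter y)}"
    then obtain p q where pq: "x = (p, q)" "w = p @ c @ q" by auto
    then have "(\<forall>y\<in>set p. bletter y) \<or> (\<forall>y\<in>set q. bletter y)" using x by auto
    then have "p = ?p \<or> q = ?q" using 1 2 pq(2) by blast
    moreover have qd: "q = drop (length p + length c) w" and pd: "p = take (length w - length q - length c) w"
      using pq(2) by simp_all
    ultimately have "x = (?p, drop (length ?p + length c) w) \<or> x = (take (length w - length ?q - length c) w, ?q)"
      using pq(1) by metis
    then show "x \<in> {(?p, drop (length ?p + length c) w), (take (length w - length ?q - length c) w, ?q)}"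
      by blast
  qed
  then have "card {x \<in> {(p, q). w = p @ c @ q}. (\<forall>y\<in>set (fst x). bletter y) \<or> (\<forall>y\<in>set (snd x). bletter y)}
      \<le> card {(?p, drop (length ?p + length c) w), (take (length w - length ?q - length c) w, ?q)}"
    by (intro card_mono) auto
  then show ?thesis by (auto simp: card_insert_if split: if_splits)
qed

text \<open>Match the occurrences of the core in \<open>T\<^sup>n(w)\<close> with those of the shifted core in \<open>w\<close>. For each of them the
  conditions at the two ends are sums over the choices, apart from the boundary occurrences.\<close>

lemma occ_with_ends_twist:
  assumes d: "d \<ge> 2" and c: "core d c"
  shows "equivalent d (\<lambda>w. occ (with_ends el c er) (tw (int n) 0 0 w))
    (\<lambda>w. \<Sum>l\<in>left_choices d n el (hd c). \<Sum>r\<in>right_choices d n er (last c). occ (l @ core_shift (- int n) c @ r) w)"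
proof -
  let ?L = "left_choices d n el (hd c)" and ?R = "right_choices d n er (last c)"
  let ?c = "core_shift (- int n) c"
  let ?l = "b_end el (hd c)" and ?r = "word_inv (b_end er (letter_inv (last c)))"
  let ?f = "tw (int n) (is_a_inv (hd c)) 0" and ?g = "tw (int n) 0 (int n * is_a (last c))"
  define D where "D = 1 + real (card ?L) * real (card ?R)"
  have c': "c \<noteq> []" "\<not> bletter (hd c)" "\<not> bletter (last c)" using c by (auto simp: core_def)
  have cs: "core d ?c" by (rule core_shift_core[OF d c])
  have "\<bar>occ (with_ends el c er) (tw (int n) 0 0 w) - (\<Sum>l\<in>?L. \<Sum>r\<in>?R. occ (l @ ?c @ r) w)\<bar> \<le> 2 * D" if w: "w \<in> F d" for w
  proof -
    let ?S = "{(p, q). w = p @ ?c @ q}"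
    let ?B = "{x \<in> ?S. (\<forall>y\<in>set (fst x). bletter y) \<or> (\<forall>y\<in>set (snd x). bletter y)}"
    \<comment> \<open>The conditions at the two ends in the image, and the same as a count of choices.\<close>
    define A where "A x = (of_bool (suffix ?l (?f (fst x))) * of_bool (prefix ?r (?g (snd x))) :: real)" for x
    define A' where "A' x = (\<Sum>l\<in>?L. of_bool (suffix l (fst x))) * (\<Sum>r\<in>?R. of_bool (prefix r (snd x)) :: real)" for x
    have rw: "reduced w" using w by (simp add: carrier_iff)
    have "occ (with_ends el c er) (tw (int n) 0 0 w)
        = (\<Sum>(p, q)\<in>{(p, q). tw (int n) 0 0 w = p @ c @ q}. of_bool (suffix ?l p) * of_bool (prefix ?r q))"
      unfolding with_ends_def by (rule occ_context)
    also have "\<dots> = (\<Sum>x\<in>?S. A x)"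
      by (subst sum.reindex_bij_betw[OF split_bij[OF d c rw, of "int n"], symmetric])
        (simp add: A_def case_prod_unfold)
    finally have 1: "occ (with_ends el c er) (tw (int n) 0 0 w) = (\<Sum>x\<in>?S. A x)" .
    have "(\<Sum>l\<in>?L. \<Sum>r\<in>?R. occ (l @ ?c @ r) w)
        = (\<Sum>l\<in>?L. \<Sum>r\<in>?R. \<Sum>x\<in>?S. of_bool (suffix l (fst x)) * of_bool (prefix r (snd x)))"
      unfolding occ_context by (simp add: case_prod_unfold)
    also have "\<dots> = (\<Sum>l\<in>?L. \<Sum>x\<in>?S. \<Sum>r\<in>?R. of_bool (suffix l (fst x)) * of_bool (prefix r (snd x)))"
      by (intro sum.cong refl sum.swap)
    also have "\<dots> = (\<Sum>x\<in>?S. \<Sum>l\<in>?L. \<Sum>r\<in>?R. of_bool (suffix l (fst x)) * of_bool (prefix r (snd x)))"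
      by (rule sum.swap)
    also have "\<dots> = (\<Sum>x\<in>?S. A' x)"
      unfolding A'_def sum_product ..
    finally have 2: "(\<Sum>l\<in>?L. \<Sum>r\<in>?R. occ (l @ ?c @ r) w) = (\<Sum>x\<in>?S. A' x)" .
    have eq: "A x = A' x" if "x \<in> ?S - ?B" for x
    proof -
      have "x \<in> ?S" using that by blast
      then obtain p q where x: "x = (p, q)" "w = p @ ?c @ q" by auto
      then have "p \<in> F d" "q \<in> F d" using w by (auto simp: carrier_iff reduced_append)
      moreover have "\<exists>y\<in>set p. \<not> bletter y" "\<exists>y\<in>set q. \<not> bletter y" using that x by auto
      ultimately show ?thesis
        unfolding A_def A'_def x fst_conv snd_conv
        by (simp only: left_choices_count_word[OF _ _ c'(2)] right_choices_count_word[OF _ _ c'(3)])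
    qed
    have le: "\<bar>A x - A' x\<bar> \<le> D" for x
    proof -
      have "0 \<le> A x" "A x \<le> 1" by (auto simp: A_def)
      moreover have "(\<Sum>l\<in>?L. of_bool (suffix l (fst x))) \<le> (\<Sum>l\<in>?L. 1 :: real)"
        "(\<Sum>r\<in>?R. of_bool (prefix r (snd x))) \<le> (\<Sum>r\<in>?R. 1 :: real)" by (rule sum_mono; simp)+
      then have "A' x \<le> real (card ?L) * real (card ?R)"
        unfolding A'_def by (intro mult_mono) (auto intro: sum_nonneg)
      moreover have "0 \<le> A' x" unfolding A'_def by (intro mult_nonneg_nonneg sum_nonneg) auto
      ultimately show ?thesis unfolding D_def by linarith
    qed
    have "\<bar>(\<Sum>x\<in>?S. A x) - (\<Sum>x\<in>?S. A' x)\<bar> = \<bar>\<Sum>x\<in>?S. A x - A' x\<bar>" by (simp add: sum_subtractf)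
    also have "(\<Sum>x\<in>?S. A x - A' x) = (\<Sum>x\<in>?B. A x - A' x)"
      by (rule sum.mono_neutral_right) (use eq finite_splits[of w ?c] in auto)
    also have "\<bar>\<Sum>x\<in>?B. A x - A' x\<bar> \<le> (\<Sum>x\<in>?B. D)"
      by (rule order.trans[OF sum_abs sum_mono]) (rule le)
    also have "\<dots> = real (card ?B) * D" by simp
    also have "\<dots> \<le> 2 * D"
    proof (rule mult_right_mono)
      have "card ?B \<le> 2" by (rule finite_boundary_splits) (use cs in \<open>auto simp: core_def\<close>)
      then show "real (card ?B) \<le> 2" by linarith
      show "0 \<le> D" by (simp add: D_def)
    qed
    finally show ?thesis using 1 2 by simp
  qed
  then show ?thesis unfolding equivalent_def by blast
qed

section \<open>Degrees and lengths\<close>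

abbreviation strip_b :: "word \<Rightarrow> word" where
  "strip_b \<equiv> filter (\<lambda>x. \<not> bletter x)"

text \<open>The number of stretched links, as a function of the sequence of the non-\<open>b\<close> letters alone.\<close>

fun links :: "word \<Rightarrow> nat" where
  "links (t # s # w) = of_bool (stretched t s) + links (s # w)"
| "links _ = 0"

lemma strip_b_bpow [simp]: "strip_b (bpow k) = []"
  by (auto simp: filter_empty_conv dest: bletter_bpow)

lemma strip_b_tw [simp]: "strip_b (tw n e k w) = strip_b w"
  by (induction w arbitrary: k) auto

lemma strip_b_word_inv: "strip_b (word_inv w) = word_inv (strip_b w)"
  by (simp add: word_inv_def rev_filter[symmetric] filter_map o_def)

lemma links_snoc: "links (xs @ [t]) = links xs + (if xs = [] then 0 else of_bool (stretched (last xs) t))"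
  by (induction xs rule: links.induct) auto

lemma links_word_inv: "links (word_inv xs) = links xs"
proof (induction xs rule: links.induct)
  case (1 t s w)
  then show ?case
    using links_snoc[of "word_inv (s # w)" "letter_inv t"] by (simp add: word_inv_Cons stretched_inv)
qed (auto simp: word_inv_Cons)

lemma strip_b_core_shift [simp]: "strip_b (core_shift n c) = strip_b c"
  by (simp add: core_shift_def)

lemma abs_stretch:
  "\<bar>m * is_a t + k - m * is_a_inv s\<bar> \<le> \<bar>k\<bar> + \<bar>m\<bar> * of_bool (stretched t s)"
  "\<bar>m\<bar> * of_bool (stretched t s) \<le> \<bar>m * is_a t + k - m * is_a_inv s\<bar> + \<bar>k\<bar>"
proof -
  have "m * is_a t + k - m * is_a_inv s = k + m * (is_a t - is_a_inv s)" by (simp add: algebra_simps)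
  also have "\<dots> = k + m * (if stretched t s then bsign s else 0)" by (simp only: stretched_eq)
  finally have eq: "m * is_a t + k - m * is_a_inv s = k + m * (if stretched t s then bsign s else 0)" .
  show "\<bar>m * is_a t + k - m * is_a_inv s\<bar> \<le> \<bar>k\<bar> + \<bar>m\<bar> * of_bool (stretched t s)"
    "\<bar>m\<bar> * of_bool (stretched t s) \<le> \<bar>m * is_a t + k - m * is_a_inv s\<bar> + \<bar>k\<bar>"
    unfolding eq by (auto simp: bsign_def)
qed

text \<open>Each stretched link of the word \<open>t w\<close> changes its exponent by \<open>\<bar>m\<bar>\<close> in one direction, so its length
  becomes \<open>\<bar>m\<bar>\<close> up to the original exponent.\<close>

lemma length_tw_after:
  "reduced w \<Longrightarrow> w \<noteq> [] \<Longrightarrow> \<not> bletter (last w) \<Longrightarrow>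
    int (length (tw m (is_a (last w)) (m * is_a t) w)) \<le> int (length w) + \<bar>m\<bar> * int (links (t # strip_b w)) \<and>
    \<bar>m\<bar> * int (links (t # strip_b w)) \<le> int (length (tw m (is_a (last w)) (m * is_a t) w)) + int (length w)"
proof (induction w arbitrary: t rule: word_induct)
  case (power k)
  have "k \<noteq> 0" using power by auto
  then show ?case using power by (simp add: last_bpow)
next
  case (letter k s u)
  show ?case
  proof (cases "u = []")
    case True
    then show ?thesis using letter(1) abs_stretch(1)[of m t k s] abs_stretch(2)[of m t s k] by (simp add: algebra_simps)
  next
    case False
    have "int (length (tw m (is_a (last u)) (m * is_a s) u)) \<le> int (length u) + \<bar>m\<bar> * int (links (s # strip_b u)) \<and>
      \<bar>m\<bar> * int (links (s # strip_b u)) \<le> int (length (tw m (is_a (last u)) (m * is_a s) u)) + int (length u)"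
      by (rule letter.IH) (use False letter.prems in auto)
    then show ?thesis using False letter(1) abs_stretch(1)[of m t k s] abs_stretch(2)[of m t s k] by (simp add: algebra_simps)
  qed
qed

lemma length_core_shift:
  assumes "core d c"
  shows "length (core_shift m c) \<le> length c + nat \<bar>m\<bar> * links (strip_b c)"
    and "nat \<bar>m\<bar> * links (strip_b c) \<le> length (core_shift m c) + length c"
proof -
  obtain s x where c: "c = s # x" using assms by (cases c) (auto simp: core_def)
  have s: "\<not> bletter s" and x: "reduced x" using assms by (auto simp: core_def c carrier_iff reduced_Cons)
  have "int (length (core_shift m c)) \<le> int (length c) + \<bar>m\<bar> * int (links (strip_b c)) \<and>
    \<bar>m\<bar> * int (links (strip_b c)) \<le> int (length (core_shift m c)) + int (length c)"
  proof (cases "x = []")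
    case True
    then show ?thesis using s by (simp add: c core_shift_Cons)
  next
    case False
    then show ?thesis using length_tw_after[OF x, of m s] assms s
      by (simp add: c core_shift_Cons core_def)
  qed
  then have "int (length (core_shift m c)) \<le> int (length c + nat \<bar>m\<bar> * links (strip_b c))"
    "int (nat \<bar>m\<bar> * links (strip_b c)) \<le> int (length (core_shift m c) + length c)" by simp_all
  then show "length (core_shift m c) \<le> length c + nat \<bar>m\<bar> * links (strip_b c)"
    "nat \<bar>m\<bar> * links (strip_b c) \<le> length (core_shift m c) + length c" by (simp_all only: of_nat_le_iff)
qed

lemma length_left_choices: "l \<in> left_choices d n el s \<Longrightarrow> length l \<le> of_bool el * n + 1"
  by (erule left_choices_cases) (auto simp: bsign_def)

text \<open>The rate at which the longest words in the expansion of a normal word grow with \<open>n\<close>.\<close>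

definition degree :: "word \<Rightarrow> nat" where
  "degree v = links (strip_b v) + of_bool (bletter (hd v)) + of_bool (bletter (last v))"

lemma degree_inv: "v \<noteq> [] \<Longrightarrow> degree (word_inv v) = degree v"
  by (simp add: degree_def strip_b_word_inv links_word_inv hd_word_inv last_word_inv)

lemma hd_b_end: "\<not> bletter (hd c) \<Longrightarrow> c \<noteq> [] \<Longrightarrow> bletter (hd (b_end e s @ c @ y)) = e"
  by (auto simp: b_end_def hd_append hd_bpow)

lemma degree_with_ends:
  assumes "core d c"
  shows "degree (with_ends el c er) = links (strip_b c) + of_bool el + of_bool er"
proof -
  have c: "c \<noteq> []" "\<not> bletter (hd c)" "\<not> bletter (last c)" using assms by (auto simp: core_def)
  have nl: "strip_b (b_end e s) = []" for e s by (simp add: b_end_def)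
  have "bletter (hd (with_ends el c er)) = el" using hd_b_end[OF c(2,1)] by (simp add: with_ends_def)
  moreover have "bletter (hd (with_ends er (word_inv c) el)) = er"
    using hd_b_end[of "word_inv c"] c by (simp add: with_ends_def hd_word_inv)
  then have "bletter (last (with_ends el c er)) = er"
    using c(1) with_ends_not_Nil[OF c(1), of el er] hd_word_inv[of "with_ends el c er"] by (simp add: word_inv_with_ends)
  moreover have "strip_b (with_ends el c er) = strip_b c" by (simp add: with_ends_def nl strip_b_word_inv)
  ultimately show ?thesis by (simp add: degree_def)
qed

lemma left_choice_normal:
  assumes d: "d \<ge> 2" and c: "core d c" and l: "l \<in> left_choices d n el (hd c)"
  shows "\<exists>el' c1. core d c1 \<and> last c1 = last c \<and> l @ c = b_end el' (hd c1) @ c1"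
  using l
proof (cases rule: left_choices_cases)
  case none
  then show ?thesis using c by (auto simp: b_end_def intro!: exI[of _ False])
next
  case b
  then show ?thesis using c by (auto simp: b_end_def intro!: exI[of _ True])
next
  case (letter t i)
  obtain s x where cs: "c = s # x" "\<not> bletter s" using c by (cases c) (auto simp: core_def)
  have "t \<noteq> letter_inv s" using letter(4) cs(1) by (cases s) (auto simp: stretched_def)
  then have "s \<noteq> letter_inv t" by auto
  then have "reduced (t # bpow (bsign (hd c) * i) @ c)"
  proof -
    have "reduced (s # x)" using c by (simp add: core_def carrier_iff cs)
    then show ?thesis
      using letter(3) cs(2) \<open>s \<noteq> letter_inv t\<close>
      reduced_Cons_bpow[of t "bsign (hd c) * i" "s # x"] reduced_bpow_Cons[of s _ x] reduced_Cons[of t "s # x"]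
      unfolding cs(1) by (cases "bsign (hd (s # x)) * i = 0") simp_all
  qed
  then have "core d (t # bpow (bsign (hd c) * i) @ c)"
    using core_extend_left[OF c letter(3) _ d] by blast
  then show ?thesis using letter(2) cs
    by (intro exI[of _ False] exI[of _ "t # bpow (bsign (hd c) * i) @ c"]) (simp add: b_end_def)
qed

text \<open>A choice is either the admissible end letter or makes the core longer; a stretched link never joins a
  letter to its inverse, hence the longer core is reduced.\<close>

lemma choices_normal:
  assumes d: "d \<ge> 2" and c: "core d c"
    and l: "l \<in> left_choices d n el (hd c)" and r: "r \<in> right_choices d n er (last c)"
  shows "l @ c @ r \<in> normal_words d"
proof -
  obtain el' c1 where c1: "core d c1" "last c1 = last c" "l @ c = b_end el' (hd c1) @ c1"
    using left_choice_normal[OF d c l] by blast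
  have c1': "c1 \<noteq> []" using c1 by (simp add: core_def)
  have "word_inv r \<in> left_choices d n er (hd (word_inv c1))"
    using r c1(2) c1' by (auto simp: right_choices_def hd_word_inv)
  then obtain er' c2 where c2: "core d c2" "last c2 = last (word_inv c1)"
      "word_inv r @ word_inv c1 = b_end er' (hd c2) @ c2"
    using left_choice_normal[OF d, of "word_inv c1"] c1(1) core_inv by blast
  have "c1 @ r = word_inv c2 @ word_inv (b_end er' (hd c2))"
    using arg_cong[OF c2(3), of word_inv] by (simp add: word_inv_append)
  moreover have "hd (word_inv c2) = hd c1" "letter_inv (last (word_inv c2)) = hd c2"
    using c2(1,2) c1' by (simp_all add: hd_word_inv last_word_inv core_def)
  moreover have "l @ c @ r = b_end el' (hd c1) @ c1 @ r" using c1(3) by (metis append_assoc)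
  ultimately have "l @ c @ r = with_ends el' (word_inv c2) er'" by (simp add: with_ends_def)
  then show ?thesis using c2(1) core_inv by (auto simp: normal_words_def)
qed

section \<open>Recovering a normal word from its expansion\<close>

lemma choice_head_links:
  assumes l: "l \<in> left_choices d n el s" and X: "X \<noteq> []" "hd X = s" "\<not> bletter s"
    and hd: "\<not> bletter (hd (l @ X))"
  shows "links (strip_b (l @ X)) = of_bool el + links (strip_b X)"
proof -
  obtain x where x: "X = s # x" using X by (cases X) auto
  from l show ?thesis
  proof (cases rule: left_choices_cases)
    case b
    then show ?thesis using hd X by (simp add: hd_append hd_bpow)
  next
    case (letter t i)
    then show ?thesis using X by (simp add: x)
  qed simp
qed

lemma choice_decode:
  assumes l: "l \<in> left_choices d n el s" "l' \<in> left_choices d n el s'"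
    and X: "X \<noteq> []" "\<not> bletter (hd X)" "X' \<noteq> []" "\<not> bletter (hd X')"
    and hd: "\<not> bletter (hd (l @ X))" and eq: "l @ X = l' @ X'"
  shows "l = l' \<and> X = X'"
proof (cases el)
  case False
  then show ?thesis using l eq by (simp add: left_choices_def)
next
  case True
  have nb: "l \<noteq> bpow (bsign u)" for u using hd by (auto simp: hd_append hd_bpow)
  have nb': "l' \<noteq> bpow (bsign u)" for u using hd unfolding eq by (auto simp: hd_append hd_bpow)
  obtain t j where lt: "l = t # bpow j" using l(1)
  proof (cases rule: left_choices_cases)
    case b
    then show ?thesis using nb[of s] by simp
  qed (use True that in auto)
  obtain t' j' where lt': "l' = t' # bpow j'" using l(2)
  proof (cases rule: left_choices_cases)
    case b
    then show ?thesis using nb'[of s'] by simp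
  qed (use True that in auto)
  have "bpow j @ hd X # tl X = bpow j' @ hd X' # tl X'" using eq X by (simp add: lt lt')
  from bpow_append_decode[OF X(2,4) this] have "j = j'" "X = X'" using X by (auto intro: list.expand)
  then show ?thesis using eq by (simp add: lt lt')
qed

lemma core_single: "core d c \<Longrightarrow> length (strip_b c) = 1 \<Longrightarrow> c = [hd c]"
proof -
  assume c: "core d c" "length (strip_b c) = 1"
  obtain s x where cs: "c = s # x" "\<not> bletter s" using c by (cases c) (auto simp: core_def)
  have "x = []"
  proof (rule ccontr)
    assume "x \<noteq> []"
    then have "last x \<in> set (strip_b x)" using c(1) cs by (simp add: core_def)
    then show False using c(2) cs by (cases "strip_b x") auto
  qed
  then show ?thesis using cs by simp
qed

text \<open>The left-hand word was obtained from a core without an end letter, the right-hand one with the far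
  choice on the left. Then the first link of the shifted core of \<open>c\<close> has the exponent of the far
  choice, so \<open>c\<close> has a link of exponent \<open>\<plusminus>M\<close> and is too long, unless \<open>c\<close> has a single letter and the
  link belongs to the choice on the right.\<close>

lemma missing_left_end:
  assumes c: "core d c" "core d c0" and M: "length c < M"
    and t0: "\<not> bletter t0" "stretched t0 (hd c0)"
    and r: "r \<in> right_choices d n er (last c)"
    and eq: "core_shift (- int n) c @ r = t0 # bpow (bsign (hd c0) * (int M - int n)) @ core_shift (- int n) c0 @ r0"
  shows "c = [t0] \<and> er \<and> c0 = [hd c0] \<and> strip_b r0 = []"
proof -
  obtain s x where cs: "c = s # x" "\<not> bletter s" using c by (cases c) (auto simp: core_def)
  obtain s0 x0 where cs0: "c0 = s0 # x0" "\<not> bletter s0" using c by (cases c0) (auto simp: core_def)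
  let ?y0 = "tw (- int n) (is_a (last c0)) (- int n * is_a s0) x0"
  have "s # (tw (- int n) (is_a (last c)) (- int n * is_a s) x @ r)
      = t0 # (bpow (bsign s0 * (int M - int n)) @ s0 # ?y0 @ r0)"
    using eq unfolding cs(1) cs0(1) core_shift_Cons[OF cs(2)] core_shift_Cons[OF cs0(2)]
    unfolding append_Cons list.sel .
  then have s: "s = t0" and eq2: "tw (- int n) (is_a (last c)) (- int n * is_a s) x @ r
      = bpow (bsign s0 * (int M - int n)) @ s0 # ?y0 @ r0" unfolding list.inject by blast+
  have x: "x = []"
  proof (rule ccontr)
    assume ne: "x \<noteq> []"
    have rx: "reduced x" and lx: "\<not> bletter (last x)"
      using c(1) ne by (auto simp: core_def cs carrier_iff reduced_Cons)
    from rx show False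
    proof (cases rule: word_cases)
      case (power k)
      then show False using ne lx by (simp add: last_bpow)
    next
      case (letter k s1 y)
      have "bpow (- int n * is_a s + k - (- int n) * is_a_inv s1) @ s1 #
            (tw (- int n) (is_a (last c)) (- int n * is_a s1) y @ r)
          = bpow (bsign s0 * (int M - int n)) @ s0 # (?y0 @ r0)"
        using eq2 letter by simp
      note dd = bpow_append_decode[OF letter(2) cs0(2) this]
      have "s1 = s0" using dd by blast
      with conjunct1[OF dd] have "- int n * is_a s + k - (- int n) * is_a_inv s0 = bsign s0 * (int M - int n)" by simp
      moreover have "- int n * is_a s + k - (- int n) * is_a_inv s0 = k - int n * (is_a s - is_a_inv s0)"
        by (simp add: algebra_simps)
      moreover have "is_a s - is_a_inv s0 = bsign s0" using stretched_eq[of s s0] t0(2) s cs0(1) by simp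
      ultimately have "k = bsign s0 * int M" by (simp add: algebra_simps)
      then have "\<bar>k\<bar> = int M" by (simp add: bsign_def)
      moreover have "nat \<bar>k\<bar> \<le> length x" using letter(1) by simp
      ultimately show False using M cs by simp
    qed
  qed
  have r': "r = bpow (bsign s0 * (int M - int n)) @ s0 # ?y0 @ r0"
    using eq2 cs by (simp add: x)
  obtain l where l: "l \<in> left_choices d n er (letter_inv (last c))" "r = word_inv l"
    using r by (auto simp: right_choices_def)
  have nr: "strip_b r = s0 # strip_b x0 @ strip_b r0" using cs0(2) by (simp add: r')
  from l(1) have "er \<and> length (strip_b r) = 1"
  proof (cases rule: left_choices_cases)
    case (letter t i)
    then show ?thesis using l(2) by (simp add: strip_b_word_inv)
  qed (use l(2) nr in \<open>auto simp: strip_b_word_inv\<close>)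
  then have "er" "strip_b x0 = []" "strip_b r0 = []" using nr by auto
  then show ?thesis using core_single[OF c(2)] cs cs0 s x by simp
qed

definition far_letter :: "letter \<Rightarrow> letter" where
  "far_letter s = (if s = (1, False) then (1, False) else (1, True))"

lemma far_letter: "stretched (far_letter s) s" "\<not> bletter (far_letter s)"
  by (auto simp: far_letter_def stretched_def)

text \<open>A choice in place of an end letter that belongs, in the image under \<open>T\<^sup>n\<close>, to a link of exponent
  \<open>\<plusminus>M\<close>. Such a link is too long for any word of length less than \<open>M\<close>, so that only an end letter can
  account for it.\<close>

definition far_choice :: "nat \<Rightarrow> nat \<Rightarrow> bool \<Rightarrow> letter \<Rightarrow> word" where
  "far_choice M n el s = (if el then far_letter s # bpow (bsign s * (int M - int n)) else [])"

lemma far_choice_left: "d \<ge> 2 \<Longrightarrow> 1 \<le> M \<Longrightarrow> M \<le> n \<Longrightarrow> far_choice M n el s \<in> left_choices d n el s"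
  using far_letter[of s] unfolding far_choice_def left_choices_def
  by (auto simp: far_letter_def letters_def image_iff intro!: bexI[of _ "int M - int n"])

lemma hd_far_choice: "\<not> bletter (hd X) \<Longrightarrow> \<not> bletter (hd (far_choice M n el s @ X))"
  using far_letter[of s] by (simp add: far_choice_def)

lemma strip_b_far_choice: "strip_b (far_choice M n el s) = [] \<longleftrightarrow> \<not> el"
  using far_letter[of s] by (simp add: far_choice_def)

text \<open>The stretched links of the common word are those of \<open>c\<close> together with one for each end letter, so the
  degrees agree. By \<open>missing_left_end\<close> and its mirror image an end letter on the right-hand side of
  the equation forces one on the left-hand side; the exceptional case is the cancellation between \<open>ab\<close> and \<open>bs\<close>, or
  between their inverses, which the hypotheses on \<open>ab\<close> exclude. Since the right-hand side has the
  greatest number of end letters, both sides have the same ends, and the parts can be read off.\<close>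

lemma expansion_unique:
  assumes d: "d \<ge> 2" and c: "core d c" "core d c0" and M: "length c < M" "1 \<le> M" "M \<le> n"
    and l: "l \<in> left_choices d n el (hd c)" and r: "r \<in> right_choices d n er (last c)"
    and l0: "l0 = far_choice M n el0 (hd c0)" and r0: "r0 = word_inv (far_choice M n er0 (letter_inv (last c0)))"
    and eq: "l @ core_shift (- int n) c @ r = l0 @ core_shift (- int n) c0 @ r0"
    and notab: "with_ends el c er \<noteq> [(1, True), (2, True)]" "with_ends el c er \<noteq> [(2, False), (1, False)]"
      "with_ends el0 c0 er0 \<noteq> [(1, True), (2, True)]" "with_ends el0 c0 er0 \<noteq> [(2, False), (1, False)]"
    and ends: "degree (with_ends el c er) = degree (with_ends el0 c0 er0) \<Longrightarrow>
      of_bool el + of_bool er \<le> (of_bool el0 + of_bool er0 :: nat)"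
  shows "el = el0 \<and> c = c0 \<and> er = er0 \<and> l = l0 \<and> r = r0"
proof -
  let ?c = "core_shift (- int n) c" and ?e = "core_shift (- int n) c0"
  let ?ci = "word_inv c" and ?ei = "word_inv c0"
  have ne: "c \<noteq> []" "c0 \<noteq> []" "?c \<noteq> []" "?e \<noteq> []" and nb: "\<not> bletter (hd c)" "\<not> bletter (hd c0)"
      "\<not> bletter (last c)" "\<not> bletter (last c0)"
    using c core_shift_core[OF d] by (auto simp: core_def)
  have hds: "hd ?c = hd c" "hd ?e = hd c0" "last ?c = last c" "last ?e = last c0"
    using hd_core_shift[OF c(1)] hd_core_shift[OF c(2)] last_core_shift[OF c(1)] last_core_shift[OF c(2)] by simp_all
  have ri: "word_inv r \<in> left_choices d n er (letter_inv (last c))" using r by (auto simp: right_choices_def)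
  have ri0: "word_inv r0 = far_choice M n er0 (letter_inv (last c0))" by (simp add: r0)
  have eqi: "word_inv r @ word_inv ?c @ word_inv l = word_inv r0 @ word_inv ?e @ word_inv l0"
    using arg_cong[OF eq, of word_inv] by (simp add: word_inv_append)
  have ics: "word_inv ?c = core_shift (- int n) ?ci" "word_inv ?e = core_shift (- int n) ?ei"
    using core_shift_inv[OF c(1)] core_shift_inv[OF c(2)] by simp_all
  have A: "el" if "el0"
  proof (rule ccontr)
    assume "\<not> el"
    then have "?c @ r = far_letter (hd c0) # bpow (bsign (hd c0) * (int M - int n)) @ ?e @ r0"
      using eq l l0 that by (simp add: left_choices_def far_choice_def)
    from missing_left_end[OF c M(1) far_letter(2,1) r this]
    have *: "c = [far_letter (hd c0)]" "er" "c0 = [hd c0]" "strip_b r0 = []" by auto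
    then have "\<not> er0" using strip_b_far_choice[of M n er0] by (simp add: r0 strip_b_word_inv)
    show False
    proof (cases "hd c0 = (1, False)")
      case True
      then have "c0 = [(1, False)]" using *(3) by simp
      then show False using notab(4) that \<open>\<not> er0\<close> by (simp add: with_ends_def b_end_def bsign_def)
    next
      case False
      then have "c = [(1, True)]" using *(1) by (simp add: far_letter_def)
      then show False using notab(1) *(2) \<open>\<not> el\<close> by (simp add: with_ends_def b_end_def bsign_def word_inv_Cons)
    qed
  qed
  have B: "er" if "er0"
  proof (rule ccontr)
    assume "\<not> er"
    then have "r = []" using ri by (simp add: left_choices_def)
    then have e: "core_shift (- int n) ?ci @ word_inv l = far_letter (hd ?ei) #
        bpow (bsign (hd ?ei) * (int M - int n)) @ core_shift (- int n) ?ei @ word_inv l0"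
      using eqi that ne by (simp add: ics ri0 far_choice_def hd_word_inv)
    have rl: "word_inv l \<in> right_choices d n el (last ?ci)"
      using l ne by (simp add: right_choices_def last_word_inv)
    have "length ?ci < M" using M by simp
    from missing_left_end[OF _ _ this far_letter(2,1) rl e]
    have *: "?ci = [far_letter (hd ?ei)]" "el" "?ei = [hd ?ei]" "strip_b (word_inv l0) = []"
      using c core_inv by auto
    then have "\<not> el0" using strip_b_far_choice[of M n el0] by (simp add: l0 strip_b_word_inv)
    have c1: "c = [letter_inv (far_letter (hd ?ei))]"
      using arg_cong[OF *(1), of word_inv] by (simp add: word_inv_Cons)
    show False
    proof (cases "hd ?ei = (1, False)")
      case True
      then have "word_inv ?ei = word_inv [(1, False)]" using *(3) by metis
      then have "c0 = [(1, True)]" by (simp add: word_inv_Cons)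
      then show False using notab(3) that \<open>\<not> el0\<close> by (simp add: with_ends_def b_end_def bsign_def word_inv_Cons)
    next
      case False
      then have "c = [(1, False)]" using c1 by (simp add: far_letter_def)
      then show False using notab(2) *(2) \<open>\<not> er\<close> by (simp add: with_ends_def b_end_def bsign_def)
    qed
  qed
  have hdl: "\<not> bletter (hd (l @ ?c @ r))"
    unfolding eq l0 by (rule hd_far_choice) (use ne nb hds in simp)
  have hdr: "\<not> bletter (hd (word_inv r @ word_inv ?c))"
  proof -
    have "\<not> bletter (hd (word_inv r @ word_inv ?c @ word_inv l))"
      unfolding eqi ri0 by (rule hd_far_choice) (use ne nb hds in \<open>simp add: hd_word_inv\<close>)
    then show ?thesis using ne by (cases "word_inv r") auto
  qed
  have deg: "links (strip_b (l @ k @ r)) = of_bool el + of_bool er + links (strip_b k)"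
    if k: "k \<noteq> []" "hd k = hd c'" "last k = last c'" "\<not> bletter (hd c')" "\<not> bletter (last c')"
      and l: "l \<in> left_choices d n el (hd c')" and r: "word_inv r \<in> left_choices d n er (letter_inv (last c'))"
      and h: "\<not> bletter (hd (l @ k @ r))" "\<not> bletter (hd (word_inv r @ word_inv k))" for l k r el er c'
  proof -
    have "links (strip_b (word_inv r @ word_inv k)) = of_bool er + links (strip_b (word_inv k))"
      by (rule choice_head_links[OF r _ _ _ h(2)]) (use k in \<open>simp_all add: hd_word_inv\<close>)
    then have "links (strip_b (word_inv (k @ r))) = of_bool er + links (strip_b (word_inv k))"
      by (simp add: word_inv_append)
    then have "links (strip_b (k @ r)) = of_bool er + links (strip_b k)"
      by (simp only: strip_b_word_inv links_word_inv)
    moreover have "links (strip_b (l @ k @ r)) = of_bool el + links (strip_b (k @ r))"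
      by (rule choice_head_links[OF l _ _ _ h(1)]) (use k in simp_all)
    ultimately show ?thesis by simp
  qed
  have "links (strip_b (l @ ?c @ r)) = of_bool el + of_bool er + links (strip_b ?c)"
    by (rule deg[where c' = c]) (use ne hds nb l ri hdl hdr in auto)
  moreover have "links (strip_b (l0 @ ?e @ r0)) = of_bool el0 + of_bool er0 + links (strip_b ?e)"
  proof (rule deg[where c' = c0])
    show "l0 \<in> left_choices d n el0 (hd c0)" unfolding l0 by (rule far_choice_left[OF d M(2,3)])
    show "word_inv r0 \<in> left_choices d n er0 (letter_inv (last c0))" unfolding ri0 by (rule far_choice_left[OF d M(2,3)])
    show "\<not> bletter (hd (l0 @ ?e @ r0))" using hdl eq by simp
    show "\<not> bletter (hd (word_inv r0 @ word_inv ?e))"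
      unfolding ri0 by (rule hd_far_choice) (use ne nb hds in \<open>simp add: hd_word_inv\<close>)
  qed (use ne hds nb in auto)
  ultimately have "degree (with_ends el c er) = degree (with_ends el0 c0 er0)"
    using eq by (simp add: degree_with_ends[OF c(1)] degree_with_ends[OF c(2)])
  then have "of_bool el + of_bool er \<le> (of_bool el0 + of_bool er0 :: nat)" by (rule ends)
  then have E: "el = el0" "er = er0" using A B by (cases el; cases er; cases el0; cases er0; simp)+
  have l0': "l0 \<in> left_choices d n el (hd c0)" unfolding l0 E by (rule far_choice_left[OF d M(2,3)])
  have r0': "word_inv r0 \<in> left_choices d n er (letter_inv (last c0))" unfolding ri0 E by (rule far_choice_left[OF d M(2,3)])
  have L: "l = l0 \<and> ?c @ r = ?e @ r0"
    by (rule choice_decode[OF l l0' _ _ _ _ hdl eq]) (use ne nb hds in simp_all)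
  have "word_inv r @ word_inv ?c = word_inv r0 @ word_inv ?e"
    using arg_cong[OF conjunct2[OF L], of word_inv] by (simp only: word_inv_append)
  then have R: "word_inv r = word_inv r0 \<and> word_inv ?c = word_inv ?e"
    by (intro choice_decode[OF ri r0' _ _ _ _ hdr]) (use ne nb hds in \<open>simp_all add: hd_word_inv\<close>)
  then have "?c = ?e" "r = r0" by (metis word_inv_inv)+
  moreover have "c = c0" using core_shift_inverse'[OF c(1), of "int n"] core_shift_inverse'[OF c(2), of "int n"] \<open>?c = ?e\<close> by metis
  ultimately show ?thesis using E L by simp
qed

section \<open>Growth of the norm under the twist\<close>

text \<open>The norm of \<open>f \<circ> T\<^sup>n\<close> is \<open>K n\<close> up to a constant.\<close>

definition grows :: "nat \<Rightarrow> (word \<Rightarrow> real) \<Rightarrow> nat \<Rightarrow> bool" where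
  "grows d f K \<longleftrightarrow> (\<exists>C. \<forall>n. norm_le d (\<lambda>w. f (tw (int n) 0 0 w)) (K * n + C)
      \<and> (\<forall>L. norm_le d (\<lambda>w. f (tw (int n) 0 0 w)) L \<longrightarrow> K * n \<le> L + C))"

lemma norm_le_mono: "norm_le d f L \<Longrightarrow> L \<le> M \<Longrightarrow> norm_le d f M"
  unfolding norm_le_def by (erule in_span_mono) auto

lemma norm_le_equiv: "norm_le d f L \<Longrightarrow> equivalent d g f \<Longrightarrow> norm_le d g L"
  unfolding norm_le_def by (rule in_span_equiv)

lemma norm_le_add: "norm_le d f L \<Longrightarrow> norm_le d g L \<Longrightarrow> norm_le d (\<lambda>w. f w + g w) L"
  unfolding norm_le_def by (rule in_span_add)

lemma norm_le_minus: "norm_le d f L \<Longrightarrow> norm_le d g L \<Longrightarrow> norm_le d (\<lambda>w. f w - g w) L"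
  unfolding norm_le_def by (rule in_span_minus)

lemma norm_le_scale: "norm_le d f L \<Longrightarrow> norm_le d (\<lambda>w. r * f w) L"
  unfolding norm_le_def by (rule in_span_scale)

lemma equivalent_tw: "d \<ge> 2 \<Longrightarrow> equivalent d f g \<Longrightarrow>
    equivalent d (\<lambda>w. f (tw n 0 0 w)) (\<lambda>w. g (tw n 0 0 w))"
  by (erule equivalent_comp) (rule tw_carrier)

text \<open>Used for the two summands whose norms stay bounded under the twist, \<open>rot\<close> and the exponent sum of
  \<open>b\<close>.\<close>

lemma grows_add_bounded:
  assumes d: "d \<ge> 2" and f: "grows d f K" and g: "\<And>n. norm_le d (\<lambda>w. g (tw (int n) 0 0 w)) B"
    and h: "equivalent d h (\<lambda>w. f w + g w)"
  shows "grows d h K"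
proof -
  obtain C where C: "\<And>n. norm_le d (\<lambda>w. f (tw (int n) 0 0 w)) (K * n + C)"
    "\<And>n L. norm_le d (\<lambda>w. f (tw (int n) 0 0 w)) L \<Longrightarrow> K * n \<le> L + C"
    using f by (auto simp: grows_def)
  have h': "equivalent d (\<lambda>w. h (tw (int n) 0 0 w)) (\<lambda>w. f (tw (int n) 0 0 w) + g (tw (int n) 0 0 w))" for n
    by (rule equivalent_tw[OF d h])
  show ?thesis unfolding grows_def
  proof (intro exI[of _ "C + B"] allI conjI impI)
    fix n
    show "norm_le d (\<lambda>w. h (tw (int n) 0 0 w)) (K * n + (C + B))"
      by (rule norm_le_equiv[OF norm_le_add h']) (rule norm_le_mono[OF C(1)], simp, rule norm_le_mono[OF g], simp)
  next
    fix n L assume L: "norm_le d (\<lambda>w. h (tw (int n) 0 0 w)) L"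
    have "norm_le d (\<lambda>w. h (tw (int n) 0 0 w) - g (tw (int n) 0 0 w)) (L + B)"
      by (rule norm_le_minus) (rule norm_le_mono[OF L], simp, rule norm_le_mono[OF g], simp)
    moreover have "equivalent d (\<lambda>w. f (tw (int n) 0 0 w)) (\<lambda>w. h (tw (int n) 0 0 w) - g (tw (int n) 0 0 w))"
      using equivalent_sym[OF h'[of n]] by (auto simp: equivalent_def algebra_simps)
    ultimately have "norm_le d (\<lambda>w. f (tw (int n) 0 0 w)) (L + B)" by (rule norm_le_equiv)
    then show "K * n \<le> L + (C + B)" using C(2) by fastforce
  qed
qed

text \<open>A normal word given by its core and the presence of its two end letters.\<close>

type_synonym pattern = "bool \<times> word \<times> bool"

definition pattern_word :: "pattern \<Rightarrow> word" where
  "pattern_word p = (case p of (el, c, er) \<Rightarrow> with_ends el c er)"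

definition expansions :: "nat \<Rightarrow> nat \<Rightarrow> pattern \<Rightarrow> (word \<times> word) set" where
  "expansions d n p = (case p of (el, c, er) \<Rightarrow> left_choices d n el (hd c) \<times> right_choices d n er (last c))"

lemma finite_expansions: "finite (expansions d n p)"
  by (simp add: expansions_def case_prod_unfold)

definition ends :: "pattern \<Rightarrow> nat" where
  "ends p = (case p of (el, c, er) \<Rightarrow> of_bool el + of_bool er)"

lemma pattern_sum_twist:
  assumes d: "d \<ge> 2" and c: "\<And>p. p \<in> J \<Longrightarrow> core d (fst (snd p))" and J: "finite J"
  shows "equivalent d (\<lambda>w. \<Sum>p\<in>J. \<alpha> p * occ (pattern_word p) (tw (int n) 0 0 w))
    (\<lambda>w. \<Sum>i\<in>(SIGMA p:J. expansions d n p).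
      \<alpha> (fst i) * occ (fst (snd i) @ core_shift (- int n) (fst (snd (fst i))) @ snd (snd i)) w)"
proof -
  let ?z = "\<lambda>p lr. fst lr @ core_shift (- int n) (fst (snd p)) @ snd lr"
  have "equivalent d (\<lambda>w. \<Sum>p\<in>J. \<alpha> p * occ (pattern_word p) (tw (int n) 0 0 w))
      (\<lambda>w. \<Sum>p\<in>J. \<alpha> p * (\<Sum>lr\<in>expansions d n p. occ (?z p lr) w))"
  proof (rule equivalent_sum[OF equivalent_scale])
    fix p assume p: "p \<in> J"
    obtain el c er where p_eq: "p = (el, c, er)" by (cases p)
    show "equivalent d (\<lambda>w. occ (pattern_word p) (tw (int n) 0 0 w)) (\<lambda>w. \<Sum>lr\<in>expansions d n p. occ (?z p lr) w)"
      using occ_with_ends_twist[OF d, of c el er n] assms(2)[OF p]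
      by (simp add: p_eq pattern_word_def expansions_def sum.cartesian_product case_prod_unfold)
  qed
  moreover have "(\<Sum>p\<in>J. \<alpha> p * (\<Sum>lr\<in>expansions d n p. occ (?z p lr) w))
      = (\<Sum>i\<in>(SIGMA p:J. expansions d n p). \<alpha> (fst i) * occ (?z (fst i) (snd i)) w)" for w
    using sum.Sigma[of J "expansions d n" "\<lambda>p lr. \<alpha> p * occ (?z p lr) w"] J
    by (simp add: finite_expansions sum_distrib_left case_prod_unfold)
  ultimately show ?thesis by simp
qed

lemma length_expansion:
  assumes "core d c" "l \<in> left_choices d n el (hd c)" "r \<in> right_choices d n er (last c)"
  shows "length (l @ core_shift (- int n) c @ r) \<le> degree (with_ends el c er) * n + (length c + 2)"
proof -
  have "length r \<le> of_bool er * n + 1"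
  proof -
    obtain x where "x \<in> left_choices d n er (letter_inv (last c))" "r = word_inv x"
      using assms(3) by (auto simp: right_choices_def)
    then show ?thesis using length_left_choices by simp
  qed
  moreover have "length (core_shift (- int n) c) \<le> length c + n * links (strip_b c)"
    using length_core_shift(1)[OF assms(1), of "- int n"] by simp
  ultimately show ?thesis
    using length_left_choices[OF assms(2)] by (simp add: degree_with_ends[OF assms(1)] algebra_simps)
qed

lemma length_far_expansion:
  assumes "core d c" "M \<le> n"
  shows "degree (with_ends el c er) * n \<le> length (far_choice M n el (hd c) @ core_shift (- int n) c
    @ word_inv (far_choice M n er (letter_inv (last c)))) + (length c + 2 * M)"
proof -
  have f: "of_bool e * n \<le> length (far_choice M n e s) + M" for e s
    using assms(2) by (auto simp: far_choice_def bsign_def)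
  have "n * links (strip_b c) \<le> length (core_shift (- int n) c) + length c"
    using length_core_shift(2)[OF assms(1), of "- int n"] by simp
  then show ?thesis
    using f[of el "hd c"] f[of er "letter_inv (last c)"] by (simp add: degree_with_ends[OF assms(1)] algebra_simps)
qed

text \<open>Expand every term with \<open>occ_with_ends_twist\<close>. Counting stretched links bounds all lengths from
  above. For the lower bound take the far choices for a word of maximal degree and, among these, with
  the greatest number of end letters: by \<open>expansion_unique\<close> the resulting long word has a
  non-zero coefficient, and \<open>norm_lower_bound\<close> applies.\<close>

lemma grows_patterns:
  assumes d: "d \<ge> 2" and J: "finite J" and c: "\<And>p. p \<in> J \<Longrightarrow> core d (fst (snd p))"
    and nz: "\<And>p. p \<in> J \<Longrightarrow> \<alpha> p \<noteq> 0"
    and notab: "\<And>p. p \<in> J \<Longrightarrow> pattern_word p \<noteq> [(1, True), (2, True)] \<and> pattern_word p \<noteq> [(2, False), (1, False)]"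
  shows "grows d (\<lambda>w. \<Sum>p\<in>J. \<alpha> p * occ (pattern_word p) w) (Max (insert 0 ((degree \<circ> pattern_word) ` J)))"
proof -
  define K where "K = Max (insert 0 ((degree \<circ> pattern_word) ` J))"
  define S where "S = (\<Sum>p\<in>J. length (fst (snd p)))"
  let ?I = "\<lambda>n. SIGMA p:J. expansions d n p"
  let ?z = "\<lambda>n i. fst (snd i) @ core_shift (- int n) (fst (snd (fst i))) @ snd (snd i)"
  let ?f = "\<lambda>n w. \<Sum>p\<in>J. \<alpha> p * occ (pattern_word p) (tw (int n) 0 0 w)"
  have S: "length (fst (snd p)) \<le> S" if "p \<in> J" for p
    unfolding S_def using that J member_le_sum[of p J "\<lambda>p. length (fst (snd p))"] by simp
  have K: "degree (pattern_word p) \<le> K" if "p \<in> J" for p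
    unfolding K_def using that J by (intro Max_ge) auto
  have eq: "equivalent d (?f n) (\<lambda>w. \<Sum>i\<in>?I n. \<alpha> (fst i) * occ (?z n i) w)" for n
    by (rule pattern_sum_twist[OF d c J])
  have finI: "finite (?I n)" for n using J by (auto simp: expansions_def)
  have zn: "?z n i \<in> normal_words d \<and> length (?z n i) \<le> K * n + (S + 2)" if i: "i \<in> ?I n" for i n
  proof -
    obtain el k er l r where ie: "i = ((el, k, er), l, r)" by (metis prod.collapse)
    have p: "(el, k, er) \<in> J" and lr: "l \<in> left_choices d n el (hd k)" "r \<in> right_choices d n er (last k)"
      using i by (auto simp: ie expansions_def)
    have k: "core d k" using c[OF p] by simp
    have "length (l @ core_shift (- int n) k @ r) \<le> degree (with_ends el k er) * n + (length k + 2)"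
      by (rule length_expansion[OF k lr])
    moreover have "degree (with_ends el k er) * n \<le> K * n" using K[OF p] by (simp add: pattern_word_def)
    moreover have "length k \<le> S" using S[OF p] by simp
    moreover have "l @ core_shift (- int n) k @ r \<in> normal_words d"
      by (rule choices_normal[OF d core_shift_core[OF d k]]) (use lr hd_core_shift[OF k] last_core_shift[OF k] in simp_all)
    ultimately show ?thesis unfolding ie fst_conv snd_conv by linarith
  qed
  have up: "norm_le d (?f n) (K * n + (S + 2))" for n
    unfolding norm_le_def
    by (rule in_span_equiv[OF _ eq], intro in_span_sum in_span_scale in_span_occ)
      (use zn normal_words_nontriv[OF d] in blast)
  \<comment> \<open>An exponent that exceeds the length of every core in the sum.\<close>
  define M where "M = Suc S"
  define D where "D = K * M + (S + 2 * M) + 3"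
  have low: "K * n \<le> L + D" if L: "norm_le d (?f n) L" for n L
  proof (cases "K = 0 \<or> n < M")
    case True
    then have "K * n \<le> K * M" by auto
    then show ?thesis unfolding D_def by linarith
  next
    case False
    have "K \<in> insert 0 ((degree \<circ> pattern_word) ` J)" unfolding K_def by (rule Max_in) (use J in auto)
    then have "K \<in> (degree \<circ> pattern_word) ` J" using False by blast
    then obtain q where "q \<in> J" "K = (degree \<circ> pattern_word) q" by (rule imageE)
    then have q: "q \<in> J \<and> degree (pattern_word q) = K" by (simp only: o_apply)
    have "ends p < 3" for p by (cases p) (simp add: ends_def of_bool_def)
    then have "\<forall>p. p \<in> J \<and> degree (pattern_word p) = K \<longrightarrow> ends p < 3" by blast
    from ex_has_greatest_nat[of "\<lambda>p. p \<in> J \<and> degree (pattern_word p) = K", OF q this]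
    obtain p0 where pp: "(p0 \<in> J \<and> degree (pattern_word p0) = K)
        \<and> (\<forall>p. p \<in> J \<and> degree (pattern_word p) = K \<longrightarrow> ends p \<le> ends p0)" by (rule exE)
    then have p0: "p0 \<in> J" "degree (pattern_word p0) = K" by (rule conjunct1[THEN conjunct1], rule conjunct1[THEN conjunct2])
    have mx: "ends p \<le> ends p0" if "p \<in> J" "degree (pattern_word p) = K" for p
      by (rule conjunct2[OF pp, rule_format]) (rule conjI[OF that])
    obtain el0 c0 er0 where p0e: "p0 = (el0, c0, er0)" by (cases p0)
    have c0: "core d c0" using c[OF p0(1)] by (simp add: p0e)
    define l0 where "l0 = far_choice M n el0 (hd c0)"
    define r0 where "r0 = word_inv (far_choice M n er0 (letter_inv (last c0)))"
    define y where "y = l0 @ core_shift (- int n) c0 @ r0"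
    have Mn: "1 \<le> M" "M \<le> n" using False by (auto simp: M_def)
    have "{i \<in> ?I n. ?z n i = y} = {(p0, l0, r0)}"
    proof (intro equalityI subsetI)
      fix i assume "i \<in> {i \<in> ?I n. ?z n i = y}"
      then have i: "i \<in> ?I n" "?z n i = y" by auto
      obtain el k er l r where ie: "i = ((el, k, er), l, r)" by (metis prod.collapse)
      have p: "(el, k, er) \<in> J" and lr: "l \<in> left_choices d n el (hd k)" "r \<in> right_choices d n er (last k)"
        using i(1) by (auto simp: ie expansions_def)
      have "el = el0 \<and> k = c0 \<and> er = er0 \<and> l = l0 \<and> r = r0"
      proof (rule expansion_unique[OF d _ c0 _ Mn lr l0_def r0_def])
        show "core d k" using c[OF p] by simp
        show "length k < M" using S[OF p] by (simp add: M_def)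
        show "l @ core_shift (- int n) k @ r = l0 @ core_shift (- int n) c0 @ r0"
          using i(2) by (simp add: ie y_def)
        show "of_bool el + of_bool er \<le> (of_bool el0 + of_bool er0 :: nat)"
          if "degree (with_ends el k er) = degree (with_ends el0 c0 er0)"
          using mx[OF p] p0(2) that by (simp add: pattern_word_def p0e ends_def)
      qed (use notab[OF p] notab[OF p0(1)] in \<open>simp_all add: pattern_word_def p0e\<close>)
      then show "i \<in> {(p0, l0, r0)}" by (simp add: ie p0e)
    next
      fix i assume "i \<in> {(p0, l0, r0)}"
      moreover have "l0 \<in> left_choices d n el0 (hd c0)" unfolding l0_def by (rule far_choice_left[OF d Mn])
      moreover have "r0 \<in> right_choices d n er0 (last c0)"
        unfolding r0_def right_choices_def by (intro imageI far_choice_left[OF d Mn])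
      moreover have "(el0, c0, er0) \<in> J" using p0(1) by (simp add: p0e)
      ultimately show "i \<in> {i \<in> ?I n. ?z n i = y}"
        by (simp add: y_def p0e expansions_def)
    qed
    then have "(\<Sum>i\<in>{i \<in> ?I n. ?z n i = y}. \<alpha> (fst i)) = (\<Sum>i\<in>{(p0, l0, r0)}. \<alpha> (fst i))"
      by (rule arg_cong)
    also have "\<dots> = \<alpha> p0" by simp
    finally have coeff: "(\<Sum>i\<in>{i \<in> ?I n. ?z n i = y}. \<alpha> (fst i)) \<noteq> 0"
      using nz[OF p0(1)] by (rule ssubst)
    have "K * n \<le> length y + (length c0 + 2 * M)"
      using length_far_expansion[OF c0 Mn(2), of el0 er0] p0(2)
      by (simp add: pattern_word_def p0e y_def l0_def r0_def)
    moreover have "length c0 \<le> S" using S[OF p0(1)] by (simp add: p0e)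
    moreover have "length y \<le> L" if "length y \<ge> 3"
    proof (rule norm_lower_bound[OF d finI _ _ coeff that])
      show "norm_le d (\<lambda>w. \<Sum>i\<in>?I n. \<alpha> (fst i) * occ (?z n i) w) L"
        by (rule norm_le_equiv[OF L equivalent_sym[OF eq]])
    qed (use zn in blast)
    ultimately have "K * n \<le> L + (S + 2 * M) + 3"
      by (cases "length y \<ge> 3") linarith+
    then show ?thesis unfolding D_def by linarith
  qed
  show ?thesis unfolding K_def[symmetric] grows_def
  proof (intro exI[of _ "D + (S + 2)"] allI conjI impI)
    fix n
    show "norm_le d (?f n) (K * n + (D + (S + 2)))" by (rule norm_le_mono[OF up]) simp
    fix L assume "norm_le d (?f n) L"
    then show "K * n \<le> L + (D + (S + 2))" using low by fastforce
  qed
qed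

lemma grows_normal_words:
  assumes d: "d \<ge> 2" and V: "finite V" "V \<subseteq> normal_words d"
    and nz: "\<And>v. v \<in> V \<Longrightarrow> \<alpha> v \<noteq> 0"
    and notab: "[(1, True), (2, True)] \<notin> V" "[(2, False), (1, False)] \<notin> V"
  shows "grows d (occ_sum V \<alpha>) (Max (insert 0 (degree ` V)))"
proof -
  have "\<forall>v\<in>V. \<exists>p. core d (fst (snd p)) \<and> pattern_word p = v"
    using V(2) by (fastforce simp: normal_words_def pattern_word_def)
  then obtain P where P: "\<And>v. v \<in> V \<Longrightarrow> core d (fst (snd (P v)))" "\<And>v. v \<in> V \<Longrightarrow> pattern_word (P v) = v"
    by metis
  have inj: "inj_on P V" using P(2) by (metis inj_onI)
  have "grows d (\<lambda>w. \<Sum>p\<in>P ` V. \<alpha> (pattern_word p) * occ (pattern_word p) w) (Max (insert 0 ((degree \<circ> pattern_word) ` P ` V)))"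
    by (rule grows_patterns[OF d]) (use V P nz notab in auto)
  moreover have "(degree \<circ> pattern_word) ` P ` V = degree ` V" using P(2) by (force simp: image_iff)
  moreover have "(\<lambda>w. \<Sum>p\<in>P ` V. \<alpha> (pattern_word p) * occ (pattern_word p) w) = occ_sum V \<alpha>"
    using P(2) by (simp add: occ_sum_def[abs_def] sum.reindex[OF inj] cong: sum.cong)
  ultimately show ?thesis by simp
qed

section \<open>The speed\<close>

text \<open>The inverse in the definition of the action and that in the automorphism cancel.\<close>

lemma act_power:
  assumes d: "d \<ge> 2"
  shows "act d ((inv\<^bsub>AutoGroup (free_group d)\<^esub> (twist d)) [^]\<^bsub>AutoGroup (free_group d)\<^esub> n) (eq_class d f)
    = eq_class d (\<lambda>w. f (tw (int n) 0 0 w))"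
proof -
  interpret A: group "AutoGroup (free_group d)" by (rule group.AutoGroup[OF group_free_group])
  let ?G = "AutoGroup (free_group d)"
  have t: "twist d \<in> carrier ?G" by (rule twist_auto[OF d])
  have "inv\<^bsub>?G\<^esub> ((inv\<^bsub>?G\<^esub> (twist d)) [^]\<^bsub>?G\<^esub> n) = twist d [^]\<^bsub>?G\<^esub> n"
    using t by (simp add: A.nat_pow_inv)
  then have *: "act d ((inv\<^bsub>?G\<^esub> (twist d)) [^]\<^bsub>?G\<^esub> n) (eq_class d f)
      = (\<Union>g\<in>eq_class d f. eq_class d (g \<circ> (twist d [^]\<^bsub>?G\<^esub> n)))"
    by (simp add: act_def)
  have "eq_class d (g \<circ> (twist d [^]\<^bsub>?G\<^esub> n)) = eq_class d (\<lambda>w. f (tw (int n) 0 0 w))"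
    if "g \<in> eq_class d f" for g
  proof -
    have "equivalent d f g" using that by (simp add: eq_class_def)
    then have "equivalent d (\<lambda>w. f (tw (int n) 0 0 w)) (\<lambda>w. g (tw (int n) 0 0 w))"
      by (rule equivalent_tw[OF d])
    then have "equivalent d (\<lambda>w. f (tw (int n) 0 0 w)) (g \<circ> (twist d [^]\<^bsub>?G\<^esub> n))"
      by (rule equivalent_cong) (simp_all add: twist_pow[OF d])
    then show ?thesis unfolding eq_class_def by (blast intro: equivalent_trans equivalent_sym)
  qed
  moreover have "f \<in> eq_class d f" by (simp add: eq_class_def equivalent_refl)
  ultimately show ?thesis unfolding * by blast
qed

lemma class_norm_props:
  assumes "norm_le d f L"
  shows "class_norm d (eq_class d f) \<le> L" "norm_le d f (class_norm d (eq_class d f))"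
proof -
  let ?P = "\<lambda>k. \<exists>I \<alpha>. finite I \<and> I \<subseteq> nontriv d \<and> occ_sum I \<alpha> \<in> eq_class d f \<and> coeff_norm I \<alpha> = k"
  obtain J \<alpha> where J: "finite J" "J \<subseteq> {v \<in> nontriv d. length v \<le> L}" "equivalent d f (occ_sum J \<alpha>)"
    using assms unfolding norm_le_def in_span_def by blast
  have "coeff_norm J \<alpha> \<le> L" unfolding coeff_norm_def using J by (auto simp: supp_def)
  moreover have P: "?P (coeff_norm J \<alpha>)"
    using J by (intro exI[of _ J] exI[of _ \<alpha>]) (auto simp: eq_class_def)
  ultimately show "class_norm d (eq_class d f) \<le> L"
    unfolding class_norm_def using Least_le[of ?P, OF P] by linarith
  have "?P (class_norm d (eq_class d f))" unfolding class_norm_def by (rule LeastI[of ?P]) (rule P)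
  then obtain I \<beta> where I: "finite I" "I \<subseteq> nontriv d" "equivalent d f (occ_sum I \<beta>)"
    "coeff_norm I \<beta> = class_norm d (eq_class d f)" by (auto simp: eq_class_def)
  have "occ_sum I \<beta> = occ_sum (supp I \<beta>) \<beta>"
    unfolding occ_sum_def[abs_def] supp_def using I(1)
    by (auto intro!: ext sum.mono_neutral_right)
  moreover have "length v \<le> coeff_norm I \<beta>" if "v \<in> supp I \<beta>" for v
    unfolding coeff_norm_def using that I(1) by (intro Max_ge) (auto simp: supp_def)
  ultimately show "norm_le d f (class_norm d (eq_class d f))"
    unfolding norm_le_def in_span_def using I
    by (intro exI[of _ "supp I \<beta>"] exI[of _ \<beta>]) (auto simp: supp_def)
qed

lemma grows_speed:
  assumes d: "d \<ge> 2" and g: "grows d f K"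
  defines "Tinv \<equiv> inv\<^bsub>AutoGroup (free_group d)\<^esub> (twist d)"
  shows "speed_exists d Tinv (eq_class d f)" "speed d Tinv (eq_class d f) = real K"
proof -
  obtain C where C: "\<And>n. norm_le d (\<lambda>w. f (tw (int n) 0 0 w)) (K * n + C)"
    "\<And>n L. norm_le d (\<lambda>w. f (tw (int n) 0 0 w)) L \<Longrightarrow> K * n \<le> L + C"
    using g by (auto simp: grows_def)
  have "speed_seq d Tinv (eq_class d f) \<longlonglongrightarrow> real K"
  proof (rule real_tendsto_sandwich)
    let ?N = "\<lambda>n. class_norm d (eq_class d (\<lambda>w. f (tw (int n) 0 0 w)))"
    have seq: "speed_seq d Tinv (eq_class d f) n = real (?N n) / real n" for n
      by (simp add: speed_seq_def Tinv_def act_power[OF d])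
    have up: "real (?N n) \<le> real K * real n + real C" for n
      using class_norm_props(1)[OF C(1), of n] by (metis of_nat_add of_nat_le_iff of_nat_mult)
    have low: "real K * real n - real C \<le> real (?N n)" for n
    proof -
      have "K * n \<le> ?N n + C" by (rule C(2)[OF class_norm_props(2)[OF C(1)]])
      then have "real (K * n) \<le> real (?N n + C)" by (simp only: of_nat_le_iff)
      then show ?thesis by simp
    qed
    show "\<forall>\<^sub>F n in sequentially. real K - real C / real n \<le> speed_seq d Tinv (eq_class d f) n"
      using eventually_gt_at_top[of 0]
    proof eventually_elim
      case (elim n)
      have "real K - real C / real n = (real K * real n - real C) / real n"
        using elim by (simp add: diff_divide_distrib)
      then show ?case unfolding seq using divide_right_mono[OF low[of n], of "real n"] by simp
    qed
    show "\<forall>\<^sub>F n in sequentially. speed_seq d Tinv (eq_class d f) n \<le> real K + real C / real n"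
      using eventually_gt_at_top[of 0]
    proof eventually_elim
      case (elim n)
      have "real K + real C / real n = (real K * real n + real C) / real n"
        using elim by (simp add: add_divide_distrib)
      then show ?case unfolding seq using divide_right_mono[OF up[of n], of "real n"] by simp
    qed
    have z: "(\<lambda>n. real C / real n) \<longlonglongrightarrow> 0" by (rule lim_const_over_n)
    show "(\<lambda>n. real K - real C / real n) \<longlonglongrightarrow> real K" using tendsto_diff[OF tendsto_const z, of "real K"] by simp
    show "(\<lambda>n. real K + real C / real n) \<longlonglongrightarrow> real K" using tendsto_add[OF tendsto_const z, of "real K"] by simp
  qed
  then show "speed_exists d Tinv (eq_class d f)" "speed d Tinv (eq_class d f) = real K"
    by (auto simp: speed_exists_def speed_def convergent_def limI)
qed

section \<open>The rotation and the exponent sum of b\<close>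

lemma phi_letter_Cons:
  "phi [x] (y # w) = of_bool (y = x) - of_bool (y = letter_inv x) + phi [x] w"
  by (auto simp: phi_def word_inv_def occ_Cons)

lemma phi_letter_append: "phi [x] (u @ v) = phi [x] u + phi [x] v"
  by (induction u) (simp_all add: phi_letter_Cons, simp add: phi_def word_inv_def occ_Nil)

lemma phi_letter_Nil [simp]: "phi [x] [] = 0"
  by (simp add: phi_def word_inv_def occ_Nil)

lemma phi_b_bpow: "phi [(2, True)] (bpow k) = real_of_int k"
proof -
  have "phi [(2, True)] (replicate m (2, c)) = (if c then real m else - real m)" for m c
    by (induction m) (auto simp: phi_letter_Cons)
  then show ?thesis by (auto simp: bpow_def)
qed

text \<open>The exponent sum of \<open>b\<close> grows by that of \<open>a\<close> with each application of \<open>T\<close>, hence its norm remains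
  at most \<open>1\<close>.\<close>

lemma phi_b_tw:
  "phi [(2, True)] (tw n e k w)
    = phi [(2, True)] w + real_of_int n * phi [(1, True)] w + real_of_int k - real_of_int n * real_of_int e"
proof (induction w arbitrary: k)
  case Nil
  then show ?case by (simp add: phi_b_bpow)
next
  case (Cons x w)
  show ?case
  proof (cases "bletter x")
    case True
    then show ?thesis using Cons bletter_cases[OF True] by (auto simp: phi_letter_Cons)
  next
    case False
    then have "x \<noteq> (2, True)" "x \<noteq> (2, False)" by auto
    then show ?thesis using Cons False
      by (auto simp: phi_letter_Cons phi_letter_append phi_b_bpow is_a_def is_a_inv_def algebra_simps)
  qed
qed

lemma norm_le_phi: "v \<in> nontriv d \<Longrightarrow> length v \<le> L \<Longrightarrow> norm_le d (phi v) L"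
  unfolding norm_le_def phi_def[abs_def]
  by (intro in_span_minus in_span_occ) (auto simp: nontriv_iff carrier_inv)

lemma letter_nontriv: "d \<ge> 2 \<Longrightarrow> x \<in> letters d \<Longrightarrow> [x] \<in> nontriv d"
  by (simp add: nontriv_iff carrier_iff)

lemma norm_le_phi_b_twist:
  assumes "d \<ge> 2"
  shows "norm_le d (\<lambda>w. phi [(2, True)] (tw n 0 0 w)) 1"
proof -
  have "(2, True) \<in> letters d" "(1, True) \<in> letters d" using assms by (auto simp: letters_def)
  then have "norm_le d (\<lambda>w. phi [(2, True)] w + real_of_int n * phi [(1, True)] w) 1"
    using assms by (intro norm_le_add norm_le_scale norm_le_phi letter_nontriv) simp_all
  then show ?thesis by (simp add: phi_b_tw)
qed

text \<open>The contribution of \<open>rot\<close> before antisymmetrisation.\<close>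

definition rot_count :: "nat \<Rightarrow> word \<Rightarrow> real" where
  "rot_count d w = occ [(1, True), (2, True)] w - (\<Sum>s\<in>nonb d - {(1, False)}. occ [(2, True), s] w)"

lemma rot_letters: "letters d - {(2, True), (2, False)} - {(1, False)} = nonb d - {(1, False)}"
  by (auto simp: bletter_def)

lemma rot_eq: "rot d w = rot_count d w - rot_count d (word_inv w)"
  unfolding rot_def rot_letters rot_count_def phi_def occ_word_inv by (simp add: sum_subtractf)

lemma core_letter: "s \<in> nonb d \<Longrightarrow> core d [s]"
  by (simp add: core_def carrier_iff)

lemma core_shift_letter: "\<not> bletter s \<Longrightarrow> core_shift n [s] = [s]"
  by (simp add: core_shift_Cons)

lemma sum_left_choices:
  "(\<Sum>l\<in>left_choices d n True s. g l) = g (bpow (bsign s))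
    + (\<Sum>t\<in>{t \<in> nonb d. stretched t s}. \<Sum>i\<in>{1 - int n..0}. (g (t # bpow (bsign s * i)) :: real))"
proof -
  let ?A = "{t \<in> nonb d. stretched t s} \<times> {1 - int n..0}"
  let ?h = "\<lambda>(t, i). t # bpow (bsign s * i)"
  have "bpow (bsign s) \<notin> ?h ` ?A" by (auto simp: bsign_def)
  moreover have "inj_on ?h ?A" by (auto simp: inj_on_def)
  ultimately show ?thesis
    by (simp add: left_choices_def sum.reindex sum.cartesian_product case_prod_unfold)
qed

text \<open>The expansion of \<open>ab\<close> contributes the words \<open>a b\<^sup>i s\<close> for all \<open>s \<noteq> a\<inverse>\<close>, and so do the expansions of
  all the \<open>bs\<close> together; in the difference they cancel.\<close>

lemma rot_count_twist:
  assumes d: "d \<ge> 2"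
  shows "equivalent d (\<lambda>w. rot_count d (tw (int n) 0 0 w)) (rot_count d)"
proof -
  let ?N = "nonb d - {(1, False)}"
  let ?I = "{1 - int n..0}"
  have a: "(1, True) \<in> nonb d" using d by (simp add: letters_def)
  have "equivalent d (\<lambda>w. occ (with_ends False [(1, True)] True) (tw (int n) 0 0 w))
      (\<lambda>w. \<Sum>l\<in>left_choices d n False (1, True). \<Sum>r\<in>right_choices d n True (1, True).
        occ (l @ [(1, True)] @ r) w)"
    using occ_with_ends_twist[OF d core_letter[OF a], of False True n] by (simp add: core_shift_letter)
  moreover have "(\<Sum>l\<in>left_choices d n False (1, True). \<Sum>r\<in>right_choices d n True (1, True).
        occ (l @ [(1, True)] @ r) w)
      = occ [(1, True), (2, True)] w + (\<Sum>s\<in>?N. \<Sum>i\<in>?I. occ ([(1, True)] @ bpow i @ [s]) w)" for w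
  proof -
    have "(\<Sum>r\<in>right_choices d n True (1, True). occ ([(1, True)] @ r) w)
        = (\<Sum>l\<in>left_choices d n True (1, False). occ ([(1, True)] @ word_inv l) w)"
      unfolding right_choices_def by (subst sum.reindex[OF inj_word_inv]) simp
    also have "\<dots> = occ [(1, True), (2, True)] w
        + (\<Sum>t\<in>{t \<in> nonb d. stretched t (1, False)}. \<Sum>i\<in>?I. occ ([(1, True)] @ bpow i @ [letter_inv t]) w)"
      by (simp add: sum_left_choices bsign_def word_inv_Cons)
    also have "(\<Sum>t\<in>{t \<in> nonb d. stretched t (1, False)}. \<Sum>i\<in>?I. occ ([(1, True)] @ bpow i @ [letter_inv t]) w)
        = (\<Sum>s\<in>?N. \<Sum>i\<in>?I. occ ([(1, True)] @ bpow i @ [s]) w)"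
      by (rule sum.reindex_bij_witness[of _ letter_inv letter_inv]) (auto simp: stretched_def letter_inv_def letters_def bletter_def)
    finally show ?thesis by (simp add: left_choices_def)
  qed
  moreover have "with_ends False [(1, True)] True = [(1, True), (2, True)]"
    by (simp add: with_ends_def b_end_def bsign_def word_inv_Cons)
  ultimately have A: "equivalent d (\<lambda>w. occ [(1, True), (2, True)] (tw (int n) 0 0 w))
      (\<lambda>w. occ [(1, True), (2, True)] w + (\<Sum>s\<in>?N. \<Sum>i\<in>?I. occ ([(1, True)] @ bpow i @ [s]) w))"
    by simp
  have B: "equivalent d (\<lambda>w. occ [(2, True), s] (tw (int n) 0 0 w))
      (\<lambda>w. occ [(2, True), s] w + (\<Sum>i\<in>?I. occ ([(1, True)] @ bpow i @ [s]) w))" if s: "s \<in> ?N" for s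
  proof -
    have "{t \<in> nonb d. stretched t s} = {(1, True)}" using s a by (auto simp: stretched_def)
    moreover have "bsign s = 1" using s by (auto simp: bsign_def)
    moreover have "right_choices d n False s = {[]}" by (simp add: right_choices_def left_choices_def)
    moreover have "with_ends True [s] False = [(2, True), s]" using \<open>bsign s = 1\<close> by (simp add: with_ends_def b_end_def)
    ultimately show ?thesis
      using occ_with_ends_twist[OF d core_letter, of s True False n] s by (simp add: core_shift_letter sum_left_choices)
  qed
  have "equivalent d
     (\<lambda>w. occ [(1, True), (2, True)] (tw (int n) 0 0 w)
        + (-1) * (\<Sum>s\<in>?N. occ [(2, True), s] (tw (int n) 0 0 w)))
     (\<lambda>w. occ [(1, True), (2, True)] w + (\<Sum>s\<in>?N. \<Sum>i\<in>?I. occ ([(1, True)] @ bpow i @ [s]) w)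
        + (-1) * (\<Sum>s\<in>?N. occ [(2, True), s] w + (\<Sum>i\<in>?I. occ ([(1, True)] @ bpow i @ [s]) w)))"
    by (intro equivalent_add equivalent_scale equivalent_sum A B)
  then show ?thesis by (simp add: rot_count_def[abs_def] sum.distrib)
qed

lemma rot_words_normal:
  assumes d: "d \<ge> 2"
  shows "[(1, True), (2, True)] \<in> normal_words d"
    "s \<in> nonb d - {(1, False)} \<Longrightarrow> [(2, True), s] \<in> normal_words d"
proof -
  have "(1, True) \<in> nonb d" using d by (simp add: letters_def)
  then have "core d [(1, True)]" by (rule core_letter)
  moreover have "[(1, True), (2, True)] = with_ends False [(1, True)] True"
    by (simp add: with_ends_def b_end_def bsign_def word_inv_Cons)
  ultimately show "[(1, True), (2, True)] \<in> normal_words d" unfolding normal_words_def by blast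
  assume s: "s \<in> nonb d - {(1, False)}"
  then have "core d [s]" using core_letter by blast
  moreover have "[(2, True), s] = with_ends True [s] False" using s by (auto simp: with_ends_def b_end_def bsign_def)
  ultimately show "[(2, True), s] \<in> normal_words d" unfolding normal_words_def by blast
qed

lemma norm_le_rot_twist:
  assumes d: "d \<ge> 2"
  shows "norm_le d (\<lambda>w. rot d (tw (int n) 0 0 w)) 2"
proof -
  have nt: "v \<in> nontriv d" if "v \<in> normal_words d" for v using that normal_words_nontriv[OF d] by blast
  have "norm_le d (rot d) 2" unfolding norm_le_def rot_def[abs_def] rot_letters
    by (intro in_span_minus in_span_sum norm_le_phi[unfolded norm_le_def])
      (use rot_words_normal[OF d] nt in auto)
  moreover have "equivalent d (\<lambda>w. rot d (tw (int n) 0 0 w)) (rot d)"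
  proof -
    have "equivalent d (\<lambda>w. rot_count d (tw (int n) 0 0 w) + (-1) * rot_count d (tw (int n) 0 0 (word_inv w)))
        (\<lambda>w. rot_count d w + (-1) * rot_count d (word_inv w))"
      by (intro equivalent_add equivalent_scale rot_count_twist[OF d]
          equivalent_comp[OF rot_count_twist[OF d]]) (simp add: carrier_inv)
    then show ?thesis
    proof (rule equivalent_cong)
      fix w assume "w \<in> F d"
      then have "word_inv (tw (int n) 0 0 w) = tw (int n) 0 0 (word_inv w)"
        using tw_word_inv[of w "int n" 0 0] by (simp add: carrier_iff)
      then show "rot_count d (tw (int n) 0 0 w) + (-1) * rot_count d (tw (int n) 0 0 (word_inv w))
          = rot d (tw (int n) 0 0 w)" by (simp add: rot_eq)
    qed (simp add: rot_eq)
  qed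
  ultimately show ?thesis by (rule norm_le_equiv)
qed

section \<open>Antisymmetric sums of normal words\<close>

text \<open>The words \<open>b\<close> and \<open>b\<inverse>\<close> have degree \<open>2\<close> in the sense of \<open>degree\<close>, but speed zero.\<close>

definition rate :: "nat \<Rightarrow> word \<Rightarrow> nat" where
  "rate d v = (if v \<in> normal_words d then degree v else 0)"

lemma normal_words_inv_iff: "word_inv v \<in> normal_words d \<longleftrightarrow> v \<in> normal_words d"
  using normal_words_inv[of v d] normal_words_inv[of "word_inv v" d] by auto

lemma rate_inv: "v \<noteq> [] \<Longrightarrow> rate d (word_inv v) = rate d v"
  by (simp add: rate_def normal_words_inv_iff degree_inv)

lemma phi_word_inv: "phi (word_inv v) w = - phi v w"
  by (simp add: phi_def)

text \<open>For antisymmetric coefficients the sum of the quasimorphisms is twice the sum of the counting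
  functions with the same coefficients. So no coefficient is lost in passing to counting functions, and
  the degree of the sum is the maximum over the support.\<close>

lemma grows_antisymmetric:
  assumes d: "d \<ge> 2" and V: "finite V" "V \<subseteq> basic_words d" "\<And>v. v \<in> V \<Longrightarrow> word_inv v \<in> V"
    and anti: "\<And>v. \<beta> (word_inv v) = - \<beta> v" and ab: "\<beta> [(1, True), (2, True)] = 0"
  shows "grows d (phi_sum V \<beta>) (Max (insert 0 (rate d ` supp V \<beta>)))"
proof -
  let ?N = "V \<inter> normal_words d"
  let ?S = "supp V \<beta> \<inter> normal_words d"
  let ?b = "[(2, True)] :: word" and ?ab = "[(1, True), (2, True)] :: word"
  have "(\<Sum>v\<in>?N. \<beta> v * occ (word_inv v) w) = (\<Sum>v\<in>?N. - (\<beta> v * occ v w))" for w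
    by (rule sum.reindex_bij_witness[of _ word_inv word_inv])
      (use V(3) normal_words_inv anti in auto)
  then have "(\<Sum>v\<in>?N. \<beta> v * phi v w) = (\<Sum>v\<in>?N. 2 * \<beta> v * occ v w)" for w
    by (simp add: phi_def right_diff_distrib sum_subtractf sum_negf sum.distrib[symmetric] algebra_simps)
  moreover have "(\<Sum>v\<in>?N. 2 * \<beta> v * occ v w) = occ_sum ?S (\<lambda>v. 2 * \<beta> v) w" for w
    unfolding occ_sum_def using V(1) by (intro sum.mono_neutral_right) (auto simp: supp_def)
  ultimately have N: "(\<Sum>v\<in>?N. \<beta> v * phi v w) = occ_sum ?S (\<lambda>v. 2 * \<beta> v) w" for w by simp
  have split: "phi_sum V \<beta> w = occ_sum ?S (\<lambda>v. 2 * \<beta> v) w + (\<Sum>v\<in>V - ?N. \<beta> v * phi v w)" for w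
    unfolding N[symmetric] phi_sum_def using V(1) by (subst sum.subset_diff[of ?N V]) auto
  have "word_inv ?ab = [(2, False), (1, False)]" by (simp add: word_inv_Cons)
  then have "\<beta> [(2, False), (1, False)] = 0" using anti[of ?ab] ab by simp
  then have "grows d (occ_sum ?S (\<lambda>v. 2 * \<beta> v)) (Max (insert 0 (degree ` ?S)))"
    using V(1) ab by (intro grows_normal_words[OF d]) (auto simp: supp_def)
  moreover have "insert 0 (degree ` ?S) = insert 0 (rate d ` supp V \<beta>)"
    by (auto simp: rate_def image_iff)
  ultimately have g: "grows d (occ_sum ?S (\<lambda>v. 2 * \<beta> v)) (Max (insert 0 (rate d ` supp V \<beta>)))" by simp
  have b: "norm_le d (\<lambda>w. \<Sum>v\<in>V - ?N. \<beta> v * phi v (tw (int n) 0 0 w)) 1" for n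
    unfolding norm_le_def
  proof (intro in_span_sum in_span_scale)
    fix v assume "v \<in> V - ?N"
    then consider "v = ?b" | "v = word_inv ?b"
      using V(2) by (auto simp: basic_words_def word_inv_Cons)
    then show "in_span d {v \<in> nontriv d. length v \<le> 1} (\<lambda>w. phi v (tw (int n) 0 0 w))"
    proof cases
      case 1
      then show ?thesis using norm_le_phi_b_twist[OF d, of "int n"] by (simp add: norm_le_def)
    next
      case 2
      then show ?thesis using norm_le_scale[OF norm_le_phi_b_twist[OF d, of "int n"], of "-1"]
        by (simp only: norm_le_def phi_word_inv) simp
    qed
  qed
  show ?thesis
    by (rule grows_add_bounded[OF d g b]) (simp add: split[abs_def] equivalent_refl)
qed

lemma word_inv_neq: "reduced v \<Longrightarrow> v \<noteq> [] \<Longrightarrow> word_inv v \<noteq> v"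
proof (induction "length v" arbitrary: v rule: less_induct)
  case less
  obtain x r where v: "v = x # r" using less.prems by (cases v) auto
  show ?case
  proof (cases r rule: rev_cases)
    case Nil
    then show ?thesis by (simp add: v word_inv_Cons)
  next
    case (snoc m y)
    have m: "reduced m" using less.prems by (simp add: v snoc reduced_Cons reduced_append)
    show ?thesis
    proof
      assume "word_inv v = v"
      then have e: "y = letter_inv x" "word_inv m = m"
        by (auto simp: v snoc word_inv_append word_inv_Cons)
      then have "m = []" using less.hyps[of m] m by (auto simp: v snoc)
      then show False using less.prems e by (simp add: v snoc reduced_Cons)
    qed
  qed
qed

lemma basic_words_inv: "v \<in> basic_words d \<Longrightarrow> word_inv v \<in> basic_words d"
  by (auto simp: basic_words_def normal_words_inv word_inv_Cons)

lemma basic_words_nontriv: "d \<ge> 2 \<Longrightarrow> basic_words d \<subseteq> nontriv d"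
  using normal_words_nontriv by (auto simp: basic_words_def letters_def intro!: letter_nontriv)

text \<open>The antisymmetric representation of a single counting quasimorphism has the coefficients
  \<open>\<plusminus>1/2\<close>; the two words differ because no non-trivial reduced word is its own inverse.\<close>

lemma grows_phi:
  assumes d: "d \<ge> 2" and v: "v \<in> basic_words d" "v \<noteq> [(1, True), (2, True)]" "word_inv v \<noteq> [(1, True), (2, True)]"
  shows "grows d (phi v) (rate d v)"
proof -
  define \<beta> where "\<beta> u = (if u = v then 1 / 2 else if u = word_inv v then - 1 / 2 else 0 :: real)" for u
  have vF: "v \<in> nontriv d" using v(1) basic_words_nontriv[OF d] by blast
  then have ne: "word_inv v \<noteq> v" "v \<noteq> []" using word_inv_neq by (auto simp: nontriv_iff carrier_iff)
  have anti: "\<beta> (word_inv u) = - \<beta> u" for u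
  proof -
    have "word_inv u = v \<longleftrightarrow> u = word_inv v" "word_inv u = word_inv v \<longleftrightarrow> u = v"
      by (metis word_inv_inv)+
    then show ?thesis unfolding \<beta>_def using ne(1) by (simp split: if_split)
  qed
  have "grows d (phi_sum {v, word_inv v} \<beta>) (Max (insert 0 (rate d ` supp {v, word_inv v} \<beta>)))"
  proof (rule grows_antisymmetric[OF d])
    show "\<beta> (word_inv u) = - \<beta> u" for u by (rule anti)
    show "{v, word_inv v} \<subseteq> basic_words d" using v(1) basic_words_inv by blast
    show "\<beta> [(1, True), (2, True)] = 0" using v(2,3) by (simp add: \<beta>_def)
  qed auto
  moreover have "phi_sum {v, word_inv v} \<beta> = phi v"
    using ne by (simp add: fun_eq_iff phi_sum_def \<beta>_def phi_word_inv)
  moreover have "supp {v, word_inv v} \<beta> = {v, word_inv v}" by (auto simp: supp_def \<beta>_def)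
  ultimately show ?thesis using ne(2) by (simp add: rate_inv)
qed

lemma speed_reduced_antisymmetric:
  assumes d: "d \<ge> 2" and V: "finite V" "V \<subseteq> basic_words d" "\<And>v. v \<in> V \<Longrightarrow> word_inv v \<in> V"
    and anti: "\<And>v. \<beta> (word_inv v) = - \<beta> v" and ab: "\<beta> [(1, True), (2, True)] = 0"
  shows "speed_reduced d (inv\<^bsub>AutoGroup (free_group d)\<^esub> (twist d)) V \<beta>"
proof -
  let ?T = "inv\<^bsub>AutoGroup (free_group d)\<^esub> (twist d)"
  let ?S = "supp V \<beta>"
  have S: "finite ?S" using V(1) by (simp add: supp_def)
  have g: "grows d (phi v) (rate d v)" if v: "v \<in> ?S" for v
  proof (rule grows_phi[OF d])
    show "v \<in> basic_words d" using v V(2) by (auto simp: supp_def)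
    show "v \<noteq> [(1, True), (2, True)]" "word_inv v \<noteq> [(1, True), (2, True)]"
      using v ab anti[of v] by (auto simp: supp_def)
  qed
  have "(SUP v\<in>?S. speed d ?T (eq_class d (phi v))) = real (Max (insert 0 (rate d ` ?S)))" if "?S \<noteq> {}"
  proof -
    have "(\<lambda>v. speed d ?T (eq_class d (phi v))) ` ?S = (\<lambda>v. real (rate d v)) ` ?S"
      by (rule image_cong) (simp_all add: grows_speed(2)[OF d g])
    then have "(SUP v\<in>?S. speed d ?T (eq_class d (phi v))) = Max ((\<lambda>v. real (rate d v)) ` ?S)"
      using S that by (simp add: cSup_eq_Max)
    also have "\<dots> = real (Max (rate d ` ?S))"
      using mono_Max_commute[of real "rate d ` ?S"] S that by (simp add: mono_def image_image)
    also have "Max (rate d ` ?S) = Max (insert 0 (rate d ` ?S))" using S that by simp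
    finally show ?thesis .
  qed
  then show ?thesis
    using grows_speed[OF d grows_antisymmetric[OF assms]] grows_speed(1)[OF d g]
    by (auto simp: speed_reduced_def)
qed

section \<open>The decomposition\<close>

lemma in_span_phi_sum:
  assumes "in_span d A f"
  shows "\<exists>J \<alpha>. finite J \<and> J \<subseteq> A \<and> equivalent d (\<lambda>w. f w - f (word_inv w)) (phi_sum J \<alpha>)"
proof -
  obtain J \<alpha> where J: "finite J" "J \<subseteq> A" "equivalent d f (occ_sum J \<alpha>)"
    using assms by (auto simp: in_span_def)
  have "equivalent d (\<lambda>w. f w + (-1) * f (word_inv w))
      (\<lambda>w. occ_sum J \<alpha> w + (-1) * occ_sum J \<alpha> (word_inv w))"
    by (rule equivalent_add[OF J(3) equivalent_scale[OF equivalent_comp[OF J(3)]]]) (simp add: carrier_inv)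
  moreover have "(\<lambda>w. occ_sum J \<alpha> w + (-1) * occ_sum J \<alpha> (word_inv w)) = phi_sum J \<alpha>"
    by (simp add: phi_sum_def[abs_def] phi_def occ_sum_def occ_word_inv right_diff_distrib sum_subtractf)
  ultimately show ?thesis using J by auto
qed

lemma phi_sum_basic_words:
  assumes d: "d \<ge> 2" and I: "I \<subseteq> nontriv d"
  shows "\<exists>J a. finite J \<and> J \<subseteq> basic_words d \<and> equivalent d (phi_sum I \<alpha>) (phi_sum J a)"
proof -
  have "in_span d (basic_words d) (occ_sum I \<alpha>)"
    unfolding occ_sum_def[abs_def] using I span_basic_words[OF d] by (intro in_span_sum in_span_scale) auto
  moreover have "(\<lambda>w. occ_sum I \<alpha> w - occ_sum I \<alpha> (word_inv w)) = phi_sum I \<alpha>"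
    by (simp add: phi_sum_def[abs_def] phi_def occ_sum_def occ_word_inv right_diff_distrib sum_subtractf)
  ultimately show ?thesis using in_span_phi_sum[of d "basic_words d" "occ_sum I \<alpha>"] by simp
qed

text \<open>The coefficients of \<open>v\<close> and \<open>v\<inverse>\<close> are redistributed, as \<open>\<phi>v\<inverse> = - \<phi>v\<close>.\<close>

lemma antisymmetrise:
  assumes "\<And>v. v \<in> V \<Longrightarrow> word_inv v \<in> V"
  shows "phi_sum V (\<lambda>v. (a v - a (word_inv v)) / 2) = phi_sum V a"
proof
  fix w
  have "(\<Sum>v\<in>V. a (word_inv v) * phi v w) = (\<Sum>v\<in>V. - (a v * phi v w))"
    by (rule sum.reindex_bij_witness[of _ word_inv word_inv]) (use assms phi_word_inv in auto)
  then show "phi_sum V (\<lambda>v. (a v - a (word_inv v)) / 2) w = phi_sum V a w"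
    by (simp add: phi_sum_def left_diff_distrib diff_divide_distrib sum_subtractf sum_negf
        sum_divide_distrib[symmetric])
qed

lemma phi_sum_rot:
  assumes d: "d \<ge> 2" and V: "finite V" "[(1, True), (2, True)] \<in> V"
    "\<And>s. s \<in> nonb d - {(1, False)} \<Longrightarrow> [(2, True), s] \<in> V"
  shows "phi_sum V (\<lambda>v. if v = [(1, True), (2, True)] then 1
      else if v \<in> (\<lambda>s. [(2, True), s]) ` (nonb d - {(1, False)}) then - 1 else 0) = rot d"
proof
  fix w
  let ?R = "(\<lambda>s. [(2, True), s]) ` (nonb d - {(1, False)})" and ?ab = "[(1, True), (2, True)] :: word"
  let ?\<rho> = "\<lambda>v. if v = ?ab then 1 else if v \<in> ?R then - 1 else (0 :: real)"
  have "phi_sum V ?\<rho> w = (\<Sum>v\<in>insert ?ab ?R. ?\<rho> v * phi v w)"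
    unfolding phi_sum_def using V by (intro sum.mono_neutral_right) auto
  also have "\<dots> = phi ?ab w + (\<Sum>v\<in>?R. ?\<rho> v * phi v w)" by (subst sum.insert) auto
  also have "(\<Sum>v\<in>?R. ?\<rho> v * phi v w) = (\<Sum>v\<in>?R. - phi v w)" by (rule sum.cong) auto
  also have "\<dots> = - (\<Sum>s\<in>nonb d - {(1, False)}. phi [(2, True), s] w)"
    by (subst sum.reindex) (auto simp: inj_on_def sum_negf)
  finally show "phi_sum V ?\<rho> w = rot d w" unfolding rot_def rot_letters by simp
qed

theorem corollary6p30:
  fixes d :: nat and I :: "word set" and \<alpha> :: "word \<Rightarrow> real"
    and Tinv :: "word \<Rightarrow> word" and f :: "word \<Rightarrow> real"
  defines "Tinv \<equiv> inv\<^bsub>AutoGroup (free_group d)\<^esub> (twist d)"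
    and "f \<equiv> phi_sum I \<alpha>"
  assumes "d \<ge> 2" and "finite I" and "I \<subseteq> nontriv d"
  shows "\<exists>(r::real) J \<beta>.
           finite J \<and> J \<subseteq> nontriv d \<and>
           equivalent d f (\<lambda>w. r * rot d w + phi_sum J \<beta> w) \<and>
           speed_reduced d Tinv J \<beta> \<and>
           speed_exists d Tinv (eq_class d f) \<and>
           speed d Tinv (eq_class d f) = speed d Tinv (eq_class d (phi_sum J \<beta>))"
proof -
  note d = \<open>d \<ge> 2\<close>
  let ?ab = "[(1, True), (2, True)] :: word"
  let ?R = "(\<lambda>s. [(2, True), s]) ` (nonb d - {(1, False)})"
  obtain J0 a0 where J0: "finite J0" "J0 \<subseteq> basic_words d" "equivalent d f (phi_sum J0 a0)"
    using phi_sum_basic_words[OF d \<open>I \<subseteq> nontriv d\<close>] unfolding f_def by blast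
  define J where "J = (J0 \<union> insert ?ab ?R) \<union> word_inv ` (J0 \<union> insert ?ab ?R)"
  define a where "a v = (if v \<in> J0 then a0 v else 0)" for v
  define \<rho> where "\<rho> v = (if v = ?ab then 1 else if v \<in> ?R then - 1 else (0 :: real))" for v
  \<comment> \<open>The multiple of \<open>rot\<close> for which \<open>ab\<close> and its inverse drop out after antisymmetrisation.\<close>
  define r where "r = a ?ab - a (word_inv ?ab)"
  define \<beta> where "\<beta> v = ((a v - r * \<rho> v) - (a (word_inv v) - r * \<rho> (word_inv v))) / 2" for v
  have "insert ?ab ?R \<subseteq> basic_words d" using rot_words_normal[OF d] by (auto simp: basic_words_def)
  then have J: "finite J" "J \<subseteq> basic_words d" "\<And>v. v \<in> J \<Longrightarrow> word_inv v \<in> J"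
    using J0 basic_words_inv by (auto simp: J_def)
  have anti: "\<beta> (word_inv v) = - \<beta> v" for v by (simp add: \<beta>_def field_simps)
  have ab: "\<beta> ?ab = 0" by (simp add: \<beta>_def r_def \<rho>_def word_inv_Cons image_iff)
  have "phi_sum J \<rho> = rot d" unfolding \<rho>_def by (rule phi_sum_rot[OF d J(1)]) (auto simp: J_def)
  moreover have "phi_sum J a = phi_sum J0 a0"
    unfolding phi_sum_def a_def using J(1) by (intro ext sum.mono_neutral_cong_right) (auto simp: J_def)
  moreover have "phi_sum J \<beta> = phi_sum J (\<lambda>v. a v - r * \<rho> v)"
    unfolding \<beta>_def by (rule antisymmetrise) (rule J(3))
  moreover have "phi_sum J (\<lambda>v. a v - r * \<rho> v) w = phi_sum J a w - r * phi_sum J \<rho> w" for w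
    by (simp add: phi_sum_def left_diff_distrib sum_subtractf sum_distrib_left mult.assoc)
  ultimately have eq: "equivalent d f (\<lambda>w. r * rot d w + phi_sum J \<beta> w)" using J0(3) by simp
  have g: "grows d (phi_sum J \<beta>) (Max (insert 0 (rate d ` supp J \<beta>)))"
    by (rule grows_antisymmetric[OF d J anti ab])
  have "norm_le d (\<lambda>w. r * rot d (tw (int n) 0 0 w)) 2" for n
    by (rule norm_le_scale[OF norm_le_rot_twist[OF d]])
  from grows_add_bounded[OF d g this] have "grows d f (Max (insert 0 (rate d ` supp J \<beta>)))"
    using eq by (simp add: add.commute)
  from grows_speed[OF d this] grows_speed[OF d g]
  have "speed_exists d Tinv (eq_class d f)"
    "speed d Tinv (eq_class d f) = speed d Tinv (eq_class d (phi_sum J \<beta>))"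
    unfolding Tinv_def by simp_all
  moreover have "speed_reduced d Tinv J \<beta>"
    unfolding Tinv_def by (rule speed_reduced_antisymmetric[OF d J anti ab])
  ultimately show ?thesis using J eq basic_words_nontriv[OF d] by blast
qed

end
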